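(* Let $\mathscr{M}_D$ be the Dyment lattice and $\mathscr{M}_{D,w}$ the Dyment-Muchnik lattice. Then $\operatorname{Th}(\mathscr{M}_{D})=\operatorname{Th}(\mathscr{M}_{D,w})=\mathrm{JAN}$.
   Context: $\mathcal{P}$ is the set of all partial functions from $\omega$ to $\omega$. An enumeration operator ($e$-operator) is a map $\Phi:2^\omega\to 2^\omega$ given by a c.e. set $W$ via $\Phi(A)=\{x:(\exists u)[\langle x,u\rangle\in W\ \&\ D_u\subseteq A]\}$, $D_u$ being the finite set with canonical index $u$. $A\le_e B$ iff $A=\Phi(B)$ for some $e$-operator $\Phi$. For partial functions, $\varphi\le_e\psi$ iff $\operatorname{graph}(\varphi)\le_e\operatorname{graph}(\psi)$. An $e$-operator $\Phi$ induces a partial map on $\mathcal{P}$: $\Phi(\psi)$ is defined ($\psi\in\operatorname{domain}(\Phi)$) iff $\Phi(\operatorname{graph}(\psi))$ is the graph of a partial function, and then $\Phi(\psi)$ is that partial function. A $D$-mass problem is a subset of $\mathcal{P}$. $\mathcal{A}\le_D\mathcal{B}$ iff there is an $e$-operator $\Phi$ with $\mathcal{B}\subseteq\operatorname{domain}(\Phi)$ and $\Phi(\psi)\in\mathcal{A}$ for all $\psi\in\mathcal{B}$. $\mathcal{A}\le_{D,w}\mathcal{B}$ iff $(\forall\psi\in\mathcal{B})(\exists\varphi\in\mathcal{A})[\varphi\le_e\psi]$. The Dyment lattice $\mathscr{M}_D$ (resp. the Dyment-Muchnik lattice $\mathscr{M}_{D,w}$) is the set of equivalence classes of $D$-mass problems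 under the equivalence induced by $\le_D$ (resp. $\le_{D,w}$), with the induced partial order. Both are Brouwer algebras; in both, the least element is the class of any $D$-mass problem containing a partial computable function and the greatest element is the class of $\emptyset$. A Brouwer algebra is a lattice with $0\neq 1$ (least and greatest elements) such that for all $a,b$ the set $\{c: a\lor c\ge b\}$ has a least element, denoted $a\to b$. A propositional formula is an identity of a Brouwer algebra if every assignment of elements to its atoms evaluates it to $0$, where the connectives $\lor,\wedge,\to$ are interpreted by meet, join, and $\to$ respectively, and $\neg a$ by $a\to 1$. $\operatorname{Th}(\mathscr{L})$ is the set of identities of $\mathscr{L}$. $\mathrm{JAN}$ (Jankov logic) is the intermediate propositional logic obtained by adding to the intuitionistic propositional calculus the axiom scheme $\neg\alpha\lor\neg\neg\alpha$ (weak law of excluded middle), identified with its set of theorems. *)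

theory Defs
  imports "HOL-Algebra.Lattice" "HOL-Library.Nat_Bijection"
begin

section \<open>Computability\<close>

datatype recfn =
    Zero
  | Succ
  | Proj nat
  | Comp recfn "recfn list"
  | PrimRec recfn recfn
  | Mu recfn

text \<open>
  Partial recursive functions of all arities, acting on argument lists. The recursion variable
  and the search variable are the head of the list. A basic function applied to too few arguments
  is undefined; superfluous arguments are ignored.
\<close>

fun eval :: "recfn \<Rightarrow> nat list \<Rightarrow> nat option" where
  "eval Zero xs = Some 0"
| "eval Succ xs = (case xs of [] \<Rightarrow> None | x # _ \<Rightarrow> Some (Suc x))"
| "eval (Proj i) xs = (if i < length xs then Some (xs ! i) else None)"
| "eval (Comp f gs) xs =
    (let ys = map (\<lambda>g. eval g xs) gs in if None \<in> set ys then None else eval f (map the ys))"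
| "eval (PrimRec f g) xs =
    (case xs of
      [] \<Rightarrow> None
    | n # zs \<Rightarrow> rec_nat (eval f zs) (\<lambda>m r. Option.bind r (\<lambda>y. eval g (m # y # zs))) n)"
| "eval (Mu f) xs =
    (if \<exists>n. eval f (n # xs) = Some 0 \<and> (\<forall>m<n. eval f (m # xs) \<noteq> None)
     then Some (LEAST n. eval f (n # xs) = Some 0) else None)"

definition ce :: "nat set \<Rightarrow> bool" where
  "ce W \<longleftrightarrow> (\<exists>f. W = {x. eval f [x] \<noteq> None})"


section \<open>Enumeration operators\<close>

type_synonym pfun = "nat \<rightharpoonup> nat"

text \<open>\<^const>\<open>set_decode\<close> \<open>u\<close> is the finite set with canonical index \<open>u\<close>.\<close>

definition e_operator :: "(nat set \<Rightarrow> nat set) \<Rightarrow> bool" where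
  "e_operator \<Phi> \<longleftrightarrow>
    (\<exists>W. ce W \<and> (\<forall>A. \<Phi> A = {x. \<exists>u. prod_encode (x, u) \<in> W \<and> set_decode u \<subseteq> A}))"

definition e_le :: "nat set \<Rightarrow> nat set \<Rightarrow> bool" where
  "e_le A B \<longleftrightarrow> (\<exists>\<Phi>. e_operator \<Phi> \<and> A = \<Phi> B)"

definition gr :: "pfun \<Rightarrow> nat set" where
  "gr \<phi> = prod_encode ` Map.graph \<phi>"

definition pfun_e_le :: "pfun \<Rightarrow> pfun \<Rightarrow> bool" where
  "pfun_e_le \<phi> \<psi> \<longleftrightarrow> e_le (gr \<phi>) (gr \<psi>)"

text \<open>The induced map is well defined as \<^const>\<open>gr\<close> is injective.\<close>

definition pmap :: "(nat set \<Rightarrow> nat set) \<Rightarrow> pfun \<rightharpoonup> pfun" where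
  "pmap \<Phi> \<psi> =
    (if \<exists>\<phi>. \<Phi> (gr \<psi>) = gr \<phi> then Some (THE \<phi>. \<Phi> (gr \<psi>) = gr \<phi>) else None)"


section \<open>The Dyment and Dyment-Muchnik lattices\<close>

type_synonym mass_problem = "pfun set"

definition D_le :: "mass_problem \<Rightarrow> mass_problem \<Rightarrow> bool" where
  "D_le A B \<longleftrightarrow>
    (\<exists>\<Phi>. e_operator \<Phi> \<and> B \<subseteq> dom (pmap \<Phi>) \<and> (\<forall>\<psi>\<in>B. the (pmap \<Phi> \<psi>) \<in> A))"

definition Dw_le :: "mass_problem \<Rightarrow> mass_problem \<Rightarrow> bool" where
  "Dw_le A B \<longleftrightarrow> (\<forall>\<psi>\<in>B. \<exists>\<phi>\<in>A. pfun_e_le \<phi> \<psi>)"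

definition degrees :: "('a \<Rightarrow> 'a \<Rightarrow> bool) \<Rightarrow> 'a set gorder" where
  "degrees r =
    \<lparr> carrier = UNIV // {(a, b). r a b \<and> r b a},
      eq = (=),
      le = (\<lambda>X Y. \<exists>a\<in>X. \<exists>b\<in>Y. r a b) \<rparr>"

definition Dyment_lattice :: "mass_problem set gorder"  (\<open>\<M>\<^sub>D\<close>) where
  "\<M>\<^sub>D = degrees D_le"

definition Dyment_Muchnik_lattice :: "mass_problem set gorder"  (\<open>\<M>\<^sub>D\<^sub>w\<close>) where
  "\<M>\<^sub>D\<^sub>w = degrees Dw_le"


section \<open>Propositional formulas and Brouwer algebras\<close>

datatype form =
    Atom nat
  | Or form form  (infixr \<open>\<^bold>\<or>\<close> 65)
  | And form form  (infixr \<open>\<^bold>\<and>\<close> 70)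
  | Imp form form  (infixr \<open>\<^bold>\<rightarrow>\<close> 60)
  | Neg form  (\<open>\<^bold>\<not> _\<close> [80] 80)

text \<open>
  The order is dual to that of Heyting algebras: the least element interprets truth, disjunction
  is interpreted by meet and conjunction by join.
\<close>

locale brouwer_algebra = bounded_lattice L for L (structure) +
  assumes bottom_neq_top: "\<bottom> \<noteq> \<top>"
    and residual_exists: "\<lbrakk>a \<in> carrier L; b \<in> carrier L\<rbrakk>
      \<Longrightarrow> \<exists>c. least L c {c \<in> carrier L. b \<sqsubseteq> a \<squnion> c}"
begin

definition residual :: "'a \<Rightarrow> 'a \<Rightarrow> 'a" where
  "residual a b = (THE c. least L c {c \<in> carrier L. b \<sqsubseteq> a \<squnion> c})"

primrec value_of :: "(nat \<Rightarrow> 'a) \<Rightarrow> form \<Rightarrow> 'a" where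
  "value_of v (Atom i) = v i"
| "value_of v (\<alpha> \<^bold>\<or> \<beta>) = value_of v \<alpha> \<sqinter> value_of v \<beta>"
| "value_of v (\<alpha> \<^bold>\<and> \<beta>) = value_of v \<alpha> \<squnion> value_of v \<beta>"
| "value_of v (\<alpha> \<^bold>\<rightarrow> \<beta>) = residual (value_of v \<alpha>) (value_of v \<beta>)"
| "value_of v (\<^bold>\<not> \<alpha>) = residual (value_of v \<alpha>) \<top>"

definition identities :: "form set" where
  "identities = {\<alpha>. \<forall>v. range v \<subseteq> carrier L \<longrightarrow> value_of v \<alpha> = \<bottom>}"

end

abbreviation Th :: "('a, 'b) gorder_scheme \<Rightarrow> form set" where
  "Th \<equiv> brouwer_algebra.identities"


section \<open>Jankov logic\<close>

text \<open>A Hilbert calculus for intuitionistic propositional logic with additional axioms \<open>X\<close>.\<close>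

inductive_set IPC :: "form set \<Rightarrow> form set" for X where
  extra: "\<alpha> \<in> X \<Longrightarrow> \<alpha> \<in> IPC X"
| MP: "\<lbrakk>\<alpha> \<^bold>\<rightarrow> \<beta> \<in> IPC X; \<alpha> \<in> IPC X\<rbrakk> \<Longrightarrow> \<beta> \<in> IPC X"
| K: "\<alpha> \<^bold>\<rightarrow> (\<beta> \<^bold>\<rightarrow> \<alpha>) \<in> IPC X"
| S: "(\<alpha> \<^bold>\<rightarrow> (\<beta> \<^bold>\<rightarrow> \<gamma>)) \<^bold>\<rightarrow> ((\<alpha> \<^bold>\<rightarrow> \<beta>) \<^bold>\<rightarrow> (\<alpha> \<^bold>\<rightarrow> \<gamma>)) \<in> IPC X"
| conjE1: "(\<alpha> \<^bold>\<and> \<beta>) \<^bold>\<rightarrow> \<alpha> \<in> IPC X"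
| conjE2: "(\<alpha> \<^bold>\<and> \<beta>) \<^bold>\<rightarrow> \<beta> \<in> IPC X"
| conjI: "\<alpha> \<^bold>\<rightarrow> (\<beta> \<^bold>\<rightarrow> (\<alpha> \<^bold>\<and> \<beta>)) \<in> IPC X"
| disjI1: "\<alpha> \<^bold>\<rightarrow> (\<alpha> \<^bold>\<or> \<beta>) \<in> IPC X"
| disjI2: "\<beta> \<^bold>\<rightarrow> (\<alpha> \<^bold>\<or> \<beta>) \<in> IPC X"
| disjE: "(\<alpha> \<^bold>\<rightarrow> \<gamma>) \<^bold>\<rightarrow> ((\<beta> \<^bold>\<rightarrow> \<gamma>) \<^bold>\<rightarrow> ((\<alpha> \<^bold>\<or> \<beta>) \<^bold>\<rightarrow> \<gamma>)) \<in> IPC X"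
| negI: "(\<alpha> \<^bold>\<rightarrow> \<beta>) \<^bold>\<rightarrow> ((\<alpha> \<^bold>\<rightarrow> \<^bold>\<not> \<beta>) \<^bold>\<rightarrow> \<^bold>\<not> \<alpha>) \<in> IPC X"
| negE: "\<^bold>\<not> \<alpha> \<^bold>\<rightarrow> (\<alpha> \<^bold>\<rightarrow> \<beta>) \<in> IPC X"

definition JAN :: "form set" where
  "JAN = IPC {\<^bold>\<not> \<alpha> \<^bold>\<or> \<^bold>\<not> \<^bold>\<not> \<alpha> | \<alpha>. True}"

end

theory Submission
  imports Defs "HOL-Library.Countable"
begin

text \<open>
  In both lattices the greatest element is join-irreducible, so \<open>\<not>a\<close> is always \<open>0\<close> or \<open>1\<close> and the weak law
  of excluded middle is an identity.

  Conversely, a formula outside Jankov logic fails in a finite Kripke model with a least and a greatest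
  world. Such a poset is a p-morphic image of a finite cube \<open>Pow N\<close>, so it suffices to embed the up-sets of
  a cube. Choose sets \<open>a\<^sub>i\<close> such that no \<open>a\<^sub>i\<close> is enumeration reducible to the join \<open>b\<^sub>i\<close> of the others, and
  send an up-set \<open>U\<close> to the problem of finding, for some \<open>Z \<in> U\<close>, the set \<open>Z\<close> and a set \<open>S\<close> that is not
  reducible to \<open>b\<^sub>i\<close> for any \<open>i \<in> Z\<close>. For residuals in the Dyment lattice one must decide uniformly which
  \<open>Z\<close> an operator selects; this is possible because \<open>S\<close> is presented by the partial function with domain
  \<open>S\<close> and constant value \<open>0\<close>, and any two finite parts of such functions are compatible.
\<close>


section \<open>Total computable functions\<close>

text \<open>The residual dictates the encoding. Suppose that an element \<open>g\<close> of
  \<open>C\<close>, joined with any solution for \<open>U\<close>, yields a solution for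
  \<open>V\<close>. For each \<open>Z\<close> in \<open>U\<close> insert the canonical solution, the
  join of the a_i with i in \<open>Z\<close>. It is reducible to b_i for every i outside
  \<open>Z\<close>. If the answer names the world \<open>T\<close>, its set is not reducible to b_i
  for i in \<open>T - Z\<close>, so \<open>g\<close> cannot be either. Let \<open>Y\<close> be the
  union of these differences. Then \<open>g\<close>, read as a set, solves world \<open>Y\<close>,
  and \<open>Y \<union> Z\<close> contains \<open>T\<close>, hence lies in \<open>V\<close> for
  every \<open>Z\<close> in \<open>U\<close>: so \<open>Y\<close> belongs to the Heyting
  implication. The argument needs worlds with joins, which is why general frames are replaced by
  cubes; the same unions handle intersections of up-sets. Naming the world explicitly serves the
  uniform lattice. An enumeration operator sees only positive information and cannot revise its
  output, so a case distinction has to wait for one of finitely many mutually exclusive tags. The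
  choice of \<open>T\<close> for each \<open>Z\<close> is such a distinction, yet in general the
  canonical solution cannot be enumerated from \<open>g\<close>.\<close>

definition computable :: "nat \<Rightarrow> (nat list \<Rightarrow> nat) \<Rightarrow> bool" where
  "computable k F \<longleftrightarrow> (\<exists>f. \<forall>xs. length xs = k \<longrightarrow> eval f xs = Some (F xs))"

lemma computable_cong:
  "(\<And>xs. length xs = k \<Longrightarrow> F xs = G xs) \<Longrightarrow> computable k F \<longleftrightarrow> computable k G"
  unfolding computable_def by metis

lemma eval_Comp_eq:
  assumes "\<And>g. g \<in> set gs \<Longrightarrow> eval g xs = Some (h g)"
  shows "eval (Comp f gs) xs = eval f (map h gs)"
proof -
  have "map (\<lambda>g. eval g xs) gs = map (\<lambda>g. Some (h g)) gs" using assms by simp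
  then have "eval (Comp f gs) xs = eval f (map the (map (\<lambda>g. Some (h g)) gs))"
    by (simp only: eval.simps Let_def) (simp add: image_iff)
  then show ?thesis by (simp add: comp_def)
qed

lemma computable_nth: "i < k \<Longrightarrow> computable k (\<lambda>xs. xs ! i)"
  unfolding computable_def by (rule exI[of _ "Proj i"]) simp

lemma computable_comp:
  assumes "computable (length Gs) F" "\<And>G. G \<in> set Gs \<Longrightarrow> computable k G"
  shows "computable k (\<lambda>xs. F (map (\<lambda>G. G xs) Gs))"
proof -
  obtain f where f: "\<And>ys. length ys = length Gs \<Longrightarrow> eval f ys = Some (F ys)"
    using assms(1) by (auto simp: computable_def)
  have "\<exists>c. \<forall>G\<in>set Gs. \<forall>xs. length xs = k \<longrightarrow> eval (c G) xs = Some (G xs)"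
    using assms(2) by (intro bchoice) (auto simp: computable_def)
  then obtain c where c: "\<And>G xs. G \<in> set Gs \<Longrightarrow> length xs = k \<Longrightarrow> eval (c G) xs = Some (G xs)"
    by blast
  have "eval (Comp f (map c Gs)) xs = Some (F (map (\<lambda>G. G xs) Gs))" if "length xs = k" for xs
  proof -
    have "eval (Comp f (map c Gs)) xs = eval f (map (\<lambda>g. the (eval g xs)) (map c Gs))"
      using c that by (intro eval_Comp_eq) auto
    also have "map (\<lambda>g. the (eval g xs)) (map c Gs) = map (\<lambda>G. G xs) Gs"
      using c that by simp
    finally show ?thesis using f[of "map (\<lambda>G. G xs) Gs"] by simp
  qed
  then show ?thesis unfolding computable_def by blast
qed

lemma computable_comp1:
  assumes "computable (Suc 0) (\<lambda>xs. F (xs ! 0))" "computable k G"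
  shows "computable k (\<lambda>xs. F (G xs))"
  using computable_comp[of "[G]" "\<lambda>xs. F (xs ! 0)" k] assms by simp

lemma computable_Suc: "computable k G \<Longrightarrow> computable k (\<lambda>xs. Suc (G xs))"
proof -
  have "computable (Suc 0) (\<lambda>xs. Suc (xs ! 0))"
    unfolding computable_def by (rule exI[of _ "Succ"]) (auto split: list.split)
  then show "computable k G \<Longrightarrow> computable k (\<lambda>xs. Suc (G xs))" by (rule computable_comp1)
qed

lemma computable_const: "computable k (\<lambda>xs. c)"
proof (induction c)
  case 0
  then show ?case unfolding computable_def by (intro exI[of _ Zero]) simp
qed (rule computable_Suc)

lemma computable_drop_args:
  assumes "computable k F"
  shows "computable (m + k) (\<lambda>xs. F (drop m xs))"
proof -
  have *: "computable (m + k) (\<lambda>xs. F (map (\<lambda>G. G xs) (map (\<lambda>i xs. xs ! (m + i)) [0..<k])))"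
    using assms by (intro computable_comp) (auto intro!: computable_nth)
  have **: "drop m xs = map (\<lambda>i. xs ! (m + i)) [0..<k]" if "length xs = m + k" for xs
    using that by (intro nth_equalityI) auto
  show ?thesis
    by (rule iffD1[OF computable_cong *]) (simp add: ** comp_def)
qed

lemma computable_subst_args:
  assumes "computable (length Gs + k) F" "\<And>G. G \<in> set Gs \<Longrightarrow> computable k G"
  shows "computable k (\<lambda>xs. F (map (\<lambda>G. G xs) Gs @ xs))"
proof -
  have *: "computable k (\<lambda>xs. F (map (\<lambda>G. G xs) (Gs @ map (\<lambda>i xs. xs ! i) [0..<k])))"
    using assms by (intro computable_comp) (auto intro!: computable_nth)
  have **: "map (\<lambda>i. xs ! i) [0..<k] = xs" if "length xs = k" for xs :: "nat list"
    using that map_nth by blast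
  show ?thesis
    by (rule iffD1[OF computable_cong *]) (simp add: ** comp_def)
qed

text \<open>The shape of the recursive calls in \<open>computable_eval_bd\<close>: the head is the
  search bound, \<open>Gs\<close> are new leading arguments, and the remaining arguments are passed
  on unchanged.\<close>

lemma computable_subst_hd_drop:
  assumes "computable (Suc (length Gs + j)) (\<lambda>ys. F (hd ys) (tl ys))"
    "computable (m + j) n" "\<And>G. G \<in> set Gs \<Longrightarrow> computable (m + j) G"
  shows "computable (m + j) (\<lambda>xs. F (n xs) (map (\<lambda>G. G xs) Gs @ drop m xs))"
proof -
  let ?Gs = "n # Gs @ map (\<lambda>i xs. xs ! (m + i)) [0..<j]"
  have "computable (m + j) (\<lambda>xs. F (hd (map (\<lambda>G. G xs) ?Gs)) (tl (map (\<lambda>G. G xs) ?Gs)))"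
    by (rule computable_comp) (use assms in \<open>auto intro!: computable_nth\<close>)
  moreover have "map (\<lambda>i. xs ! (m + i)) [0..<j] = drop m xs" if "length xs = m + j" for xs :: "nat list"
    using that by (intro nth_equalityI) auto
  then have "F (hd (map (\<lambda>G. G xs) ?Gs)) (tl (map (\<lambda>G. G xs) ?Gs)) = F (n xs) (map (\<lambda>G. G xs) Gs @ drop m xs)"
    if "length xs = m + j" for xs :: "nat list"
    using that by (simp add: comp_def)
  ultimately show ?thesis by (rule iffD1[OF computable_cong, rotated])
qed

text \<open>\<open>PrimRec\<close> recurses on the head of its list and passes index, previous value
  and parameters to the step. The count \<open>n xs\<close> is put in front of the parameters by
  \<open>computable_subst_args\<close>.\<close>

lemma computable_rec:
  assumes "computable k a" "computable (Suc (Suc k)) (\<lambda>ys. s (ys ! 0) (ys ! 1) (drop 2 ys))"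
    "computable k n"
  shows "computable k (\<lambda>xs. rec_nat (a xs) (\<lambda>m r. s m r xs) (n xs))"
proof -
  obtain f where f: "\<And>xs. length xs = k \<Longrightarrow> eval f xs = Some (a xs)"
    using assms(1) by (auto simp: computable_def)
  obtain g where g: "\<And>ys. length ys = Suc (Suc k) \<Longrightarrow>
      eval g ys = Some (s (ys ! 0) (ys ! 1) (drop 2 ys))"
    using assms(2) by (auto simp: computable_def)
  have *: "rec_nat (eval f zs) (\<lambda>m r. Option.bind r (\<lambda>y. eval g (m # y # zs))) m
      = Some (rec_nat (a zs) (\<lambda>m r. s m r zs) m)" if "length zs = k" for zs m
    using that by (induction m) (auto simp: f g)
  have "eval (PrimRec f g) ys = Some (rec_nat (a (tl ys)) (\<lambda>m r. s m r (tl ys)) (hd ys))"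
    if "length ys = Suc k" for ys
    using that * by (cases ys) auto
  then have "computable (length [n] + k)
      (\<lambda>ys. rec_nat (a (tl ys)) (\<lambda>m r. s m r (tl ys)) (hd ys))"
    unfolding computable_def by (intro exI[of _ "PrimRec f g"]) simp
  from computable_subst_args[OF this] assms(3) show ?thesis by auto
qed

lemma computable_Least:
  assumes "computable (Suc k) (\<lambda>ys. p (ys ! 0) (tl ys))"
    and ex: "\<And>xs. length xs = k \<Longrightarrow> \<exists>n. p n xs = 0"
  shows "computable k (\<lambda>xs. LEAST n. p n xs = 0)"
proof -
  obtain f where f: "\<And>ys. length ys = Suc k \<Longrightarrow> eval f ys = Some (p (ys ! 0) (tl ys))"
    using assms(1) by (auto simp: computable_def)
  have "eval (Mu f) xs = Some (LEAST n. p n xs = 0)" if "length xs = k" for xs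
    using f[of "_ # xs"] ex[OF that] that by simp
  then show ?thesis unfolding computable_def by blast
qed

lemma computable_if:
  assumes "computable k c" "computable k a" "computable k b"
  shows "computable k (\<lambda>xs. if c xs = 0 then a xs else b xs)"
proof -
  have "computable k (\<lambda>xs. rec_nat (a xs) (\<lambda>m r. b xs) (c xs))"
    using assms(2) computable_drop_args[OF assms(3), of 2] assms(1)
    by (intro computable_rec) auto
  moreover have "(\<lambda>xs. rec_nat (a xs) (\<lambda>m r. b xs) (c xs)) = (\<lambda>xs. if c xs = 0 then a xs else b xs)"
  proof
    fix xs show "rec_nat (a xs) (\<lambda>m r. b xs) (c xs) = (if c xs = 0 then a xs else b xs)"
      by (cases "c xs") auto
  qed
  ultimately show ?thesis by simp
qed

lemma computable_pred:
  assumes "computable k F" shows "computable k (\<lambda>xs. F xs - 1)"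
proof -
  have "computable k (\<lambda>xs. rec_nat 0 (\<lambda>m r. m) (F xs))"
    by (intro computable_rec computable_const computable_nth assms) simp
  moreover have "rec_nat 0 (\<lambda>m r. m) n = n - 1" for n by (cases n) auto
  ultimately show ?thesis by simp
qed

lemmas computable_pred' = computable_pred[unfolded One_nat_def]

lemma computable_add:
  assumes "computable k F" "computable k G" shows "computable k (\<lambda>xs. F xs + G xs)"
proof -
  have "computable k (\<lambda>xs. rec_nat (F xs) (\<lambda>m r. Suc r) (G xs))"
    by (intro computable_rec computable_Suc computable_nth assms) simp
  moreover have "rec_nat m (\<lambda>_ r. Suc r) n = m + n" for m n by (induction n) auto
  ultimately show ?thesis by simp
qed

lemma computable_diff:
  assumes "computable k F" "computable k G" shows "computable k (\<lambda>xs. F xs - G xs)"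
proof -
  have "computable k (\<lambda>xs. rec_nat (F xs) (\<lambda>m r. r - 1) (G xs))"
    by (intro computable_rec computable_pred computable_nth assms) simp
  moreover have "rec_nat m (\<lambda>_ r. r - 1) n = m - n" for m n :: nat by (induction n) auto
  ultimately show ?thesis by simp
qed

text \<open>Prepares the pairing function, since \<open>prod_encode (m, n)\<close> is
  \<open>triangle (m + n) + m\<close>.\<close>

lemma computable_triangle:
  assumes "computable k F" shows "computable k (\<lambda>xs. triangle (F xs))"
proof -
  have "computable k (\<lambda>xs. rec_nat 0 (\<lambda>m r. r + Suc m) (F xs))"
    by (intro computable_rec computable_const computable_add computable_Suc computable_nth assms) auto
  moreover have "rec_nat 0 (\<lambda>m r. r + Suc m) n = triangle n" for n by (induction n) auto
  ultimately show ?thesis by simp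
qed


section \<open>Bounded evaluation\<close>

text \<open>
  The value \<open>0\<close> means that the search bound \<open>s\<close> is too small for the evaluation to converge,
  and \<open>Suc y\<close> that it converges with value \<open>y\<close>. Only unbounded search needs to be cut off; no coding
  of computations is required.
\<close>

fun eval_bd :: "recfn \<Rightarrow> nat \<Rightarrow> nat list \<Rightarrow> nat" where
  "eval_bd Zero s xs = 1"
| "eval_bd Succ s xs = (case xs of [] \<Rightarrow> 0 | x # _ \<Rightarrow> Suc (Suc x))"
| "eval_bd (Proj i) s xs = (if i < length xs then Suc (xs ! i) else 0)"
| "eval_bd (Comp f gs) s xs =
    (let ys = map (\<lambda>g. eval_bd g s xs) gs in
     if 0 \<in> set ys then 0 else eval_bd f s (map (\<lambda>y. y - 1) ys))"
| "eval_bd (PrimRec f g) s xs =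
    (case xs of
      [] \<Rightarrow> 0
    | n # zs \<Rightarrow> rec_nat (eval_bd f s zs) (\<lambda>m r. if r = 0 then 0 else eval_bd g s (m # (r - 1) # zs)) n)"
| "eval_bd (Mu f) s xs =
    (let n = (LEAST n. s \<le> n \<or> eval_bd f s (n # xs) \<le> 1) in
     if n < s \<and> eval_bd f s (n # xs) = 1 then Suc n else 0)"

lemma eval_bd_Comp_eq:
  assumes "\<And>g. g \<in> set gs \<Longrightarrow> eval_bd g s xs = Suc (h g)"
  shows "eval_bd (Comp f gs) s xs = eval_bd f s (map h gs)"
proof -
  have "map (\<lambda>g. eval_bd g s xs) gs = map (\<lambda>g. Suc (h g)) gs" using assms by simp
  then have "eval_bd (Comp f gs) s xs = eval_bd f s (map (\<lambda>y. y - 1) (map (\<lambda>g. Suc (h g)) gs))"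
    by (simp only: eval_bd.simps Let_def) (simp add: image_iff)
  then show ?thesis by (simp add: comp_def)
qed

lemma eval_bd_Comp_eq_Suc:
  assumes "eval_bd (Comp f gs) s xs = Suc y"
  shows "g \<in> set gs \<Longrightarrow> eval_bd g s xs = Suc (eval_bd g s xs - 1)"
    and "eval_bd f s (map (\<lambda>g. eval_bd g s xs - 1) gs) = Suc y"
  using assms by (auto simp: Let_def comp_def image_iff split: if_splits)

text \<open>The alternative \<open>s <= n\<close> makes the least number exist in every case, and
  the comparison with 1 stops the search both at a zero of \<open>f\<close> (value 1) and at a
  failure (value 0). The final test in \<open>eval_bd\<close> keeps only the first outcome.\<close>

lemma eval_bd_Mu_eq_Suc:
  "eval_bd (Mu f) s xs = Suc y \<longleftrightarrow>
    y < s \<and> eval_bd f s (y # xs) = 1 \<and> (\<forall>m<y. eval_bd f s (m # xs) > 1)"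
proof -
  define P where "P n \<longleftrightarrow> s \<le> n \<or> eval_bd f s (n # xs) \<le> 1" for n
  define n where "n = (LEAST n. P n)"
  have n: "P n" unfolding n_def by (rule LeastI[of _ s]) (simp add: P_def)
  have least: "\<not> P m" if "m < n" for m using not_less_Least that unfolding n_def by blast
  have *: "eval_bd (Mu f) s xs = (if n < s \<and> eval_bd f s (n # xs) = 1 then Suc n else 0)"
    by (simp add: n_def P_def Let_def)
  note eval_bd.simps(6) [simp del]
  show ?thesis
  proof
    assume "eval_bd (Mu f) s xs = Suc y"
    then show "y < s \<and> eval_bd f s (y # xs) = 1 \<and> (\<forall>m<y. eval_bd f s (m # xs) > 1)"
      using least by (auto simp: * P_def not_le split: if_splits)
  next
    assume y: "y < s \<and> eval_bd f s (y # xs) = 1 \<and> (\<forall>m<y. eval_bd f s (m # xs) > 1)"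
    have "P y" using y by (simp add: P_def)
    moreover have "\<not> P m" if "m < y" for m using y that by (auto simp: P_def not_le)
    ultimately have "n = y" using n least by (metis linorder_neqE_nat)
    then show "eval_bd (Mu f) s xs = Suc y" using y by (simp add: *)
  qed
qed

text \<open>The existence test and the \<open>LEAST\<close> in \<open>eval\<close> may speak of
  different numbers. The least zero does not exceed the witness of the test, so all values before it
  are defined, and nonzero by minimality.\<close>

lemma eval_Mu_eq_Some:
  "eval (Mu f) xs = Some y \<longleftrightarrow>
    eval f (y # xs) = Some 0 \<and> (\<forall>m<y. \<exists>z. eval f (m # xs) = Some (Suc z))"
proof -
  define P where "P n \<longleftrightarrow> eval f (n # xs) = Some 0" for n
  have *: "eval (Mu f) xs = Some y \<longleftrightarrow> (\<exists>n. P n \<and> (\<forall>m<n. eval f (m # xs) \<noteq> None)) \<and> y = (LEAST n. P n)"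
    by (auto simp: P_def)
  note eval.simps(6) [simp del]
  show ?thesis
  proof
    assume "eval (Mu f) xs = Some y"
    then obtain n where n: "P n" "\<forall>m<n. eval f (m # xs) \<noteq> None" and y: "y = (LEAST n. P n)"
      unfolding * by blast
    have "P y" "y \<le> n" using n(1) y by (auto intro: LeastI Least_le)
    moreover have "\<exists>z. eval f (m # xs) = Some (Suc z)" if "m < y" for m
    proof -
      have "eval f (m # xs) \<noteq> None" using n(2) that \<open>y \<le> n\<close> by auto
      moreover have "\<not> P m" using not_less_Least that y by blast
      ultimately show ?thesis unfolding P_def by (metis not0_implies_Suc option.exhaust)
    qed
    ultimately show "eval f (y # xs) = Some 0 \<and> (\<forall>m<y. \<exists>z. eval f (m # xs) = Some (Suc z))"
      by (auto simp: P_def)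
  next
    assume y: "eval f (y # xs) = Some 0 \<and> (\<forall>m<y. \<exists>z. eval f (m # xs) = Some (Suc z))"
    then have "P y" by (simp add: P_def)
    have "\<not> P m" if "m < y" for m using y that by (auto simp: P_def)
    then have "(LEAST n. P n) = y"
      using \<open>P y\<close> by (intro Least_equality) (auto intro: leI)
    moreover have "\<exists>n. P n \<and> (\<forall>m<n. eval f (m # xs) \<noteq> None)"
      using \<open>P y\<close> y by (intro exI[of _ y]) auto
    ultimately show "eval (Mu f) xs = Some y" unfolding * by simp
  qed
qed

declare eval.simps(4,6) [simp del] eval_bd.simps(4,6) [simp del]

section \<open>Correctness of bounded evaluation\<close>

lemma eval_bd_sound: "eval_bd f s xs = Suc y \<Longrightarrow> eval f xs = Some y"
proof (induction f arbitrary: xs y)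
  case (Comp f gs)
  note Suc = eval_bd_Comp_eq_Suc[OF Comp.prems]
  show ?case
    using eval_Comp_eq[OF Comp.IH(2)[OF _ Suc(1)]] Comp.IH(1)[OF Suc(2)] by simp
next
  case (PrimRec f g)
  show ?case
  proof (cases xs)
    case (Cons n zs)
    have "rec_nat (eval_bd f s zs) (\<lambda>m r. if r = 0 then 0 else eval_bd g s (m # (r - 1) # zs)) n = Suc y
      \<Longrightarrow> rec_nat (eval f zs) (\<lambda>m r. Option.bind r (\<lambda>y. eval g (m # y # zs))) n = Some y" for n y
    proof (induction n arbitrary: y)
      case (Suc n)
      then show ?case
        using PrimRec.IH(2)
        by (cases "rec_nat (eval_bd f s zs) (\<lambda>m r. if r = 0 then 0 else eval_bd g s (m # (r - 1) # zs)) n") auto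
    qed (use PrimRec.IH(1) in auto)
    then show ?thesis using PrimRec.prems Cons by simp
  qed (use PrimRec.prems in simp)
next
  case (Mu f)
  have y: "eval_bd f s (y # xs) = Suc 0" "\<And>m. m < y \<Longrightarrow> eval_bd f s (m # xs) > 1"
    using Mu.prems unfolding eval_bd_Mu_eq_Suc by auto
  \<comment> \<open>A bounded value above 1 has the form \<open>Suc (Suc z)\<close> and so stands
    for the nonzero value \<open>Suc z\<close>.\<close>
  have "\<exists>z. eval f (m # xs) = Some (Suc z)" if "m < y" for m
    using y(2)[OF that] Mu.IH[of "m # xs" "eval_bd f s (m # xs) - 1"]
    by (auto intro!: exI[of _ "eval_bd f s (m # xs) - 2"])
  with Mu.IH[OF y(1)] show ?case unfolding eval_Mu_eq_Some by blast
qed (auto split: list.splits if_splits)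

lemma eval_bd_mono: "eval_bd f s xs = Suc y \<Longrightarrow> s \<le> t \<Longrightarrow> eval_bd f t xs = Suc y"
proof (induction f arbitrary: xs y)
  case (Comp f gs)
  note Suc = eval_bd_Comp_eq_Suc[OF Comp.prems(1)]
  show ?case
    using eval_bd_Comp_eq[OF Comp.IH(2)[OF _ Suc(1) Comp.prems(2)]]
      Comp.IH(1)[OF Suc(2) Comp.prems(2)] by simp
next
  case (PrimRec f g)
  show ?case
  proof (cases xs)
    case (Cons n zs)
    let ?r = "\<lambda>s. rec_nat (eval_bd f s zs) (\<lambda>m r. if r = 0 then 0 else eval_bd g s (m # (r - 1) # zs))"
    have "?r s n = Suc y \<Longrightarrow> ?r t n = Suc y" for n y
    proof (induction n arbitrary: y)
      case (Suc n)
      then show ?case using PrimRec.IH(2) PrimRec.prems(2) by (cases "?r s n") auto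
    qed (use PrimRec.IH(1) PrimRec.prems(2) in auto)
    then show ?thesis using PrimRec.prems Cons by simp
  qed (use PrimRec.prems in simp)
next
  case (Mu f)
  have y: "y < s" "eval_bd f s (y # xs) = Suc 0" "\<And>m. m < y \<Longrightarrow> eval_bd f s (m # xs) > 1"
    using Mu.prems(1) unfolding eval_bd_Mu_eq_Suc by auto
  have "eval_bd f t (m # xs) > 1" if "m < y" for m
    using y(3)[OF that] Mu.IH[of "m # xs" "eval_bd f s (m # xs) - 1"] Mu.prems(2) by simp
  with Mu.IH[OF y(2) Mu.prems(2)] y(1) Mu.prems(2) show ?case
    unfolding eval_bd_Mu_eq_Suc by simp
qed (auto split: list.splits if_splits)

text \<open>By monotonicity finitely many computations can share the maximum of their bounds. This
  serves the arguments of a composition and the values inspected by a search.\<close>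

lemma eval_bd_common_bound:
  assumes "finite I" "\<And>i. i \<in> I \<Longrightarrow> \<exists>s. eval_bd (f i) s (xs i) = Suc (y i)"
  shows "\<exists>s. \<forall>i\<in>I. eval_bd (f i) s (xs i) = Suc (y i)"
proof -
  obtain b where b: "\<And>i. i \<in> I \<Longrightarrow> eval_bd (f i) (b i) (xs i) = Suc (y i)"
    using assms(2) by metis
  have "eval_bd (f i) (Max (b ` I)) (xs i) = Suc (y i)" if "i \<in> I" for i
    using eval_bd_mono[OF b[OF that]] assms(1) that by simp
  then show ?thesis by blast
qed

lemma eval_bd_complete: "eval f xs = Some y \<Longrightarrow> \<exists>s. eval_bd f s xs = Suc y"
proof (induction f arbitrary: xs y)
  case (Comp f gs)
  have "None \<notin> set (map (\<lambda>g. eval g xs) gs)"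
    using Comp.prems unfolding eval.simps(4) Let_def by (metis option.distinct(1))
  then have nz: "\<exists>z. eval g xs = Some z" if "g \<in> set gs" for g
    using that by (cases "eval g xs") (force simp: image_iff)+
  then have y: "eval f (map (\<lambda>g. the (eval g xs)) gs) = Some y"
    using Comp.prems eval_Comp_eq[of gs xs "\<lambda>g. the (eval g xs)" f] by fastforce
  have "\<exists>s. \<forall>g\<in>set gs. eval_bd g s xs = Suc (the (eval g xs))"
    using Comp.IH(2) nz by (intro eval_bd_common_bound) force+
  then obtain s where s: "\<And>g. g \<in> set gs \<Longrightarrow> eval_bd g s xs = Suc (the (eval g xs))" by blast
  obtain t where t: "eval_bd f t (map (\<lambda>g. the (eval g xs)) gs) = Suc y"
    using Comp.IH(1)[OF y] by blast
  have "eval_bd (Comp f gs) (max s t) xs = Suc y"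
    using eval_bd_mono[OF t, of "max s t"] eval_bd_mono[OF s, of _ "max s t"]
    by (subst eval_bd_Comp_eq) auto
  then show ?case by blast
next
  case (PrimRec f g)
  show ?case
  proof (cases xs)
    case (Cons n zs)
    let ?r = "\<lambda>s. rec_nat (eval_bd f s zs) (\<lambda>m r. if r = 0 then 0 else eval_bd g s (m # (r - 1) # zs))"
    let ?e = "rec_nat (eval f zs) (\<lambda>m r. Option.bind r (\<lambda>y. eval g (m # y # zs)))"
    have mono: "?r s n = Suc y \<Longrightarrow> s \<le> t \<Longrightarrow> ?r t n = Suc y" for s t n y
      using eval_bd_mono[of "PrimRec f g" s "n # zs" y t] by simp
    have "?e n = Some y \<Longrightarrow> \<exists>s. ?r s n = Suc y" for n y
    proof (induction n arbitrary: y)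
      case (Suc n)
      then obtain z where z: "?e n = Some z" "eval g (n # z # zs) = Some y"
        by (auto simp: bind_eq_Some_conv)
      obtain s where s: "?r s n = Suc z" using Suc.IH[OF z(1)] by blast
      obtain t where t: "eval_bd g t (n # z # zs) = Suc y" using PrimRec.IH(2)[OF z(2)] by blast
      have "?r (max s t) (Suc n) = Suc y"
        using mono[OF s, of "max s t"] eval_bd_mono[OF t, of "max s t"] by simp
      then show ?case by blast
    qed (use PrimRec.IH(1) in auto)
    then show ?thesis using PrimRec.prems Cons by simp
  qed (use PrimRec.prems in simp)
next
  case (Mu f)
  have y: "eval f (y # xs) = Some 0" "\<And>m. m < y \<Longrightarrow> \<exists>z. eval f (m # xs) = Some (Suc z)"
    using Mu.prems unfolding eval_Mu_eq_Some by auto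
  have "eval f (m # xs) \<noteq> None" if "m \<le> y" for m
    using y(1) y(2)[of m] that by (cases "m = y") auto
  then have "\<exists>s. \<forall>m\<in>{..y}. eval_bd f s (m # xs) = Suc (the (eval f (m # xs)))"
    by (intro eval_bd_common_bound) (auto intro!: Mu.IH)
  then obtain s where s: "\<And>m. m \<le> y \<Longrightarrow> eval_bd f s (m # xs) = Suc (the (eval f (m # xs)))"
    by auto
  \<comment> \<open>The bound must also exceed the result \<open>y\<close>, because the bounded
    search only looks below it.\<close>
  have t: "eval_bd f (max s (Suc y)) (m # xs) = Suc (the (eval f (m # xs)))" if "m \<le> y" for m
    using eval_bd_mono[OF s[OF that]] by simp
  have "eval_bd (Mu f) (max s (Suc y)) xs = Suc y"
    unfolding eval_bd_Mu_eq_Suc using t[of y] y(1) t y(2) by fastforce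
  then show ?case by blast
qed (auto split: list.splits if_splits)

lemma computable_all_nonzero:
  assumes "\<And>G. G \<in> set Gs \<Longrightarrow> computable k G"
  shows "computable k (\<lambda>xs. if 0 \<in> set (map (\<lambda>G. G xs) Gs) then 0 else 1)"
  using assms
proof (induction Gs)
  case (Cons G Gs)
  have "computable k (\<lambda>xs. if G xs = 0 then 0 else if 0 \<in> set (map (\<lambda>G. G xs) Gs) then 0 else 1)"
    using Cons by (intro computable_if computable_const) auto
  moreover have "(\<lambda>xs. if G xs = 0 then 0 else if 0 \<in> set (map (\<lambda>G. G xs) Gs) then 0 else 1)
    = (\<lambda>xs. if 0 \<in> set (map (\<lambda>G. G xs) (G # Gs)) then 0 else 1 :: nat)"
    by (intro ext) (auto simp: image_iff)
  ultimately show ?case by simp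
qed (simp add: computable_const)

text \<open>Takes the place of a universal machine: for each fixed \<open>f\<close>, convergence
  within a bound is decidable jointly in the bound and the arguments. The arity stays arbitrary
  because the recursive calls change the length of the list.\<close>

lemma computable_eval_bd: "computable (Suc k) (\<lambda>ys. eval_bd f (hd ys) (tl ys))"
proof (induction f arbitrary: k)
  case Zero
  then show ?case by (simp add: computable_const)
next
  case Succ
  show ?case
  proof (cases k)
    case 0
    have "computable (Suc k) (\<lambda>ys. 0)" by (rule computable_const)
    then show ?thesis by (rule iffD1[OF computable_cong, rotated]) (auto simp: 0 length_Suc_conv)
  next
    case (Suc k')
    have "computable (Suc k) (\<lambda>ys. Suc (Suc (ys ! 1)))"
      by (intro computable_Suc computable_nth) (simp add: Suc)
    then show ?thesis by (rule iffD1[OF computable_cong, rotated]) (auto simp: Suc length_Suc_conv)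
  qed
next
  case (Proj i)
  show ?case
  proof (cases "i < k")
    case False
    have "computable (Suc k) (\<lambda>ys. 0)" by (rule computable_const)
    then show ?thesis by (rule iffD1[OF computable_cong, rotated]) (use False in auto)
  next
    case True
    have "computable (Suc k) (\<lambda>ys. Suc (ys ! Suc i))"
      by (intro computable_Suc computable_nth) (simp add: True)
    then show ?thesis
      by (rule iffD1[OF computable_cong, rotated]) (use True in \<open>auto simp: length_Suc_conv\<close>)
  qed
next
  case (Comp f gs)
  let ?Gs = "map (\<lambda>g ys. eval_bd g (hd ys) (tl ys)) gs"
  have Gs: "computable (Suc k) G" if "G \<in> set ?Gs" for G using that Comp.IH(2) by auto
  let ?Hs = "(\<lambda>ys. ys ! 0) # map (\<lambda>G ys. G ys - 1) ?Gs"
  have Hs: "computable (Suc k) H" if "H \<in> set ?Hs" for H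
    using that Comp.IH(2) by (auto intro!: computable_pred' computable_nth)
  have "computable (length ?Hs) (\<lambda>ys. eval_bd f (hd ys) (tl ys))" using Comp.IH(1) by simp
  then have "computable (Suc k) (\<lambda>ys. eval_bd f (hd (map (\<lambda>G. G ys) ?Hs)) (tl (map (\<lambda>G. G ys) ?Hs)))"
    by (rule computable_comp) (rule Hs)
  then have "computable (Suc k) (\<lambda>ys. eval_bd f (ys ! 0) (map (\<lambda>g. eval_bd g (hd ys) (tl ys) - 1) gs))"
    by (simp add: comp_def)
  from computable_if[OF computable_all_nonzero[of ?Gs, OF Gs] computable_const this]
  have "computable (Suc k) (\<lambda>ys. if (if 0 \<in> set (map (\<lambda>G. G ys) ?Gs) then 0 else 1 :: nat) = 0 then 0
      else eval_bd f (ys ! 0) (map (\<lambda>g. eval_bd g (hd ys) (tl ys) - 1) gs))" .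
  then show ?case
    by (rule iffD1[OF computable_cong, rotated]) (auto simp: eval_bd.simps(4) Let_def comp_def image_iff hd_conv_nth length_Suc_conv)
next
  case (PrimRec f g)
  show ?case
  proof (cases k)
    case 0
    have "computable (Suc k) (\<lambda>ys. 0)" by (rule computable_const)
    then show ?thesis by (rule iffD1[OF computable_cong, rotated]) (auto simp: 0 length_Suc_conv)
  next
    case (Suc j)
    let ?step = "\<lambda>m r ys. if r = 0 then 0 else eval_bd g (ys ! 0) (m # (r - 1) # drop 2 ys)"
    have "computable (2 + j) (\<lambda>ys. eval_bd f (ys ! 0) (map (\<lambda>G. G ys) [] @ drop 2 ys))"
      by (rule computable_subst_hd_drop) (use PrimRec.IH(1)[of j] in \<open>auto intro!: computable_nth\<close>)
    then have f: "computable (Suc k) (\<lambda>ys. eval_bd f (ys ! 0) (drop 2 ys))" by (simp add: Suc)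
    \<comment> \<open>The list consists of the index, the previous bounded value, the search bound,
      the recursion count and \<open>j\<close> parameters. Hence the bound sits at position 2 and
      the parameters remain after dropping four entries.\<close>
    have "computable (4 + j) (\<lambda>ys. eval_bd g (ys ! 2)
        (map (\<lambda>G. G ys) [\<lambda>ys. ys ! 0, \<lambda>ys. ys ! 1 - 1] @ drop 4 ys))"
      by (rule computable_subst_hd_drop)
        (use PrimRec.IH(2)[of "Suc (Suc j)"] in \<open>auto intro!: computable_nth computable_pred'\<close>)
    then have g: "computable (Suc (Suc (Suc k)))
        (\<lambda>ys. eval_bd g (ys ! 2) (ys ! 0 # (ys ! 1 - 1) # drop 4 ys))"
      by (simp add: Suc eval_nat_numeral)
    have "computable (Suc k) (\<lambda>ys. rec_nat (eval_bd f (ys ! 0) (drop 2 ys)) (\<lambda>m r. ?step m r ys) (ys ! 1))"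
    proof (intro computable_rec f computable_nth)
      have "computable (Suc (Suc (Suc k))) (\<lambda>ys. if ys ! 1 = 0 then 0
          else eval_bd g (ys ! 2) (ys ! 0 # (ys ! 1 - 1) # drop 4 ys))"
        by (intro computable_if computable_const computable_nth g) simp
      then show "computable (Suc (Suc (Suc k))) (\<lambda>ys. ?step (ys ! 0) (ys ! 1) (drop 2 ys))"
        by (rule iffD1[OF computable_cong, rotated]) auto
    qed (simp add: Suc)
    then show ?thesis
      by (rule iffD1[OF computable_cong, rotated]) (auto simp: Suc length_Suc_conv cong: if_cong)
  qed
next
  case (Mu f)
  let ?e = "\<lambda>n ys. eval_bd f (ys ! 0) (n # tl ys)"
  have e: "computable (Suc (Suc k)) (\<lambda>ys. ?e (ys ! 0) (tl ys))"
  proof -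
    have "computable (2 + k) (\<lambda>ys. eval_bd f (ys ! 1) (map (\<lambda>G. G ys) [\<lambda>ys. ys ! 0] @ drop 2 ys))"
      by (rule computable_subst_hd_drop) (use Mu.IH[of "Suc k"] in \<open>auto intro!: computable_nth\<close>)
    then have "computable (Suc (Suc k)) (\<lambda>ys. eval_bd f (ys ! 1) (ys ! 0 # drop 2 ys))" by simp
    then show ?thesis
      by (rule iffD1[OF computable_cong, rotated]) (auto simp: length_Suc_conv)
  qed
  \<comment> \<open>Truncated subtraction merges the stopping conditions: \<open>?p\<close> vanishes
    if \<open>n\<close> has reached the bound or if the bounded value is at most 1.\<close>
  let ?p = "\<lambda>n ys. if ys ! 0 - n = 0 then 0 else ?e n ys - 1"
  let ?m = "\<lambda>ys. LEAST n. ?p n ys = 0"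
  have ex: "\<exists>n. ?p n ys = 0" for ys by (rule exI[of _ "ys ! 0"]) simp
  have "computable (Suc (Suc k)) (\<lambda>ys. if ys ! 1 - ys ! 0 = 0 then 0 else ?e (ys ! 0) (tl ys) - 1)"
    using computable_if[OF computable_diff[OF computable_nth[of 1] computable_nth[of 0]]
        computable_const computable_pred[OF e]] by simp
  then have "computable (Suc (Suc k)) (\<lambda>ys. ?p (ys ! 0) (tl ys))"
    by (rule iffD1[OF computable_cong, rotated]) (auto simp: length_Suc_conv)
  then have m: "computable (Suc k) ?m" by (rule computable_Least) (rule ex)
  have em: "computable (Suc k) (\<lambda>ys. ?e (?m ys) ys)"
    using computable_subst_args[of "[?m]" "Suc k" "\<lambda>ys. ?e (ys ! 0) (tl ys)"] e m by simp
  have "computable (Suc k) (\<lambda>ys. if ys ! 0 - ?m ys = 0 then 0 else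
      if ?e (?m ys) ys = 0 then 0 else if ?e (?m ys) ys - 1 = 0 then Suc (?m ys) else 0)"
    using computable_if[OF computable_diff[OF computable_nth[of 0] m] computable_const
        computable_if[OF em computable_const computable_if[OF computable_pred[OF em]
          computable_Suc[OF m] computable_const]]] by simp
  moreover have p: "?p n ys = 0 \<longleftrightarrow> ys ! 0 \<le> n \<or> ?e n ys \<le> 1" for n ys by auto
  have "(if ys ! 0 - ?m ys = 0 then 0 else if ?e (?m ys) ys = 0 then 0
      else if ?e (?m ys) ys - 1 = 0 then Suc (?m ys) else 0) = eval_bd (Mu f) (hd ys) (tl ys)"
    if "length ys = Suc k" for ys
    using that unfolding p eval_bd.simps(6) Let_def by (cases ys) auto
  ultimately show ?case by (rule iffD1[OF computable_cong, rotated])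
qed


section \<open>Semidecidable predicates\<close>

abbreviation pair :: "nat \<Rightarrow> nat \<Rightarrow> nat" where
  "pair m n \<equiv> prod_encode (m, n)"

abbreviation pfst :: "nat \<Rightarrow> nat" where
  "pfst z \<equiv> fst (prod_decode z)"

abbreviation psnd :: "nat \<Rightarrow> nat" where
  "psnd z \<equiv> snd (prod_decode z)"

lemma pair_pfst_psnd [simp]: "pair (pfst z) (psnd z) = z"
  by simp

definition computable1 :: "(nat \<Rightarrow> nat) \<Rightarrow> bool" where
  "computable1 f \<longleftrightarrow> computable (Suc 0) (\<lambda>xs. f (xs ! 0))"

text \<open>Truth is coded by 0, so that a decidable predicate can be fed directly to
  \<open>computable_if\<close> and to a search by \<open>Mu\<close>.\<close>

definition dec :: "(nat \<Rightarrow> bool) \<Rightarrow> bool" where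
  "dec P \<longleftrightarrow> computable1 (\<lambda>x. if P x then 0 else 1)"

lemma computable1_comp: "computable1 f \<Longrightarrow> computable1 g \<Longrightarrow> computable1 (\<lambda>x. f (g x))"
  unfolding computable1_def by (rule computable_comp1)

lemma computable1_id: "computable1 (\<lambda>x. x)"
  unfolding computable1_def by (rule computable_nth) simp

lemma computable1_const: "computable1 (\<lambda>x. c)"
  unfolding computable1_def by (rule computable_const)

lemma computable1_Suc: "computable1 f \<Longrightarrow> computable1 (\<lambda>x. Suc (f x))"
  unfolding computable1_def by (rule computable_Suc)

lemma computable1_add: "computable1 f \<Longrightarrow> computable1 g \<Longrightarrow> computable1 (\<lambda>x. f x + g x)"
  unfolding computable1_def by (rule computable_add)

lemma computable1_diff: "computable1 f \<Longrightarrow> computable1 g \<Longrightarrow> computable1 (\<lambda>x. f x - g x)"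
  unfolding computable1_def by (rule computable_diff)

lemma computable1_triangle: "computable1 f \<Longrightarrow> computable1 (\<lambda>x. triangle (f x))"
  unfolding computable1_def by (rule computable_triangle)

lemma computable_pair:
  "computable k F \<Longrightarrow> computable k G \<Longrightarrow> computable k (\<lambda>xs. pair (F xs) (G xs))"
  unfolding prod_encode_def by (simp add: computable_add computable_triangle)

lemma computable1_pair: "computable1 f \<Longrightarrow> computable1 g \<Longrightarrow> computable1 (\<lambda>x. pair (f x) (g x))"
  unfolding computable1_def by (rule computable_pair)

text \<open>For \<open>z = triangle (m + n) + m\<close> the sum \<open>m + n\<close> is the least
  \<open>s\<close> with \<open>z < triangle (Suc s)\<close>, because \<open>m <= m + n\<close>. Both
  projections then follow by subtraction.\<close>

lemma computable1_sum_pair: "computable1 (\<lambda>z. pfst z + psnd z)"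
proof -
  have "computable (Suc 0) (\<lambda>xs. LEAST s. Suc (xs ! 0) - triangle (Suc s) = 0)"
  proof (rule computable_Least)
    have "computable (Suc (Suc 0)) (\<lambda>ys. Suc (ys ! 1) - triangle (Suc (ys ! 0)))"
      by (intro computable_diff computable_triangle computable_Suc computable_nth) auto
    then show "computable (Suc (Suc 0)) (\<lambda>ys. Suc (tl ys ! 0) - triangle (Suc (ys ! 0)))"
      by (rule iffD1[OF computable_cong, rotated]) (auto simp: length_Suc_conv)
    fix xs :: "nat list"
    show "\<exists>s. Suc (xs ! 0) - triangle (Suc s) = 0" by (rule exI[of _ "xs ! 0"]) simp
  qed
  moreover have "(LEAST s. Suc z - triangle (Suc s) = 0) = pfst z + psnd z" for z
  proof -
    obtain m n where mn: "prod_decode z = (m, n)" by (cases "prod_decode z")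
    then have "z = pair m n" by (metis prod_decode_inverse)
    then have z: "z = triangle (m + n) + m" by (simp add: prod_encode_def)
    have "m + n \<le> s" if "Suc z - triangle (Suc s) = 0" for s
    proof (rule ccontr)
      assume "\<not> m + n \<le> s"
      then have "triangle (Suc s) \<le> triangle (m + n)"
        unfolding triangle_def by (intro div_le_mono mult_le_mono) auto
      then show False using z that by simp
    qed
    then have "(LEAST s. Suc z - triangle (Suc s) = 0) = m + n"
      by (intro Least_equality) (simp add: z)
    then show ?thesis by (simp add: mn)
  qed
  ultimately show ?thesis by (simp add: computable1_def)
qed

lemma computable1_pfst: assumes "computable1 f" shows "computable1 (\<lambda>x. pfst (f x))"
proof -
  have "computable1 (\<lambda>z. z - triangle (pfst z + psnd z))"
    by (intro computable1_diff computable1_id computable1_triangle computable1_sum_pair)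
  moreover have "z - triangle (pfst z + psnd z) = pfst z" for z
  proof -
    have "z = pair (pfst z) (psnd z)" by simp
    also have "\<dots> = triangle (pfst z + psnd z) + pfst z" by (simp only: prod_encode_def case_prod_conv)
    finally show ?thesis by simp
  qed
  ultimately show ?thesis using assms computable1_comp by auto
qed

lemma computable1_psnd: assumes "computable1 f" shows "computable1 (\<lambda>x. psnd (f x))"
proof -
  have "computable1 (\<lambda>z. (pfst z + psnd z) - pfst z)"
    by (intro computable1_diff computable1_id computable1_pfst computable1_sum_pair)
  then show ?thesis using assms computable1_comp by auto
qed

lemma computable1_Least:
  assumes "computable1 (\<lambda>z. p (pfst z) (psnd z))" "\<And>x. \<exists>n. p n x = (0::nat)"
  shows "computable1 (\<lambda>x. LEAST n. p n x = 0)"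
  unfolding computable1_def
proof (rule computable_Least)
  have "computable (Suc (Suc 0)) (\<lambda>ys. p (ys ! 0) (ys ! 1))"
    using computable_comp1[OF assms(1)[unfolded computable1_def] computable_pair[OF computable_nth[of 0] computable_nth[of 1]]]
    by simp
  then show "computable (Suc (Suc 0)) (\<lambda>ys. p (ys ! 0) (tl ys ! 0))"
    by (rule iffD1[OF computable_cong, rotated]) (auto simp: length_Suc_conv)
qed (rule assms(2))

lemma computable1_rec:
  assumes "computable1 a" "computable1 (\<lambda>z. s (pfst z) (pfst (psnd z)) (psnd (psnd z)))" "computable1 n"
  shows "computable1 (\<lambda>x. rec_nat (a x) (\<lambda>m r. s m r x) (n x))"
  unfolding computable1_def
proof (rule computable_rec)
  have "computable (Suc (Suc (Suc 0))) (\<lambda>ys. s (ys ! 0) (ys ! 1) (ys ! 2))"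
    using computable_comp1[OF assms(2)[unfolded computable1_def] computable_pair[OF computable_nth[of 0]
        computable_pair[OF computable_nth[of 1] computable_nth[of 2]]]]
    by simp
  then show "computable (Suc (Suc (Suc 0))) (\<lambda>ys. s (ys ! 0) (ys ! 1) (drop 2 ys ! 0))"
    by (rule iffD1[OF computable_cong, rotated]) (auto simp: length_Suc_conv)
qed (use assms computable1_def in auto)

lemma computable1_if:
  assumes "dec P" "computable1 f" "computable1 g"
  shows "computable1 (\<lambda>x. if P x then f x else g x)"
  using computable_if[OF assms(1)[unfolded dec_def computable1_def] assms(2,3)[unfolded computable1_def]]
  unfolding computable1_def by (rule iffD1[OF computable_cong, rotated]) auto

lemma dec_subst: "dec P \<Longrightarrow> computable1 f \<Longrightarrow> dec (\<lambda>x. P (f x))"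
  unfolding dec_def by (rule computable1_comp)

lemma dec_const: "dec (\<lambda>x. c)"
  unfolding dec_def by (rule computable1_const)

lemma dec_le:
  assumes "computable1 f" "computable1 g" shows "dec (\<lambda>x. f x \<le> g x)"
proof -
  have "computable1 (\<lambda>x. 1 - (Suc (g x) - f x))"
    by (intro computable1_diff computable1_const computable1_Suc assms)
  moreover have "1 - (Suc (g x) - f x) = (if f x \<le> g x then 0 else 1)" for x by auto
  ultimately show ?thesis unfolding dec_def by simp
qed

lemma dec_not:
  assumes "dec P" shows "dec (\<lambda>x. \<not> P x)"
proof -
  have "computable1 (\<lambda>x. if P x then 1 else 0)" by (intro computable1_if computable1_const assms)
  moreover have "(if P x then 1 else 0) = (if \<not> P x then 0 else 1 :: nat)" for x by simp
  ultimately show ?thesis unfolding dec_def by simp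
qed

lemma dec_conj:
  assumes "dec P" "dec Q" shows "dec (\<lambda>x. P x \<and> Q x)"
proof -
  have "computable1 (\<lambda>x. if P x then (if Q x then 0 else 1) else 1)"
    by (intro computable1_if computable1_const assms)
  moreover have "(if P x then (if Q x then 0 else 1) else 1) = (if P x \<and> Q x then 0 else 1 :: nat)" for x
    by auto
  ultimately show ?thesis unfolding dec_def by simp
qed

lemma dec_disj:
  assumes "dec P" "dec Q" shows "dec (\<lambda>x. P x \<or> Q x)"
  using dec_not[OF dec_conj[OF dec_not[OF assms(1)] dec_not[OF assms(2)]]] by simp

lemma dec_less: "computable1 f \<Longrightarrow> computable1 g \<Longrightarrow> dec (\<lambda>x. f x < g x)"
  using dec_not[OF dec_le, of g f] by (simp add: not_le)

lemma dec_eq: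
  assumes "computable1 f" "computable1 g" shows "dec (\<lambda>x. f x = g x)"
  using dec_conj[OF dec_le[OF assms] dec_le[OF assms(2,1)]] by (simp add: order_eq_iff)

text \<open>Search for a counterexample, cut off at \<open>b x\<close> so that the search
  terminates. The quantified statement holds exactly if the search runs into the cutoff.\<close>

lemma dec_ball_less:
  assumes "dec (\<lambda>z. P (pfst z) (psnd z))" "computable1 b"
  shows "dec (\<lambda>x. \<forall>y<b x. P y x)"
proof -
  let ?p = "\<lambda>n x. if b x \<le> n \<or> \<not> P n x then 0 else (1::nat)"
  have ex: "\<exists>n. ?p n x = 0" for x by (rule exI[of _ "b x"]) simp
  have "computable1 (\<lambda>x. LEAST n. ?p n x = 0)"
    by (rule computable1_Least)
      (intro computable1_if dec_disj dec_le computable1_const computable1_pfst computable1_psnd computable1_id dec_not assms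
        computable1_comp[OF assms(2)], rule ex)
  then have "dec (\<lambda>x. b x \<le> (LEAST n. ?p n x = 0))" by (intro dec_le assms)
  moreover have "b x \<le> (LEAST n. ?p n x = 0) \<longleftrightarrow> (\<forall>y<b x. P y x)" for x
  proof
    assume b: "b x \<le> (LEAST n. ?p n x = 0)"
    have "P y x" if "y < b x" for y
      using not_less_Least[of y "\<lambda>n. ?p n x = 0"] b that by (auto split: if_splits)
    then show "\<forall>y<b x. P y x" by blast
  next
    assume "\<forall>y<b x. P y x"
    then show "b x \<le> (LEAST n. ?p n x = 0)" using LeastI_ex[OF ex[of x]]
      by (metis not_le_imp_less one_neq_zero)
  qed
  ultimately show ?thesis by simp
qed

lemma dec_bex_less:
  assumes "dec (\<lambda>z. P (pfst z) (psnd z))" "computable1 b"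
  shows "dec (\<lambda>x. \<exists>y<b x. P y x)"
  using dec_not[OF dec_ball_less[of "\<lambda>y x. \<not> P y x", OF dec_not[OF assms(1)] assms(2)]] by simp

text \<open>Membership is a binary digit: halve the code \<open>f x\<close> times and test the
  parity, where \<open>n\<close> is even iff it is twice its half.\<close>

lemma dec_mem_set_decode:
  assumes "computable1 f" "computable1 g" shows "dec (\<lambda>x. f x \<in> set_decode (g x))"
proof -
  \<comment> \<open>This vanishes iff \<open>r < 2 * q + 2\<close>, and the least such
    \<open>q\<close> is \<open>r div 2\<close>.\<close>
  let ?p = "\<lambda>q r. Suc r - (q + q + 2)"
  have "computable1 (\<lambda>r. LEAST q. ?p q r = 0)"
  proof (rule computable1_Least)
    show "computable1 (\<lambda>z. ?p (pfst z) (psnd z))"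
      by (intro computable1_diff computable1_Suc computable1_add computable1_pfst computable1_psnd computable1_id computable1_const)
    show "\<exists>q. ?p q r = 0" for r by (rule exI[of _ r]) simp
  qed
  moreover have "(LEAST q. ?p q r = 0) = r div 2" for r by (rule Least_equality) auto
  ultimately have half: "computable1 (\<lambda>r. r div 2)" by simp
  have "computable1 (\<lambda>x. rec_nat (g x) (\<lambda>m r. r div 2) (f x))"
    by (rule computable1_rec) (intro computable1_comp[OF half] assms computable1_pfst computable1_psnd computable1_id)+
  moreover have "rec_nat u (\<lambda>m r. r div 2) n = u div 2 ^ n" for u n :: nat
    by (induction n) (simp_all add: div_mult2_eq power_Suc2 del: power_Suc)
  ultimately have *: "computable1 (\<lambda>x. g x div 2 ^ f x)" by simp
  have "dec (\<lambda>x. \<not> (g x div 2 ^ f x = g x div 2 ^ f x div 2 + g x div 2 ^ f x div 2))"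
    by (intro dec_not dec_eq computable1_add computable1_comp[OF half] *)
  moreover have "\<not> (n = n div 2 + n div 2) \<longleftrightarrow> odd n" for n :: nat by presburger
  ultimately show ?thesis by (simp add: set_decode_def)
qed

section \<open>Projections of decidable predicates\<close>

definition semidec :: "(nat \<Rightarrow> bool) \<Rightarrow> bool" where
  "semidec P \<longleftrightarrow> (\<exists>R. dec R \<and> (\<forall>x. P x \<longleftrightarrow> (\<exists>s. R (pair s x))))"

lemma semidecI: "dec (\<lambda>z. R (pfst z) (psnd z)) \<Longrightarrow> (\<And>x. P x \<longleftrightarrow> (\<exists>s. R s x)) \<Longrightarrow> semidec P"
  unfolding semidec_def by (rule exI[of _ "\<lambda>z. R (pfst z) (psnd z)"]) simp

lemma semidecE:
  assumes "semidec P"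
  obtains R where "dec (\<lambda>z. R (pfst z) (psnd z))" "\<And>x. P x \<longleftrightarrow> (\<exists>s. R s x)"
proof -
  obtain R where R: "dec R" "\<forall>x. P x \<longleftrightarrow> (\<exists>s. R (pair s x))"
    using assms by (auto simp: semidec_def)
  show ?thesis by (rule that[of "\<lambda>s x. R (pair s x)"]) (use R in simp_all)
qed

text \<open>In one direction the witness is a search bound at which the program converges; in the
  other, the program searches for a witness with \<open>Mu\<close>.\<close>

lemma ce_iff_semidec: "ce W \<longleftrightarrow> semidec (\<lambda>x. x \<in> W)"
proof
  assume "ce W"
  then obtain f where W: "W = {x. eval f [x] \<noteq> None}" by (auto simp: ce_def)
  have "computable (length [\<lambda>xs. pfst (xs ! 0), \<lambda>xs. psnd (xs ! 0)]) (\<lambda>ys. eval_bd f (hd ys) (tl ys))"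
    using computable_eval_bd[of 1] by simp
  then have "computable (Suc 0) (\<lambda>xs. eval_bd f (hd (map (\<lambda>G. G xs) [\<lambda>xs. pfst (xs ! 0), \<lambda>xs. psnd (xs ! 0)]))
      (tl (map (\<lambda>G. G xs) [\<lambda>xs. pfst (xs ! 0), \<lambda>xs. psnd (xs ! 0)])))"
    by (rule computable_comp)
      (use computable1_pfst[OF computable1_id] computable1_psnd[OF computable1_id] in \<open>auto simp: computable1_def\<close>)
  then have "computable1 (\<lambda>z. eval_bd f (pfst z) [psnd z])" by (simp add: computable1_def)
  then have "dec (\<lambda>z. 0 < eval_bd f (pfst z) [psnd z])" by (intro dec_less computable1_const)
  moreover have "x \<in> W \<longleftrightarrow> (\<exists>s. 0 < eval_bd f s [x])" for x
  proof
    assume "x \<in> W"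
    then obtain y where "eval f [x] = Some y" by (auto simp: W)
    then obtain s where "eval_bd f s [x] = Suc y" using eval_bd_complete by blast
    then show "\<exists>s. 0 < eval_bd f s [x]" by (intro exI[of _ s]) simp
  next
    assume "\<exists>s. 0 < eval_bd f s [x]"
    then obtain s where "0 < eval_bd f s [x]" by blast
    then have "eval_bd f s [x] = Suc (eval_bd f s [x] - 1)" by simp
    then show "x \<in> W" using eval_bd_sound by (force simp: W)
  qed
  ultimately show "semidec (\<lambda>x. x \<in> W)" by (rule semidecI[of "\<lambda>s x. 0 < eval_bd f s [x]"])
next
  assume "semidec (\<lambda>x. x \<in> W)"
  then obtain R where R: "dec (\<lambda>z. R (pfst z) (psnd z))" "\<And>x. x \<in> W \<longleftrightarrow> (\<exists>s. R s x)"
    by (rule semidecE) blast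
  have "computable (Suc (Suc 0)) (\<lambda>ys. if R (ys ! 0) (ys ! 1) then 0 else 1)"
    using computable_comp1[OF R(1)[unfolded dec_def computable1_def] computable_pair[OF computable_nth[of 0] computable_nth[of 1]]]
    by simp
  then obtain r where r': "\<And>xs. length xs = Suc (Suc 0) \<Longrightarrow>
      eval r xs = Some (if R (xs ! 0) (xs ! 1) then 0 else 1)"
    unfolding computable_def by blast
  have r: "eval r [s, x] = Some (if R s x then 0 else 1)" for s x using r'[of "[s, x]"] by simp
  have "x \<in> W \<longleftrightarrow> eval (Mu r) [x] \<noteq> None" for x
    by (simp add: eval.simps(6) r R(2))
  then have "W = {x. eval (Mu r) [x] \<noteq> None}" by blast
  then show "ce W" unfolding ce_def by (rule exI[of _ "Mu r"])
qed

lemma semidec_dec: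
  assumes "dec P" shows "semidec P"
proof (rule semidecI[of "\<lambda>s x. P x"])
  show "dec (\<lambda>z. P (psnd z))" by (rule dec_subst[OF assms computable1_psnd[OF computable1_id]])
qed simp

lemma semidec_subst:
  assumes "semidec P" "computable1 f" shows "semidec (\<lambda>x. P (f x))"
proof -
  obtain R where R: "dec (\<lambda>z. R (pfst z) (psnd z))" "\<And>x. P x \<longleftrightarrow> (\<exists>s. R s x)"
    using assms(1) by (rule semidecE) blast
  have "dec (\<lambda>z. R (pfst (pair (pfst z) (f (psnd z)))) (psnd (pair (pfst z) (f (psnd z)))))"
    by (rule dec_subst[OF R(1)]) (intro computable1_pair computable1_pfst computable1_psnd computable1_id computable1_comp[OF assms(2)])
  then show ?thesis by (intro semidecI[of "\<lambda>s x. R s (f x)"]) (auto simp: R)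
qed

lemma dec_pair_subst:
  assumes "dec (\<lambda>z. R (pfst z) (psnd z))" "computable1 f" "computable1 g"
  shows "dec (\<lambda>x. R (f x) (g x))"
  using dec_subst[OF assms(1) computable1_pair[OF assms(2,3)]] by simp

lemma semidec_conj:
  assumes "semidec P" "semidec Q" shows "semidec (\<lambda>x. P x \<and> Q x)"
proof -
  obtain R where R: "dec (\<lambda>z. R (pfst z) (psnd z))" "\<And>x. P x \<longleftrightarrow> (\<exists>s. R s x)"
    using assms(1) by (rule semidecE) blast
  obtain S where S: "dec (\<lambda>z. S (pfst z) (psnd z))" "\<And>x. Q x \<longleftrightarrow> (\<exists>s. S s x)"
    using assms(2) by (rule semidecE) blast
  have "dec (\<lambda>z. R (pfst (pfst z)) (psnd z) \<and> S (psnd (pfst z)) (psnd z))"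
    by (intro dec_conj dec_pair_subst[OF R(1)] dec_pair_subst[OF S(1)] computable1_pfst computable1_psnd computable1_id)
  then show ?thesis
    by (rule semidecI[of "\<lambda>s x. R (pfst s) x \<and> S (psnd s) x"])
      (metis R(2) S(2) fst_conv prod_encode_inverse snd_conv)
qed

lemma semidec_disj:
  assumes "semidec P" "semidec Q" shows "semidec (\<lambda>x. P x \<or> Q x)"
proof -
  obtain R where R: "dec (\<lambda>z. R (pfst z) (psnd z))" "\<And>x. P x \<longleftrightarrow> (\<exists>s. R s x)"
    using assms(1) by (rule semidecE) blast
  obtain S where S: "dec (\<lambda>z. S (pfst z) (psnd z))" "\<And>x. Q x \<longleftrightarrow> (\<exists>s. S s x)"
    using assms(2) by (rule semidecE) blast
  show ?thesis
    by (rule semidecI[of "\<lambda>s x. R s x \<or> S s x"]) (use R S dec_disj in auto)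
qed

lemma semidec_ex:
  assumes "semidec (\<lambda>z. P (pfst z) (psnd z))" shows "semidec (\<lambda>x. \<exists>y. P y x)"
proof -
  obtain R where R: "dec (\<lambda>z. R (pfst z) (psnd z))" "\<And>z. P (pfst z) (psnd z) \<longleftrightarrow> (\<exists>s. R s z)"
    using assms by (rule semidecE) blast
  have "dec (\<lambda>z. R (pfst (pfst z)) (pair (psnd (pfst z)) (psnd z)))"
    by (intro dec_pair_subst[OF R(1)] computable1_pair computable1_pfst computable1_psnd computable1_id)
  moreover have "(\<exists>y. P y x) \<longleftrightarrow> (\<exists>s. R (pfst s) (pair (psnd s) x))" for x
  proof -
    have "(\<exists>y. P y x) \<longleftrightarrow> (\<exists>y s. R s (pair y x))" using R(2)[of "pair _ x"] by simp
    also have "\<dots> \<longleftrightarrow> (\<exists>s. R (pfst s) (pair (psnd s) x))"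
      by (metis fst_conv prod_encode_inverse snd_conv)
    finally show ?thesis .
  qed
  ultimately show ?thesis by (rule semidecI[of "\<lambda>s x. R (pfst s) (pair (psnd s) x)"])
qed

lemma set_decode_less: "y \<in> set_decode u \<Longrightarrow> y < u"
proof -
  assume "y \<in> set_decode u"
  then have "u div 2 ^ y \<noteq> 0" by (auto simp: set_decode_def intro: ccontr)
  then have "2 ^ y \<le> u" by (simp add: div_eq_0_iff)
  with less_exp[of y] show ?thesis by linarith
qed

text \<open>Only finitely many \<open>y\<close> occur, so their witnesses lie below a common
  \<open>t\<close>. One existential quantifier over \<open>t\<close> then precedes bounded, hence
  decidable, quantifiers; \<open>set_decode_less\<close> bounds the range of
  \<open>y\<close>.\<close>

lemma semidec_ball:
  assumes "semidec (\<lambda>z. P (pfst z) (psnd z))" "computable1 g"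
  shows "semidec (\<lambda>x. \<forall>y\<in>set_decode (g x). P y x)"
proof -
  obtain R where R: "dec (\<lambda>z. R (pfst z) (psnd z))" "\<And>z. P (pfst z) (psnd z) \<longleftrightarrow> (\<exists>s. R s z)"
    using assms(1) by (rule semidecE) blast
  have P: "P y x \<longleftrightarrow> (\<exists>s. R s (pair y x))" for x y using R(2)[of "pair y x"] by simp
  let ?R = "\<lambda>t x. \<forall>y<g x. y \<notin> set_decode (g x) \<or> (\<exists>s<t. R s (pair y x))"
  show ?thesis
  proof (rule semidecI[of ?R])
    show "dec (\<lambda>z. ?R (pfst z) (psnd z))"
      by (intro dec_ball_less dec_disj dec_not dec_mem_set_decode dec_bex_less dec_pair_subst[OF R(1)]
          computable1_pair computable1_pfst computable1_psnd computable1_id computable1_comp[OF assms(2)])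
    fix x
    show "(\<forall>y\<in>set_decode (g x). P y x) \<longleftrightarrow> (\<exists>t. ?R t x)"
    proof
      assume "\<forall>y\<in>set_decode (g x). P y x"
      then obtain b where b: "\<And>y. y \<in> set_decode (g x) \<Longrightarrow> R (b y) (pair y x)"
        unfolding P by metis
      have "?R (Suc (Max (b ` set_decode (g x)))) x"
        using b by (auto simp: less_Suc_eq_le intro!: exI[of _ "b _"])
      then show "\<exists>t. ?R t x" ..
    next
      assume "\<exists>t. ?R t x"
      then show "\<forall>y\<in>set_decode (g x). P y x" unfolding P using set_decode_less by blast
    qed
  qed
qed


section \<open>Enumeration operators as positive definitions\<close>

text \<open>These are the relations \<open>x \<in> \<Phi> A\<close> for enumeration operators, by
  \<open>e_operator_iff\<close>: monotone and compact in \<open>A\<close>, and semidecidable on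
  finite sets. They are closed under the positive connectives, so an operator can be given by a
  positive formula instead of a c.e. set of axioms.\<close>

definition enumerable :: "(nat \<Rightarrow> nat set \<Rightarrow> bool) \<Rightarrow> bool" where
  "enumerable P \<longleftrightarrow>
    (\<forall>x A B. A \<subseteq> B \<longrightarrow> P x A \<longrightarrow> P x B) \<and>
    (\<forall>x A. P x A \<longrightarrow> (\<exists>F\<subseteq>A. finite F \<and> P x F)) \<and>
    semidec (\<lambda>z. P (pfst z) (set_decode (psnd z)))"

lemma enumerable_mono: "enumerable P \<Longrightarrow> P x A \<Longrightarrow> A \<subseteq> B \<Longrightarrow> P x B"
  unfolding enumerable_def by blast

lemma enumerable_finite: "enumerable P \<Longrightarrow> P x A \<Longrightarrow> \<exists>F\<subseteq>A. finite F \<and> P x F"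
  unfolding enumerable_def by blast

lemma enumerable_semidec:
  assumes "enumerable P" "computable1 f" "computable1 g"
  shows "semidec (\<lambda>x. P (f x) (set_decode (g x)))"
proof -
  have "semidec (\<lambda>z. P (pfst z) (set_decode (psnd z)))" using assms(1) by (simp add: enumerable_def)
  from semidec_subst[OF this computable1_pair[OF assms(2,3)]] show ?thesis by simp
qed

lemma enumerable_mem:
  assumes "computable1 f" shows "enumerable (\<lambda>x A. f x \<in> A)"
proof -
  have "semidec (\<lambda>z. f (pfst z) \<in> set_decode (psnd z))"
    by (intro semidec_dec dec_mem_set_decode computable1_comp[OF assms] computable1_pfst computable1_psnd computable1_id)
  moreover have "\<exists>F\<subseteq>A. finite F \<and> f x \<in> F" if "f x \<in> A" for x A
    using that by (intro exI[of _ "{f x}"]) simp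
  ultimately show ?thesis unfolding enumerable_def by blast
qed

lemma enumerable_const: "semidec P \<Longrightarrow> enumerable (\<lambda>x A. P x)"
  unfolding enumerable_def using semidec_subst[OF _ computable1_pfst[OF computable1_id]] by auto

lemma enumerable_dec: "dec P \<Longrightarrow> enumerable (\<lambda>x A. P x)"
  by (intro enumerable_const semidec_dec)

lemma enumerable_conj:
  assumes "enumerable P" "enumerable Q" shows "enumerable (\<lambda>x A. P x A \<and> Q x A)"
  unfolding enumerable_def
proof (intro HOL.conjI allI impI)
  fix x A assume "P x A \<and> Q x A"
  then obtain F G where "F \<subseteq> A" "finite F" "P x F" "G \<subseteq> A" "finite G" "Q x G"
    using assms[THEN enumerable_finite] by meson
  then show "\<exists>F\<subseteq>A. finite F \<and> P x F \<and> Q x F"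
    using assms[THEN enumerable_mono] by (intro exI[of _ "F \<union> G"]) auto
qed (use assms in \<open>auto intro: enumerable_mono intro!: semidec_conj simp: enumerable_def\<close>)

lemma enumerable_disj:
  assumes "enumerable P" "enumerable Q" shows "enumerable (\<lambda>x A. P x A \<or> Q x A)"
  unfolding enumerable_def
proof (intro HOL.conjI allI impI)
  fix x A assume "P x A \<or> Q x A"
  then show "\<exists>F\<subseteq>A. finite F \<and> (P x F \<or> Q x F)" using assms[THEN enumerable_finite] by meson
qed (use assms in \<open>auto intro: enumerable_mono intro!: semidec_disj simp: enumerable_def\<close>)

lemma enumerable_subst:
  assumes "enumerable P" "computable1 f" shows "enumerable (\<lambda>x A. P (f x) A)"
  unfolding enumerable_def
proof (intro HOL.conjI allI impI)
  show "semidec (\<lambda>z. P (f (pfst z)) (set_decode (psnd z)))"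
    by (intro enumerable_semidec[OF assms(1)] computable1_comp[OF assms(2)] computable1_pfst computable1_psnd computable1_id)
qed (use assms(1) in \<open>auto intro: enumerable_mono enumerable_finite\<close>)

lemma enumerable_pair_subst:
  assumes "enumerable (\<lambda>z A. P (pfst z) (psnd z) A)" "computable1 f" "computable1 g"
  shows "enumerable (\<lambda>x A. P (f x) (g x) A)"
  using enumerable_subst[OF assms(1), of "\<lambda>x. pair (f x) (g x)"] computable1_pair[OF assms(2,3)] by simp

lemma enumerable_ex:
  assumes "enumerable (\<lambda>z A. P (pfst z) (psnd z) A)" shows "enumerable (\<lambda>x A. \<exists>y. P y x A)"
proof -
  have P: "enumerable (\<lambda>x A. P y x A)" for y
    using enumerable_pair_subst[OF assms computable1_const computable1_id] .
  show ?thesis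
    unfolding enumerable_def
  proof (intro HOL.conjI allI impI)
    fix x A B assume "A \<subseteq> B" "\<exists>y. P y x A"
    then show "\<exists>y. P y x B" using enumerable_mono[OF P] by blast
  next
    fix x A assume "\<exists>y. P y x A"
    then show "\<exists>F\<subseteq>A. finite F \<and> (\<exists>y. P y x F)" using enumerable_finite[OF P] by meson
  next
    have "semidec (\<lambda>z. P (pfst (pair (pfst z) (pfst (psnd z)))) (psnd (pair (pfst z) (pfst (psnd z))))
        (set_decode (psnd (psnd z))))"
      by (intro enumerable_semidec[OF assms] computable1_pair computable1_pfst computable1_psnd computable1_id)
    then show "semidec (\<lambda>z. \<exists>y. P y (pfst z) (set_decode (psnd z)))"
      by (intro semidec_ex) simp
  qed
qed

text \<open>The range of \<open>y\<close> is finite and does not depend on \<open>A\<close>, so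
  compactness survives: the union of the finite supports is again finite.\<close>

lemma enumerable_ball:
  assumes "enumerable (\<lambda>z A. P (pfst z) (psnd z) A)" "computable1 g"
  shows "enumerable (\<lambda>x A. \<forall>y\<in>set_decode (g x). P y x A)"
proof -
  have P: "enumerable (\<lambda>x A. P y x A)" for y
    using enumerable_pair_subst[OF assms(1) computable1_const computable1_id] .
  show ?thesis
    unfolding enumerable_def
  proof (intro HOL.conjI allI impI)
    fix x A B assume "A \<subseteq> B" "\<forall>y\<in>set_decode (g x). P y x A"
    then show "\<forall>y\<in>set_decode (g x). P y x B" using enumerable_mono[OF P] by blast
  next
    fix x A assume "\<forall>y\<in>set_decode (g x). P y x A"
    then have "\<forall>y\<in>set_decode (g x). \<exists>F\<subseteq>A. finite F \<and> P y x F"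
      using enumerable_finite[OF P] by meson
    then obtain F where F: "\<forall>y\<in>set_decode (g x). F y \<subseteq> A \<and> finite (F y) \<and> P y x (F y)"
      by metis
    then show "\<exists>F\<subseteq>A. finite F \<and> (\<forall>y\<in>set_decode (g x). P y x F)"
      by (intro exI[of _ "\<Union>y\<in>set_decode (g x). F y"]) (auto intro: enumerable_mono[OF P])
  next
    have "semidec (\<lambda>z. P (pfst (pair (pfst z) (pfst (psnd z)))) (psnd (pair (pfst z) (pfst (psnd z))))
        (set_decode (psnd (psnd z))))"
      by (intro enumerable_semidec[OF assms(1)] computable1_pair computable1_pfst computable1_psnd computable1_id)
    then show "semidec (\<lambda>z. \<forall>y\<in>set_decode (g (pfst z)). P y (pfst z) (set_decode (psnd z)))"
      by (intro semidec_ball computable1_comp[OF assms(2)] computable1_pfst computable1_id) simp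
  qed
qed

text \<open>For the converse, the axioms are all pairs of \<open>x\<close> and \<open>u\<close> such
  that the finite set \<open>set_decode u\<close> already yields \<open>x\<close>; by compactness
  they generate the whole operator.\<close>

lemma e_operator_iff: "e_operator \<Phi> \<longleftrightarrow> enumerable (\<lambda>x A. x \<in> \<Phi> A)"
proof
  assume "e_operator \<Phi>"
  then obtain W where W: "ce W" "\<And>A. \<Phi> A = {x. \<exists>u. pair x u \<in> W \<and> set_decode u \<subseteq> A}"
    unfolding e_operator_def by blast
  have "enumerable (\<lambda>x A. \<exists>u. pair x u \<in> W \<and> (\<forall>y\<in>set_decode u. y \<in> A))"
    by (intro enumerable_ex enumerable_conj enumerable_const semidec_subst[OF W(1)[unfolded ce_iff_semidec]]
        enumerable_ball enumerable_mem computable1_pair computable1_pfst computable1_psnd computable1_id)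
  then show "enumerable (\<lambda>x A. x \<in> \<Phi> A)" by (simp add: W(2) subset_eq)
next
  assume \<Phi>: "enumerable (\<lambda>x A. x \<in> \<Phi> A)"
  let ?W = "{z. pfst z \<in> \<Phi> (set_decode (psnd z))}"
  have "ce ?W" using \<Phi> unfolding ce_iff_semidec enumerable_def by simp
  moreover have "\<Phi> A = {x. \<exists>u. pair x u \<in> ?W \<and> set_decode u \<subseteq> A}" for A
  proof -
    have "\<exists>u. x \<in> \<Phi> (set_decode u) \<and> set_decode u \<subseteq> A" if "x \<in> \<Phi> A" for x
      using enumerable_finite[OF \<Phi> that] by (metis set_encode_inverse)
    then show ?thesis using enumerable_mono[OF \<Phi>] by auto
  qed
  ultimately show "e_operator \<Phi>" unfolding e_operator_def by blast
qed

lemma e_operator_mono: "e_operator \<Phi> \<Longrightarrow> A \<subseteq> B \<Longrightarrow> \<Phi> A \<subseteq> \<Phi> B"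
  using enumerable_mono[of "\<lambda>x A. x \<in> \<Phi> A"] unfolding e_operator_iff by blast

lemma e_operator_finite: "e_operator \<Phi> \<Longrightarrow> x \<in> \<Phi> A \<Longrightarrow> \<exists>F\<subseteq>A. finite F \<and> x \<in> \<Phi> F"
  using enumerable_finite[of "\<lambda>x A. x \<in> \<Phi> A"] unfolding e_operator_iff by blast

text \<open>\<open>P\<close> consults only a finite part of \<open>\<Phi> A\<close>. Guessing that
  part and then verifying that it is enumerated gives a positive definition.\<close>

lemma enumerable_comp:
  assumes "enumerable P" "e_operator \<Phi>" shows "enumerable (\<lambda>x A. P x (\<Phi> A))"
proof -
  have "enumerable (\<lambda>x A. \<exists>u. P x (set_decode u) \<and> (\<forall>y\<in>set_decode u. y \<in> \<Phi> A))"
    by (intro enumerable_ex enumerable_conj enumerable_const enumerable_semidec[OF assms(1)]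
        enumerable_ball enumerable_subst[OF assms(2)[unfolded e_operator_iff]] computable1_pfst computable1_psnd computable1_id)
  moreover have "(\<exists>u. P x (set_decode u) \<and> (\<forall>y\<in>set_decode u. y \<in> \<Phi> A)) \<longleftrightarrow> P x (\<Phi> A)" for x A
    using enumerable_finite[OF assms(1), of x "\<Phi> A"] enumerable_mono[OF assms(1), of x _ "\<Phi> A"]
    by (metis set_encode_inverse subset_eq)
  ultimately show ?thesis by simp
qed

lemma enumerable_op: "e_operator \<Phi> \<Longrightarrow> computable1 f \<Longrightarrow> enumerable (\<lambda>x A. f x \<in> \<Phi> A)"
  unfolding e_operator_iff by (rule enumerable_subst)

lemma e_operator_id: "e_operator (\<lambda>A. A)"
  unfolding e_operator_iff by (intro enumerable_mem computable1_id)

lemma e_operator_comp: "e_operator \<Phi> \<Longrightarrow> e_operator \<Psi> \<Longrightarrow> e_operator (\<lambda>A. \<Phi> (\<Psi> A))"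
  unfolding e_operator_iff[of \<Phi>] e_operator_iff[of "\<lambda>A. \<Phi> (\<Psi> A)"] by (rule enumerable_comp)

instance recfn :: countable
  by countable_datatype

text \<open>Mere countability of the programs, with no effectiveness claimed. It lists the
  requirements for the independent sets.\<close>

lemma e_operators_enumerated: "\<exists>E :: nat \<Rightarrow> nat set \<Rightarrow> nat set. \<forall>\<Phi>. e_operator \<Phi> \<longrightarrow> \<Phi> \<in> range E"
proof -
  let ?E = "\<lambda>n A. {x. \<exists>u. eval (from_nat n) [pair x u] \<noteq> None \<and> set_decode u \<subseteq> A}"
  have "\<Phi> \<in> range ?E" if \<Phi>: "e_operator \<Phi>" for \<Phi>
  proof -
    obtain f where "\<And>A. \<Phi> A = {x. \<exists>u. eval f [pair x u] \<noteq> None \<and> set_decode u \<subseteq> A}"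
      using \<Phi> unfolding e_operator_def ce_def by auto
    then have "\<Phi> = ?E (to_nat f)" by (intro ext) simp
    then show ?thesis by blast
  qed
  then show ?thesis by blast
qed


section \<open>Kripke models on finite Boolean cubes\<close>

lemma IPC_mono: "X \<subseteq> Y \<Longrightarrow> IPC X \<subseteq> IPC Y"
proof
  fix \<alpha> assume "X \<subseteq> Y" "\<alpha> \<in> IPC X"
  from this(2,1) show "\<alpha> \<in> IPC Y" by induction (auto intro: IPC.intros)
qed

lemma IPC_refl: "\<alpha> \<^bold>\<rightarrow> \<alpha> \<in> IPC X"
  by (rule IPC.MP[OF IPC.MP[OF IPC.S IPC.K] IPC.K[of _ \<alpha>]])

lemma IPC_weaken: "\<beta> \<in> IPC X \<Longrightarrow> \<alpha> \<^bold>\<rightarrow> \<beta> \<in> IPC X"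
  by (rule IPC.MP[OF IPC.K])

text \<open>The calculus has axiom schemes but no substitution rule, so members of \<open>X\<close>
  act as hypotheses and the usual induction on derivations goes through.\<close>

lemma IPC_deduction: "\<beta> \<in> IPC (insert \<alpha> X) \<Longrightarrow> \<alpha> \<^bold>\<rightarrow> \<beta> \<in> IPC X"
proof (induction rule: IPC.induct)
  case (extra \<gamma>)
  then show ?case by (auto intro: IPC_refl IPC_weaken IPC.extra)
next
  case (MP \<gamma> \<delta>)
  then show ?case by (blast intro: IPC.MP IPC.S)
qed (rule IPC_weaken, rule IPC.K IPC.S IPC.conjE1 IPC.conjE2 IPC.conjI IPC.disjI1 IPC.disjI2
    IPC.disjE IPC.negI IPC.negE)+

lemma IPC_cut: "\<beta> \<in> IPC (insert \<alpha> X) \<Longrightarrow> \<alpha> \<in> IPC X \<Longrightarrow> \<beta> \<in> IPC X"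
  using IPC.MP[OF IPC_deduction] .

lemma IPC_cases:
  assumes "\<alpha> \<^bold>\<or> \<beta> \<in> IPC X" "\<gamma> \<in> IPC (insert \<alpha> X)" "\<gamma> \<in> IPC (insert \<beta> X)"
  shows "\<gamma> \<in> IPC X"
  using IPC.MP[OF IPC.MP[OF IPC.MP[OF IPC.disjE assms(2)[THEN IPC_deduction]] assms(3)[THEN IPC_deduction]] assms(1)] .

lemma IPC_contradiction: "\<alpha> \<in> IPC X \<Longrightarrow> \<^bold>\<not> \<alpha> \<in> IPC X \<Longrightarrow> IPC X = UNIV"
  using IPC.MP[OF IPC.MP[OF IPC.negE]] by blast

lemma IPC_Neg: "IPC (insert \<alpha> X) = UNIV \<Longrightarrow> \<^bold>\<not> \<alpha> \<in> IPC X"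
  using IPC.MP[OF IPC.MP[OF IPC.negI[of \<alpha> \<alpha>] IPC_refl] IPC_deduction[of "\<^bold>\<not> \<alpha>" \<alpha>]] by simp

lemma IPC_And: "\<alpha> \<^bold>\<and> \<beta> \<in> IPC X \<longleftrightarrow> \<alpha> \<in> IPC X \<and> \<beta> \<in> IPC X"
  by (blast intro: IPC.MP IPC.conjE1 IPC.conjE2 IPC.conjI)

primrec subforms :: "form \<Rightarrow> form set" where
  "subforms (Atom p) = {Atom p}"
| "subforms (\<alpha> \<^bold>\<or> \<beta>) = insert (\<alpha> \<^bold>\<or> \<beta>) (subforms \<alpha> \<union> subforms \<beta>)"
| "subforms (\<alpha> \<^bold>\<and> \<beta>) = insert (\<alpha> \<^bold>\<and> \<beta>) (subforms \<alpha> \<union> subforms \<beta>)"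
| "subforms (\<alpha> \<^bold>\<rightarrow> \<beta>) = insert (\<alpha> \<^bold>\<rightarrow> \<beta>) (subforms \<alpha> \<union> subforms \<beta>)"
| "subforms (\<^bold>\<not> \<alpha>) = insert (\<^bold>\<not> \<alpha>) (subforms \<alpha>)"

lemma finite_subforms: "finite (subforms \<alpha>)"
  by (induction \<alpha>) auto

lemma subforms_refl: "\<alpha> \<in> subforms \<alpha>"
  by (cases \<alpha>) auto

lemma subforms_trans: "\<beta> \<in> subforms \<alpha> \<Longrightarrow> subforms \<beta> \<subseteq> subforms \<alpha>"
  by (induction \<alpha>) auto

text \<open>Kripke forcing: the worlds are the subsets of \<open>N\<close>, ordered by
  inclusion.\<close>

primrec truth_set :: "nat set \<Rightarrow> (nat \<Rightarrow> nat set set) \<Rightarrow> form \<Rightarrow> nat set set" where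
  "truth_set N V (Atom p) = V p"
| "truth_set N V (\<alpha> \<^bold>\<or> \<beta>) = truth_set N V \<alpha> \<union> truth_set N V \<beta>"
| "truth_set N V (\<alpha> \<^bold>\<and> \<beta>) = truth_set N V \<alpha> \<inter> truth_set N V \<beta>"
| "truth_set N V (\<alpha> \<^bold>\<rightarrow> \<beta>) =
    {Y. Y \<subseteq> N \<and> (\<forall>Z. Y \<subseteq> Z \<longrightarrow> Z \<subseteq> N \<longrightarrow> Z \<in> truth_set N V \<alpha> \<longrightarrow> Z \<in> truth_set N V \<beta>)}"
| "truth_set N V (\<^bold>\<not> \<alpha>) = {Y. Y \<subseteq> N \<and> (\<forall>Z. Y \<subseteq> Z \<longrightarrow> Z \<subseteq> N \<longrightarrow> Z \<notin> truth_set N V \<alpha>)}"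

definition upset :: "nat set \<Rightarrow> nat set set \<Rightarrow> bool" where
  "upset N U \<longleftrightarrow> U \<subseteq> Pow N \<and> (\<forall>Y Z. Y \<in> U \<longrightarrow> Y \<subseteq> Z \<longrightarrow> Z \<subseteq> N \<longrightarrow> Z \<in> U)"

lemma upset_truth_set: "(\<And>p. upset N (V p)) \<Longrightarrow> upset N (truth_set N V \<alpha>)"
proof (induction \<alpha>)
  case (Or \<alpha> \<beta>)
  from Or.IH(1)[OF Or.prems] Or.IH(2)[OF Or.prems] show ?case unfolding upset_def by auto
next
  case (And \<alpha> \<beta>)
  from And.IH(1)[OF And.prems] And.IH(2)[OF And.prems] show ?case unfolding upset_def by auto
next
  case (Imp \<alpha> \<beta>)
  show ?case unfolding upset_def by auto
next
  case (Neg \<alpha>)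
  show ?case unfolding upset_def by auto
qed simp

text \<open>A prime theory over \<open>X\<close>, observed only on the finite set \<open>S\<close>,
  so that there are finitely many of them. As \<open>form\<close> has no falsum, consistency means
  that not every formula is derivable.\<close>

definition saturated :: "form set \<Rightarrow> form set \<Rightarrow> form set \<Rightarrow> bool" where
  "saturated X S w \<longleftrightarrow> w \<subseteq> S \<and> S \<inter> IPC (X \<union> w) \<subseteq> w \<and>
    (\<forall>\<beta> \<gamma>. \<beta> \<^bold>\<or> \<gamma> \<in> w \<longrightarrow> \<beta> \<in> w \<or> \<gamma> \<in> w) \<and> IPC (X \<union> w) \<noteq> UNIV"

text \<open>A finite Lindenbaum construction: a maximal subset of \<open>S\<close> that does not
  derive \<open>\<gamma>\<close> is prime, since otherwise each disjunct would derive
  \<open>\<gamma>\<close> and so would the disjunction.\<close>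

lemma saturated_extension:
  assumes "finite S" "\<And>\<beta>. \<beta> \<in> S \<Longrightarrow> subforms \<beta> \<subseteq> S" "u \<subseteq> S" "\<gamma> \<notin> IPC (X \<union> u)"
  obtains w where "u \<subseteq> w" "saturated X S w" "\<gamma> \<notin> IPC (X \<union> w)"
proof -
  define C where "C = {w. w \<subseteq> S \<and> u \<subseteq> w \<and> \<gamma> \<notin> IPC (X \<union> w)}"
  have "finite C" unfolding C_def using assms(1) by simp
  moreover have "C \<noteq> {}" unfolding C_def using assms by auto
  ultimately obtain w where "w \<in> C" and max: "\<And>v. v \<in> C \<Longrightarrow> w \<subseteq> v \<Longrightarrow> w = v"
    using finite_has_maximal[of C] by metis
  then have w: "w \<subseteq> S" "u \<subseteq> w" "\<gamma> \<notin> IPC (X \<union> w)" unfolding C_def by auto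
  have not_in: "\<gamma> \<in> IPC (insert \<delta> (X \<union> w))" if "\<delta> \<in> S" "\<delta> \<notin> w" for \<delta>
  proof (rule ccontr)
    assume "\<gamma> \<notin> IPC (insert \<delta> (X \<union> w))"
    then have "insert \<delta> w \<in> C" unfolding C_def using w(1,2) that by auto
    from max[OF this] show False using that by auto
  qed
  have "saturated X S w"
    unfolding saturated_def
  proof (intro HOL.conjI allI impI)
    show "S \<inter> IPC (X \<union> w) \<subseteq> w" using not_in w(3) IPC_cut by auto
    fix \<beta>1 \<beta>2 assume or: "\<beta>1 \<^bold>\<or> \<beta>2 \<in> w"
    then have "subforms (\<beta>1 \<^bold>\<or> \<beta>2) \<subseteq> S" using w(1) assms(2) by blast
    then have "\<beta>1 \<in> S" "\<beta>2 \<in> S" using subforms_refl by auto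
    moreover have "\<beta>1 \<^bold>\<or> \<beta>2 \<in> IPC (X \<union> w)" using or by (blast intro: IPC.extra)
    ultimately show "\<beta>1 \<in> w \<or> \<beta>2 \<in> w" using not_in w(3) IPC_cases by blast
  qed (use w in auto)
  then show ?thesis by (rule that[OF w(2) _ w(3)])
qed

text \<open>This is where weak excluded middle enters. Case distinctions on its instances put one of
  the two negations of each relevant formula into the base theory while \<open>\<alpha>\<close>
  stays underivable. All worlds then agree on what is refuted, which creates a greatest
  world.\<close>

lemma decide_negations:
  assumes "finite B" "\<alpha> \<notin> IPC X" "\<And>\<beta>. \<^bold>\<not> \<beta> \<^bold>\<or> \<^bold>\<not> \<^bold>\<not> \<beta> \<in> IPC X"
  shows "\<exists>X'. X \<subseteq> X' \<and> \<alpha> \<notin> IPC X' \<and> (\<forall>\<beta>\<in>B. \<^bold>\<not> \<beta> \<in> IPC X' \<or> \<^bold>\<not> \<^bold>\<not> \<beta> \<in> IPC X')"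
  using assms
proof (induction B rule: finite_induct)
  case (insert \<beta> B)
  then obtain X' where X': "X \<subseteq> X'" "\<alpha> \<notin> IPC X'"
    "\<And>\<gamma>. \<gamma> \<in> B \<Longrightarrow> \<^bold>\<not> \<gamma> \<in> IPC X' \<or> \<^bold>\<not> \<^bold>\<not> \<gamma> \<in> IPC X'" by blast
  have "\<^bold>\<not> \<beta> \<^bold>\<or> \<^bold>\<not> \<^bold>\<not> \<beta> \<in> IPC X'" using insert.prems(2) IPC_mono[OF X'(1)] by blast
  then obtain \<delta> where \<delta>: "\<delta> = \<^bold>\<not> \<beta> \<or> \<delta> = \<^bold>\<not> \<^bold>\<not> \<beta>" "\<alpha> \<notin> IPC (insert \<delta> X')"
    using IPC_cases X'(2) by blast
  have "IPC X' \<subseteq> IPC (insert \<delta> X')" by (rule IPC_mono) blast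
  moreover have "\<delta> \<in> IPC (insert \<delta> X')" by (blast intro: IPC.extra)
  ultimately show ?case using X' \<delta> by (intro exI[of _ "insert \<delta> X'"]) blast
qed auto

lemma IPC_double_negations_consistent:
  assumes "finite F" "IPC X \<noteq> UNIV" "\<And>\<beta>. \<beta> \<in> F \<Longrightarrow> \<^bold>\<not> \<^bold>\<not> \<beta> \<in> IPC X"
  shows "IPC (X \<union> F) \<noteq> UNIV"
  using assms
proof (induction F rule: finite_induct)
  case (insert \<beta> F)
  have "\<^bold>\<not> \<^bold>\<not> \<beta> \<in> IPC (X \<union> F)" using insert.prems(2) IPC_mono[of X "X \<union> F"] by blast
  then have "IPC (insert \<beta> (X \<union> F)) \<noteq> UNIV"
    using insert IPC_Neg[of \<beta> "X \<union> F"] IPC_contradiction by blast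
  then show ?case by simp
qed simp

lemma Union_chain_mem:
  assumes "finite C" "C \<noteq> {}" "\<forall>a\<in>C. \<forall>b\<in>C. a \<subseteq> b \<or> b \<subseteq> a"
  shows "\<Union> C \<in> C"
  using assms
proof (induction C rule: finite_ne_induct)
  case (insert a C)
  then have "\<Union> C \<in> C" "a \<subseteq> \<Union> C \<or> \<Union> C \<subseteq> a" by auto
  then show ?case by (auto simp: Un_absorb1 Un_absorb2)
qed simp

text \<open>
  A finite poset with least element \<open>w\<^sub>0\<close> and greatest element \<open>t\<close> is a p-morphic image of the
  cube of its subsets: a chain is sent to its maximum, everything else to \<open>t\<close>.
\<close>

theorem cube_completeness:
  assumes "\<alpha> \<notin> JAN"
  shows "\<exists>N V. finite N \<and> (\<forall>p. upset N (V p)) \<and> {} \<notin> truth_set N V \<alpha>"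
proof -
  define S where "S = subforms \<alpha>"
  have S: "finite S" "\<And>\<beta>. \<beta> \<in> S \<Longrightarrow> subforms \<beta> \<subseteq> S" "\<alpha> \<in> S"
    unfolding S_def using finite_subforms subforms_trans subforms_refl by auto
  have "\<And>\<beta>. \<^bold>\<not> \<beta> \<^bold>\<or> \<^bold>\<not> \<^bold>\<not> \<beta> \<in> JAN" unfolding JAN_def by (auto intro: IPC.extra)
  then obtain X where X: "\<alpha> \<notin> IPC X" "\<And>\<beta>. \<beta> \<in> S \<Longrightarrow> \<^bold>\<not> \<beta> \<in> IPC X \<or> \<^bold>\<not> \<^bold>\<not> \<beta> \<in> IPC X"
    using decide_negations[OF S(1), of \<alpha>] assms unfolding JAN_def by blast
  obtain w0 where w0: "saturated X S w0" "\<alpha> \<notin> IPC (X \<union> w0)"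
    using saturated_extension[OF S(1,2), of "{}" \<alpha> X] X(1) by auto
  define t where "t = {\<beta>\<in>S. \<^bold>\<not> \<beta> \<notin> IPC X}"
  have sub_X: "\<beta> \<in> IPC X \<Longrightarrow> \<beta> \<in> IPC (X \<union> w)" for \<beta> w using IPC_mono[of X "X \<union> w"] by blast
  have top: "w \<subseteq> t" if "saturated X S w" for w
    using that sub_X IPC_contradiction IPC.extra unfolding saturated_def t_def by blast
  have "saturated X S t"
  proof -
    have "IPC (X \<union> t) \<noteq> UNIV"
      using X S(1) unfolding t_def by (intro IPC_double_negations_consistent) auto
    moreover have "\<gamma> \<in> t" if "\<gamma> \<in> S" "\<gamma> \<in> IPC (X \<union> t)" for \<gamma>
      using calculation that sub_X IPC_contradiction unfolding t_def by blast
    moreover have "\<beta> \<in> t \<or> \<gamma> \<in> t" if "\<beta> \<^bold>\<or> \<gamma> \<in> t" for \<beta> \<gamma>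
    proof (rule ccontr)
      assume contr: "\<not> (\<beta> \<in> t \<or> \<gamma> \<in> t)"
      have "subforms (\<beta> \<^bold>\<or> \<gamma>) \<subseteq> S" using that S(2) unfolding t_def by blast
      then have "\<beta> \<in> S" "\<gamma> \<in> S" using subforms_refl by auto
      then have neg: "\<^bold>\<not> \<beta> \<in> IPC (X \<union> t)" "\<^bold>\<not> \<gamma> \<in> IPC (X \<union> t)"
        using contr sub_X unfolding t_def by auto
      have "\<delta> \<in> IPC (X \<union> t)" for \<delta>
      proof (rule IPC_cases)
        show "\<beta> \<^bold>\<or> \<gamma> \<in> IPC (X \<union> t)" using that by (blast intro: IPC.extra)
        have "X \<union> t \<subseteq> insert \<beta> (X \<union> t)" "X \<union> t \<subseteq> insert \<gamma> (X \<union> t)" by blast+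
        then have "\<^bold>\<not> \<beta> \<in> IPC (insert \<beta> (X \<union> t))" "\<^bold>\<not> \<gamma> \<in> IPC (insert \<gamma> (X \<union> t))"
          using neg IPC_mono by blast+
        then show "\<delta> \<in> IPC (insert \<beta> (X \<union> t))" "\<delta> \<in> IPC (insert \<gamma> (X \<union> t))"
          using IPC_contradiction by (blast intro: IPC.extra)+
      qed
      then show False using \<open>IPC (X \<union> t) \<noteq> UNIV\<close> by blast
    qed
    ultimately show ?thesis unfolding saturated_def t_def by blast
  qed
  define W where "W = {w. saturated X S w \<and> w0 \<subseteq> w}"
  have "W \<subseteq> Pow S" unfolding W_def saturated_def by blast
  then have "finite W" using S(1) finite_subset by blast
  then obtain e where e: "bij_betw e {..<card W} W"
    using ex_bij_betw_nat_finite[of W] by (auto simp: atLeast0LessThan)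
  define N where "N = {..<card W}"
  have eN: "e ` N = W" using e unfolding N_def bij_betw_def by blast
  have w0W: "w0 \<in> W" and tW: "t \<in> W"
    using w0 \<open>saturated X S t\<close> top unfolding W_def by auto
  define chain where "chain Y \<longleftrightarrow> (\<forall>i\<in>Y. \<forall>j\<in>Y. e i \<subseteq> e j \<or> e j \<subseteq> e i)" for Y
  \<comment> \<open>The union with \<open>w0\<close> sends the empty chain to the root; for a
    nonempty chain it changes nothing, since all worlds in \<open>W\<close> contain
    \<open>w0\<close>.\<close>
  define f where "f Y = (if chain Y then w0 \<union> \<Union> (e ` Y) else t)" for Y
  have fW: "f Y \<in> W" if "Y \<subseteq> N" for Y
  proof (cases "chain Y \<and> Y \<noteq> {}")
    case True
    have "finite Y" using that finite_subset unfolding N_def by blast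
    then have "\<Union> (e ` Y) \<in> e ` Y" using True unfolding chain_def by (intro Union_chain_mem) auto
    then have "\<Union> (e ` Y) \<in> W" using that eN by blast
    moreover have "w0 \<subseteq> \<Union> (e ` Y)" using calculation unfolding W_def by blast
    ultimately show ?thesis using True unfolding f_def by (simp add: Un_absorb1)
  qed (auto simp: f_def w0W tW chain_def)
  have eS: "e i \<subseteq> t" if "i \<in> N" for i using that eN top unfolding W_def by blast
  have f_mono: "f Y \<subseteq> f Z" if "Y \<subseteq> Z" "Z \<subseteq> N" for Y Z
  proof (cases "chain Z")
    case True
    then have "chain Y" using that unfolding chain_def by blast
    then show ?thesis using True that unfolding f_def by auto
  next
    case False
    then show ?thesis using top w0(1) fW[of Y] that unfolding W_def f_def by auto
  qed
  \<comment> \<open>Back condition of the p-morphism: if \<open>Y\<close> is a chain below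
    \<open>w\<close>, adding an index of \<open>w\<close> gives a chain with maximum
    \<open>w\<close>. If \<open>Y\<close> is not a chain, \<open>f Y\<close> is \<open>t\<close>,
    and so is \<open>w\<close>.\<close>
  have f_back: "\<exists>Z. Y \<subseteq> Z \<and> Z \<subseteq> N \<and> f Z = w" if Y: "Y \<subseteq> N" and w: "w \<in> W" and le: "f Y \<subseteq> w" for Y w
  proof (cases "chain Y")
    case True
    obtain i where i: "i \<in> N" "e i = w" using w eN by blast
    have ej: "e j \<subseteq> w" if "j \<in> Y" for j using that True le unfolding f_def by auto
    have "w0 \<subseteq> w" using w unfolding W_def by blast
    moreover have "chain (insert i Y)" using True ej i(2) unfolding chain_def by blast
    ultimately have "f (insert i Y) = w" using ej i(2) unfolding f_def by auto
    then show ?thesis using i(1) Y by (intro exI[of _ "insert i Y"]) auto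
  next
    case False
    then have "f Y = w" using w le top unfolding f_def W_def by auto
    then show ?thesis using Y by blast
  qed
  have f_sat: "saturated X S (f Y)" "w0 \<subseteq> f Y" if "Y \<subseteq> N" for Y
    using fW[OF that] unfolding W_def by auto
  have closed: "\<beta> \<in> f Y \<longleftrightarrow> \<beta> \<in> IPC (X \<union> f Y)" if "\<beta> \<in> S" "Y \<subseteq> N" for \<beta> Y
    using f_sat(1)[OF that(2)] that(1) IPC.extra unfolding saturated_def by blast
  \<comment> \<open>The Lindenbaum construction provides a world above \<open>f Y\<close>, and the
    back condition realises it by a set above \<open>Y\<close>. This drives the implication and
    negation cases of the truth lemma below.\<close>
  have extend: "\<exists>Z. Y \<subseteq> Z \<and> Z \<subseteq> N \<and> \<beta> \<in> f Z \<and> \<gamma> \<notin> IPC (X \<union> f Z)"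
    if "Y \<subseteq> N" "\<beta> \<in> S" "\<gamma> \<notin> IPC (insert \<beta> (X \<union> f Y))" for Y \<beta> \<gamma>
  proof -
    have "insert \<beta> (f Y) \<subseteq> S" using that f_sat(1)[OF that(1)] unfolding saturated_def by blast
    moreover have "\<gamma> \<notin> IPC (X \<union> insert \<beta> (f Y))" using that(3) by simp
    ultimately obtain w where w: "insert \<beta> (f Y) \<subseteq> w" "saturated X S w" "\<gamma> \<notin> IPC (X \<union> w)"
      using saturated_extension[OF S(1,2)] by metis
    have "w \<in> W" using w f_sat(2)[OF that(1)] unfolding W_def by blast
    then show ?thesis using f_back[OF that(1)] w by blast
  qed
  define V where "V p = {Y. Y \<subseteq> N \<and> Atom p \<in> f Y}" for p
  have truth: "Y \<in> truth_set N V \<beta> \<longleftrightarrow> \<beta> \<in> f Y" if "\<beta> \<in> S" "Y \<subseteq> N" for \<beta> Y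
    using that
  proof (induction \<beta> arbitrary: Y)
    case (Atom p)
    then show ?case by (simp add: V_def)
  next
    case (Or \<beta> \<gamma>)
    then have mem: "\<beta> \<in> S" "\<gamma> \<in> S" using S(2)[OF Or.prems(1)] subforms_refl by auto
    have "\<beta> \<^bold>\<or> \<gamma> \<in> f Y \<longleftrightarrow> \<beta> \<in> f Y \<or> \<gamma> \<in> f Y"
      using closed[OF _ Or.prems(2)] Or.prems mem f_sat(1)[OF Or.prems(2)]
        IPC.MP[OF IPC.disjI1] IPC.MP[OF IPC.disjI2] unfolding saturated_def by meson
    then show ?case using Or mem by simp
  next
    case (And \<beta> \<gamma>)
    then have mem: "\<beta> \<in> S" "\<gamma> \<in> S" using S(2)[OF And.prems(1)] subforms_refl by auto
    then show ?case using And closed[OF _ And.prems(2)] IPC_And by auto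
  next
    case (Imp \<beta> \<gamma>)
    then have mem: "\<beta> \<in> S" "\<gamma> \<in> S" using S(2)[OF Imp.prems(1)] subforms_refl by auto
    have "\<beta> \<^bold>\<rightarrow> \<gamma> \<in> f Y \<longleftrightarrow> (\<forall>Z. Y \<subseteq> Z \<longrightarrow> Z \<subseteq> N \<longrightarrow> \<beta> \<in> f Z \<longrightarrow> \<gamma> \<in> f Z)"
    proof
      assume "\<beta> \<^bold>\<rightarrow> \<gamma> \<in> f Y"
      then show "\<forall>Z. Y \<subseteq> Z \<longrightarrow> Z \<subseteq> N \<longrightarrow> \<beta> \<in> f Z \<longrightarrow> \<gamma> \<in> f Z"
        using f_mono closed mem Imp.prems by (meson IPC.MP subsetD)
    next
      assume *: "\<forall>Z. Y \<subseteq> Z \<longrightarrow> Z \<subseteq> N \<longrightarrow> \<beta> \<in> f Z \<longrightarrow> \<gamma> \<in> f Z"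
      have "\<gamma> \<in> IPC (insert \<beta> (X \<union> f Y))"
        using extend[OF Imp.prems(2) mem(1)] * closed mem(2) by blast
      then show "\<beta> \<^bold>\<rightarrow> \<gamma> \<in> f Y" using closed Imp.prems IPC_deduction by blast
    qed
    then show ?case using Imp mem by auto
  next
    case (Neg \<beta>)
    then have mem: "\<beta> \<in> S" using S(2)[OF Neg.prems(1)] subforms_refl by auto
    have "\<^bold>\<not> \<beta> \<in> f Y \<longleftrightarrow> (\<forall>Z. Y \<subseteq> Z \<longrightarrow> Z \<subseteq> N \<longrightarrow> \<beta> \<notin> f Z)"
    proof
      assume neg: "\<^bold>\<not> \<beta> \<in> f Y"
      show "\<forall>Z. Y \<subseteq> Z \<longrightarrow> Z \<subseteq> N \<longrightarrow> \<beta> \<notin> f Z"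
      proof (intro allI impI notI)
        fix Z assume Z: "Y \<subseteq> Z" "Z \<subseteq> N" "\<beta> \<in> f Z"
        then have "\<^bold>\<not> \<beta> \<in> f Z" using neg f_mono by blast
        then have "IPC (X \<union> f Z) = UNIV"
          using closed[OF _ Z(2)] Z(3) mem Neg.prems(1) IPC_contradiction by blast
        then show False using f_sat(1)[OF Z(2)] unfolding saturated_def by blast
      qed
    next
      assume *: "\<forall>Z. Y \<subseteq> Z \<longrightarrow> Z \<subseteq> N \<longrightarrow> \<beta> \<notin> f Z"
      have "IPC (insert \<beta> (X \<union> f Y)) = UNIV"
        using extend[OF Neg.prems(2) mem] * by blast
      then show "\<^bold>\<not> \<beta> \<in> f Y" using closed Neg.prems IPC_Neg by blast
    qed
    then show ?case using Neg mem by auto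
  qed
  show ?thesis
  proof (intro exI HOL.conjI allI)
    show "finite N" unfolding N_def by simp
    show "upset N (V p)" for p unfolding upset_def V_def using f_mono by blast
    have "\<alpha> \<notin> f {}" using w0(2) unfolding f_def chain_def by (auto intro: IPC.extra)
    then show "{} \<notin> truth_set N V \<alpha>" using truth[OF S(3)] by simp
  qed
qed


section \<open>Brouwer algebras from preorders\<close>

lemma upset_subset: "upset N U \<Longrightarrow> Y \<in> U \<Longrightarrow> Y \<subseteq> N"
  unfolding upset_def by blast

lemma upset_mono: "upset N U \<Longrightarrow> Y \<in> U \<Longrightarrow> Y \<subseteq> Z \<Longrightarrow> Z \<subseteq> N \<Longrightarrow> Z \<in> U"
  unfolding upset_def by blast

text \<open>The operations act on representatives and are given by their universal properties, hence
  determined only up to equivalence. The passage to degrees is thus made once for both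
  lattices.\<close>

locale brouwer_preorder =
  fixes r :: "'a \<Rightarrow> 'a \<Rightarrow> bool" and jn mt res :: "'a \<Rightarrow> 'a \<Rightarrow> 'a" and bt tp :: 'a
  assumes r_refl: "r a a"
    and r_trans: "r a b \<Longrightarrow> r b c \<Longrightarrow> r a c"
    and jn_le_iff: "r (jn a b) c \<longleftrightarrow> r a c \<and> r b c"
    and le_mt_iff: "r c (mt a b) \<longleftrightarrow> r c a \<and> r c b"
    and res_le_iff: "r (res a b) c \<longleftrightarrow> r b (jn a c)"
    and bt_le: "r bt a"
    and le_tp: "r a tp"
    and not_tp_le_bt: "\<not> r tp bt"
begin

definition cls :: "'a \<Rightarrow> 'a set" where
  "cls a = {b. r a b \<and> r b a}"

lemma carrier_degrees: "carrier (degrees r) = range cls"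
  unfolding degrees_def quotient_def cls_def by auto

lemma eq_degrees: "eq (degrees r) = (=)"
  unfolding degrees_def by simp

lemma cls_le_iff: "le (degrees r) (cls a) (cls b) \<longleftrightarrow> r a b"
  unfolding degrees_def cls_def using r_refl r_trans by simp blast

lemma cls_eq_iff: "cls a = cls b \<longleftrightarrow> r a b \<and> r b a"
  unfolding cls_def using r_refl r_trans by blast

lemma jn_upper: "r a (jn a b)" "r b (jn a b)"
  using jn_le_iff[of a b "jn a b"] r_refl by simp_all

lemma jn_res: "r b (jn a (res a b))"
  using res_le_iff[of a b "res a b"] r_refl by simp

lemma mt_lower: "r (mt a b) a" "r (mt a b) b"
  using le_mt_iff[of "mt a b" a b] r_refl by simp_all

lemma Upper_cls: "Upper (degrees r) {cls a, cls b} = cls ` {c. r a c \<and> r b c}"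
  by (auto simp: Upper_def carrier_degrees cls_le_iff)

lemma Lower_cls: "Lower (degrees r) {cls a, cls b} = cls ` {c. r c a \<and> r c b}"
  by (auto simp: Lower_def carrier_degrees cls_le_iff)

lemma least_Upper_cls: "least (degrees r) (cls (jn a b)) (Upper (degrees r) {cls a, cls b})"
  by (auto simp: least_def Upper_cls carrier_degrees cls_le_iff jn_le_iff jn_upper)

lemma greatest_Lower_cls: "greatest (degrees r) (cls (mt a b)) (Lower (degrees r) {cls a, cls b})"
  by (auto simp: greatest_def Lower_cls carrier_degrees cls_le_iff le_mt_iff mt_lower)

lemma least_bt: "least (degrees r) (cls bt) (carrier (degrees r))"
  unfolding least_def carrier_degrees by (auto simp: cls_le_iff bt_le)

lemma greatest_tp: "greatest (degrees r) (cls tp) (carrier (degrees r))"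
  unfolding greatest_def carrier_degrees by (auto simp: cls_le_iff le_tp)

lemma partial_order_degrees: "partial_order (degrees r)"
proof unfold_locales
  show "eq (degrees r) = (=)" by (rule eq_degrees)
  fix x y z w :: "'a set"
  assume "x \<in> carrier (degrees r)" "y \<in> carrier (degrees r)"
  then obtain a b where ab: "x = cls a" "y = cls b" unfolding carrier_degrees by auto
  show "le (degrees r) x x" by (simp add: ab cls_le_iff r_refl)
  show "eq (degrees r) x y" if "le (degrees r) x y" "le (degrees r) y x"
    using that by (simp add: eq_degrees ab cls_le_iff cls_eq_iff)
  assume "z \<in> carrier (degrees r)"
  then obtain c where c: "z = cls c" unfolding carrier_degrees by auto
  show "le (degrees r) x z" if "le (degrees r) x y" "le (degrees r) y z"
    using that r_trans by (auto simp: ab c cls_le_iff)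
qed (auto simp: eq_degrees)

lemma bounded_lattice_degrees: "bounded_lattice (degrees r)"
proof -
  interpret partial_order "degrees r" by (rule partial_order_degrees)
  show ?thesis
  proof unfold_locales
    fix x y assume "x \<in> carrier (degrees r)" "y \<in> carrier (degrees r)"
    then obtain a b where ab: "x = cls a" "y = cls b" unfolding carrier_degrees by auto
    show "\<exists>s. least (degrees r) s (Upper (degrees r) {x, y})"
      unfolding ab using least_Upper_cls by blast
    show "\<exists>s. greatest (degrees r) s (Lower (degrees r) {x, y})"
      unfolding ab using greatest_Lower_cls by blast
  qed (use least_bt greatest_tp in blast)+
qed

sublocale L: bounded_lattice "degrees r"
  by (rule bounded_lattice_degrees)

lemma join_cls: "join (degrees r) (cls a) (cls b) = cls (jn a b)"
proof (rule L.joinI)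
  fix s assume "least (degrees r) s (Upper (degrees r) {cls a, cls b})"
  then show "s = cls (jn a b)" using least_Upper_cls L.least_unique by blast
qed (auto simp: carrier_degrees)

lemma meet_cls: "meet (degrees r) (cls a) (cls b) = cls (mt a b)"
proof (rule L.meetI)
  fix s assume "greatest (degrees r) s (Lower (degrees r) {cls a, cls b})"
  then show "s = cls (mt a b)" using greatest_Lower_cls L.greatest_unique by blast
qed (auto simp: carrier_degrees)

lemma bottom_cls: "bottom (degrees r) = cls bt"
  using L.bottom_least least_bt L.least_unique by blast

lemma top_cls: "top (degrees r) = cls tp"
  using L.top_greatest greatest_tp L.greatest_unique by blast

lemma least_residual_cls:
  "least (degrees r) (cls (res a b))
    {c \<in> carrier (degrees r). le (degrees r) (cls b) (join (degrees r) (cls a) c)}"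
  unfolding least_def carrier_degrees
  by (auto simp: join_cls cls_le_iff res_le_iff jn_res)

sublocale B: brouwer_algebra "degrees r"
proof unfold_locales
  show "bottom (degrees r) \<noteq> top (degrees r)"
    using not_tp_le_bt by (simp add: bottom_cls top_cls cls_eq_iff)
  fix x y assume "x \<in> carrier (degrees r)" "y \<in> carrier (degrees r)"
  then obtain a b where ab: "x = cls a" "y = cls b" unfolding carrier_degrees by auto
  show "\<exists>c. least (degrees r) c
      {c \<in> carrier (degrees r). le (degrees r) y (join (degrees r) x c)}"
    unfolding ab using least_residual_cls by blast
qed

lemma residual_cls: "B.residual (cls a) (cls b) = cls (res a b)"
  unfolding B.residual_def by (rule the_equality, rule least_residual_cls, rule L.least_unique[OF _ least_residual_cls])

section \<open>Values of formulas on representatives, and soundness\<close>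

primrec val :: "(nat \<Rightarrow> 'a) \<Rightarrow> form \<Rightarrow> 'a" where
  "val v (Atom i) = v i"
| "val v (\<alpha> \<^bold>\<or> \<beta>) = mt (val v \<alpha>) (val v \<beta>)"
| "val v (\<alpha> \<^bold>\<and> \<beta>) = jn (val v \<alpha>) (val v \<beta>)"
| "val v (\<alpha> \<^bold>\<rightarrow> \<beta>) = res (val v \<alpha>) (val v \<beta>)"
| "val v (\<^bold>\<not> \<alpha>) = res (val v \<alpha>) tp"

lemma value_of_cls: "B.value_of (\<lambda>i. cls (v i)) \<alpha> = cls (val v \<alpha>)"
  by (induction \<alpha>) (simp_all add: join_cls meet_cls residual_cls top_cls)

lemma Th_degrees: "Th (degrees r) = {\<alpha>. \<forall>v. r (val v \<alpha>) bt}"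
proof -
  have "(\<forall>v. range v \<subseteq> carrier (degrees r) \<longrightarrow> B.value_of v \<alpha> = bottom (degrees r)) \<longleftrightarrow>
      (\<forall>v. r (val v \<alpha>) bt)" for \<alpha>
  proof (intro iffI allI impI)
    fix v :: "nat \<Rightarrow> 'a"
    assume all: "\<forall>v. range v \<subseteq> carrier (degrees r) \<longrightarrow> B.value_of v \<alpha> = bottom (degrees r)"
    have "range (\<lambda>i. cls (v i)) \<subseteq> carrier (degrees r)" by (auto simp: carrier_degrees)
    then have "B.value_of (\<lambda>i. cls (v i)) \<alpha> = bottom (degrees r)" using all by (elim allE impE)
    then show "r (val v \<alpha>) bt" by (simp add: value_of_cls bottom_cls cls_eq_iff)
  next
    fix u :: "nat \<Rightarrow> 'a set"
    assume v: "\<forall>v. r (val v \<alpha>) bt" and "range u \<subseteq> carrier (degrees r)"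
    then have ex: "\<exists>a. u i = cls a" for i unfolding carrier_degrees by (auto simp: subset_iff image_iff)
    define v' where "v' i = (SOME a. u i = cls a)" for i
    have u: "u = (\<lambda>i. cls (v' i))"
    proof
      show "u i = cls (v' i)" for i unfolding v'_def by (rule someI_ex[OF ex])
    qed
    show "B.value_of u \<alpha> = bottom (degrees r)"
      using v unfolding u value_of_cls bottom_cls cls_eq_iff by (simp add: bt_le)
  qed
  then show ?thesis unfolding B.identities_def by simp
qed

text \<open>Turns each implicational axiom into an inequality, with the conclusion below the
  premise.\<close>

lemma res_bt_iff: "r (res a b) bt \<longleftrightarrow> r b a"
proof -
  have "r (jn a bt) a" by (simp add: jn_le_iff r_refl bt_le)
  then show ?thesis unfolding res_le_iff using jn_upper(1) r_trans by blast
qed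

lemma le_jnI1: "r a b \<Longrightarrow> r a (jn b c)"
  using r_trans jn_upper(1) by blast

lemma le_jnI2: "r a c \<Longrightarrow> r a (jn b c)"
  using r_trans jn_upper(2) by blast

lemma jn_mono: "r a a' \<Longrightarrow> r b b' \<Longrightarrow> r (jn a b) (jn a' b')"
  by (simp add: jn_le_iff r_trans[OF _ jn_upper(1)] r_trans[OF _ jn_upper(2)])

lemma mt_mono: "r a a' \<Longrightarrow> r b b' \<Longrightarrow> r (mt a b) (mt a' b')"
  by (simp add: le_mt_iff r_trans[OF mt_lower(1)] r_trans[OF mt_lower(2)])

lemma res_mono: "r a' a \<Longrightarrow> r b b' \<Longrightarrow> r (res a b) (res a' b')"
  unfolding res_le_iff by (rule r_trans[OF _ r_trans[OF jn_res[of b' a'] jn_mono]]) (simp_all add: r_refl)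

text \<open>Distributivity is forced by residuation: the residual of the left side by
  \<open>c\<close> lies below \<open>a\<close> and below \<open>b\<close>, hence below their
  meet.\<close>

lemma jn_mt_distrib: "r (mt (jn a c) (jn b c)) (jn (mt a b) c)"
proof -
  have comm: "r (jn x y) (jn y x)" for x y by (simp add: jn_le_iff jn_upper)
  have "r (res c (mt (jn a c) (jn b c))) a" "r (res c (mt (jn a c) (jn b c))) b"
    unfolding res_le_iff by (rule r_trans[OF mt_lower(1) comm], rule r_trans[OF mt_lower(2) comm])
  then have "r (res c (mt (jn a c) (jn b c))) (mt a b)" by (simp add: le_mt_iff)
  then show ?thesis unfolding res_le_iff by (rule r_trans[OF _ comm])
qed

text \<open>Residuation moves the premises of an axiom into one join on the right of an inequality.
  Modus ponens among these premises is \<open>jn_res\<close>, and proof by cases is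
  \<open>jn_mt_distrib\<close>.\<close>

lemma IPC_sound: "\<alpha> \<in> IPC X \<Longrightarrow> (\<And>\<beta>. \<beta> \<in> X \<Longrightarrow> r (val v \<beta>) bt) \<Longrightarrow> r (val v \<alpha>) bt"
proof (induction rule: IPC.induct)
  case (MP \<alpha> \<beta>)
  then show ?case by (auto simp: res_bt_iff intro: r_trans)
next
  case (K \<alpha> \<beta>)
  show ?case by (simp only: val.simps res_bt_iff, simp add: res_le_iff jn_upper le_jnI1 le_jnI2)
next
  case (S \<alpha> \<beta> \<gamma>)
  let ?a = "val v \<alpha>" and ?b = "val v \<beta>" and ?c = "val v \<gamma>"
  let ?d = "jn ?a (jn (res ?a ?b) (res ?a (res ?b ?c)))"
  have "r ?a ?d" "r (res ?a ?b) ?d" "r (res ?a (res ?b ?c)) ?d"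
    using r_refl[of ?d] by (simp_all add: jn_le_iff)
  then have "r ?b ?d" "r (res ?b ?c) ?d"
    by (auto intro: r_trans[OF jn_res[of _ ?a]] simp: jn_le_iff)
  then have "r ?c ?d" by (auto intro: r_trans[OF jn_res[of ?c ?b]] simp: jn_le_iff)
  then show ?case by (simp only: val.simps res_bt_iff, simp add: res_le_iff)
next
  case (disjE \<alpha> \<gamma> \<beta>)
  let ?a = "val v \<alpha>" and ?b = "val v \<beta>" and ?c = "val v \<gamma>"
  let ?e = "jn (res ?b ?c) (res ?a ?c)"
  have "r ?a (jn ?a ?e)" "r (res ?a ?c) (jn ?a ?e)" "r ?b (jn ?b ?e)" "r (res ?b ?c) (jn ?b ?e)"
    using r_refl[of "jn ?a ?e"] r_refl[of "jn ?b ?e"] by (simp_all add: jn_le_iff)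
  then have "r ?c (jn ?a ?e)" "r ?c (jn ?b ?e)"
    by (auto intro: r_trans[OF jn_res[of ?c ?a]] r_trans[OF jn_res[of ?c ?b]] simp: jn_le_iff)
  then have "r ?c (mt (jn ?a ?e) (jn ?b ?e))" by (simp add: le_mt_iff)
  from r_trans[OF this jn_mt_distrib] have "r ?c (jn (mt ?a ?b) ?e)" .
  then show ?case by (simp only: val.simps res_bt_iff, simp add: res_le_iff)
next
  case (negI \<alpha> \<beta>)
  let ?a = "val v \<alpha>" and ?b = "val v \<beta>"
  let ?d = "jn ?a (jn (res ?a (res ?b tp)) (res ?a ?b))"
  have "r ?a ?d" "r (res ?a ?b) ?d" "r (res ?a (res ?b tp)) ?d"
    using r_refl[of ?d] by (simp_all add: jn_le_iff)
  then have "r ?b ?d" "r (res ?b tp) ?d"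
    by (auto intro: r_trans[OF jn_res[of _ ?a]] simp: jn_le_iff)
  then have "r tp ?d" by (auto intro: r_trans[OF jn_res[of tp ?b]] simp: jn_le_iff)
  then show ?case by (simp only: val.simps res_bt_iff, simp add: res_le_iff)
next
  case (negE \<alpha> \<beta>)
  have "r (val v \<beta>) (jn (val v \<alpha>) (res (val v \<alpha>) tp))"
    by (rule r_trans[OF le_tp jn_res])
  then show ?case by (simp only: val.simps res_bt_iff, simp add: res_le_iff)
next
  case (conjI \<alpha> \<beta>)
  show ?case by (simp only: val.simps res_bt_iff, simp add: res_le_iff jn_le_iff jn_upper le_jnI1 le_jnI2)
next
  case (disjI1 \<alpha> \<beta>)
  show ?case by (simp add: res_bt_iff mt_lower)
next
  case (disjI2 \<alpha> \<beta>)
  show ?case by (simp add: res_bt_iff mt_lower)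
qed (auto simp: res_bt_iff jn_upper)

text \<open>By \<open>jn_res\<close> the greatest element lies below the join of a value and its
  negation, hence below one of them. Whichever it is, its own negation is then least.\<close>

lemma JAN_sound:
  assumes top_join: "\<And>a b. r tp (jn a b) \<Longrightarrow> r tp a \<or> r tp b"
  shows "JAN \<subseteq> Th (degrees r)"
proof
  fix \<alpha> assume \<alpha>: "\<alpha> \<in> JAN"
  have "r (val v \<alpha>) bt" for v
    using \<alpha> unfolding JAN_def
  proof (rule IPC_sound)
    fix \<beta> assume "\<beta> \<in> {\<^bold>\<not> \<alpha> \<^bold>\<or> \<^bold>\<not> \<^bold>\<not> \<alpha> | \<alpha>. True}"
    then obtain \<gamma> where \<beta>: "\<beta> = \<^bold>\<not> \<gamma> \<^bold>\<or> \<^bold>\<not> \<^bold>\<not> \<gamma>" by blast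
    let ?c = "val v \<gamma>"
    have "r tp ?c \<or> r tp (res ?c tp)" using top_join jn_res by blast
    then have "r (res ?c tp) bt \<or> r (res (res ?c tp) tp) bt" by (simp add: res_bt_iff)
    then show "r (val v \<beta>) bt"
      unfolding \<beta> val.simps using r_trans[OF mt_lower(1)] r_trans[OF mt_lower(2)] by blast
  qed
  then show "\<alpha> \<in> Th (degrees r)" by (simp add: Th_degrees)
qed

text \<open>\<open>H\<close> embeds the up-sets of a finite cube, ordered by reverse inclusion, as a Brouwer algebra.\<close>

lemma Th_subset_JAN:
  fixes H :: "nat set set \<Rightarrow> 'a"
  assumes H_mono: "\<And>U V. U \<subseteq> V \<Longrightarrow> r (H V) (H U)"
    and H_un: "\<And>N U V c. finite N \<Longrightarrow> upset N U \<Longrightarrow> upset N V \<Longrightarrow> r c (H U) \<Longrightarrow> r c (H V) \<Longrightarrow> r c (H (U \<union> V))"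
    and H_int: "\<And>N U V c. finite N \<Longrightarrow> upset N U \<Longrightarrow> upset N V \<Longrightarrow> r (H U) c \<Longrightarrow> r (H V) c \<Longrightarrow> r (H (U \<inter> V)) c"
    and H_res: "\<And>N U V c. finite N \<Longrightarrow> upset N U \<Longrightarrow> upset N V \<Longrightarrow> r (H V) (jn (H U) c) \<Longrightarrow>
      r (H {Y. Y \<subseteq> N \<and> (\<forall>Z\<in>U. Y \<union> Z \<in> V)}) c"
    and H_empty: "r tp (H {})"
    and H_bt: "\<And>U. r (H U) bt \<Longrightarrow> {} \<in> U"
  shows "Th (degrees r) \<subseteq> JAN"
proof (rule subsetI, rule ccontr)
  fix \<alpha> assume \<alpha>: "\<alpha> \<in> Th (degrees r)" "\<alpha> \<notin> JAN"
  obtain N V where N: "finite N" and V_up: "\<forall>p. upset N (V p)" and \<alpha>_false: "{} \<notin> truth_set N V \<alpha>"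
    using cube_completeness[OF \<alpha>(2)] by (elim exE HOL.conjE)
  have V: "upset N (V p)" for p using V_up ..
  note up = upset_truth_set[of N V, OF V]
  \<comment> \<open>One half is \<open>H_res\<close> applied to the residual itself. The other is
    modus ponens for up-sets: the implication meets \<open>A\<close> inside
    \<open>B\<close>.\<close>
  have res: "r (H {Y. Y \<subseteq> N \<and> (\<forall>Z\<in>A. Y \<union> Z \<in> B)}) (res (H A) (H B))"
    "r (res (H A) (H B)) (H {Y. Y \<subseteq> N \<and> (\<forall>Z\<in>A. Y \<union> Z \<in> B)})"
    if A: "upset N A" and B: "upset N B" for A B
  proof -
    let ?I = "{Y. Y \<subseteq> N \<and> (\<forall>Z\<in>A. Y \<union> Z \<in> B)}"
    show "r (H ?I) (res (H A) (H B))" by (rule H_res[OF N A B jn_res])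
    have I: "upset N ?I"
      unfolding upset_def
    proof (intro HOL.conjI allI impI)
      fix Y Z assume Y: "Y \<in> ?I" "Y \<subseteq> Z" "Z \<subseteq> N"
      show "Z \<in> ?I"
      proof (clarify, intro HOL.conjI ballI)
        fix T assume T: "T \<in> A"
        then have "Y \<union> T \<in> B" "T \<subseteq> N" using Y A unfolding upset_def by auto
        then show "Z \<union> T \<in> B" using B Y unfolding upset_def by (meson Un_mono Un_subset_iff order_refl)
      qed (use Y in auto)
    qed auto
    have "A \<inter> ?I \<subseteq> B"
    proof
      fix Z assume "Z \<in> A \<inter> ?I"
      then have "Z \<union> Z \<in> B" by auto
      then show "Z \<in> B" by simp
    qed
    then have "r (H B) (H (A \<inter> ?I))" by (rule H_mono)
    also have "r (H (A \<inter> ?I)) (jn (H A) (H ?I))" by (rule H_int[OF N A I]) (rule jn_upper)+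
    finally (r_trans) show "r (res (H A) (H B)) (H ?I)" unfolding res_le_iff .
  qed
  \<comment> \<open>Only equivalence can be expected, since the images are problems rather than
    degrees.\<close>
  have equiv: "r (val (\<lambda>i. H (V i)) \<beta>) (H (truth_set N V \<beta>)) \<and> r (H (truth_set N V \<beta>)) (val (\<lambda>i. H (V i)) \<beta>)" for \<beta>
  proof (induction \<beta>)
    case (Atom p)
    then show ?case by (simp add: r_refl)
  next
    case (Or \<beta> \<gamma>)
    let ?B = "truth_set N V \<beta>" and ?C = "truth_set N V \<gamma>"
    have "r (mt (H ?B) (H ?C)) (H (?B \<union> ?C))" by (rule H_un[OF N up up mt_lower])
    moreover have "r (H (?B \<union> ?C)) (mt (H ?B) (H ?C))" by (simp add: le_mt_iff H_mono)
    ultimately show ?case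
      using Or by (auto intro: r_trans[OF mt_mono[of _ "H ?B" _ "H ?C"]] r_trans[OF _ mt_mono[of "H ?B" _ "H ?C"]])
  next
  case (And \<beta> \<gamma>)
    let ?B = "truth_set N V \<beta>" and ?C = "truth_set N V \<gamma>"
    have "r (H (?B \<inter> ?C)) (jn (H ?B) (H ?C))" by (rule H_int[OF N up up jn_upper])
    moreover have "r (jn (H ?B) (H ?C)) (H (?B \<inter> ?C))" by (simp add: jn_le_iff H_mono)
    ultimately show ?case
      using And by (auto intro: r_trans[OF jn_mono[of _ "H ?B" _ "H ?C"]] r_trans[OF _ jn_mono[of "H ?B" _ "H ?C"]])
  next
  case (Imp \<beta> \<gamma>)
    let ?b = "val (\<lambda>i. H (V i)) \<beta>" and ?c = "val (\<lambda>i. H (V i)) \<gamma>"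
    let ?B = "truth_set N V \<beta>" and ?C = "truth_set N V \<gamma>"
    \<comment> \<open>Forcing an implication quantifies over the members of \<open>?B\<close> above
      \<open>Y\<close>. As \<open>?B\<close> is an up-set, these are exactly the unions of
      \<open>Y\<close> with members of \<open>?B\<close>.\<close>
    have "truth_set N V (\<beta> \<^bold>\<rightarrow> \<gamma>) = {Y. Y \<subseteq> N \<and> (\<forall>Z\<in>?B. Y \<union> Z \<in> ?C)}"
    proof -
      have "(\<forall>Z. Y \<subseteq> Z \<longrightarrow> Z \<subseteq> N \<longrightarrow> Z \<in> ?B \<longrightarrow> Z \<in> ?C) \<longleftrightarrow> (\<forall>Z\<in>?B. Y \<union> Z \<in> ?C)" if "Y \<subseteq> N" for Y
      proof (intro iffI ballI allI impI)
        fix Z assume *: "\<forall>Z. Y \<subseteq> Z \<longrightarrow> Z \<subseteq> N \<longrightarrow> Z \<in> ?B \<longrightarrow> Z \<in> ?C" "Z \<in> ?B"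
        have "Z \<subseteq> N" by (rule upset_subset[OF up *(2)])
        moreover have "Y \<union> Z \<in> ?B" by (rule upset_mono[OF up *(2)]) (use that calculation in auto)
        ultimately show "Y \<union> Z \<in> ?C" using * that by simp
      next
        fix Z assume "\<forall>Z\<in>?B. Y \<union> Z \<in> ?C" "Y \<subseteq> Z" "Z \<subseteq> N" "Z \<in> ?B"
        then show "Z \<in> ?C" by (metis Un_absorb1)
      qed
      then show ?thesis by auto
    qed
    moreover have "r (res ?b ?c) (res (H ?B) (H ?C))" "r (res (H ?B) (H ?C)) (res ?b ?c)"
      using Imp by (auto intro: res_mono)
    ultimately show ?case
      using res[OF up[of \<beta>] up[of \<gamma>]] r_trans[of "res ?b ?c"] r_trans[of _ _ "res ?b ?c"] by auto
  next
    case (Neg \<beta>)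
    let ?b = "val (\<lambda>i. H (V i)) \<beta>"
    let ?B = "truth_set N V \<beta>"
    have em: "upset N {}" unfolding upset_def by simp
    \<comment> \<open>Negation becomes implication into the empty up-set, whose image is equivalent
      to \<open>tp\<close>.\<close>
    have "truth_set N V (\<^bold>\<not> \<beta>) = {Y. Y \<subseteq> N \<and> (\<forall>Z\<in>?B. Y \<union> Z \<in> {})}"
    proof -
      have "(\<forall>Z. Y \<subseteq> Z \<longrightarrow> Z \<subseteq> N \<longrightarrow> Z \<notin> ?B) \<longleftrightarrow> ?B = {}" if "Y \<subseteq> N" for Y
      proof
        assume *: "\<forall>Z. Y \<subseteq> Z \<longrightarrow> Z \<subseteq> N \<longrightarrow> Z \<notin> ?B"
        have "Y \<union> Z \<in> ?B \<and> Y \<union> Z \<subseteq> N" if Z: "Z \<in> ?B" for Z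
        proof
          show "Y \<union> Z \<subseteq> N" using upset_subset[OF up Z] \<open>Y \<subseteq> N\<close> by simp
          then show "Y \<union> Z \<in> ?B" by (rule upset_mono[OF up Z Un_upper2])
        qed
        then show "?B = {}" using * by blast
      qed auto
      then show ?thesis by auto
    qed
    moreover have "r (res ?b tp) (res (H ?B) (H {}))" "r (res (H ?B) (H {})) (res ?b tp)"
      using Neg H_empty le_tp by (auto intro: res_mono)
    ultimately show ?case
      using res[OF up[of \<beta>] em] r_trans[of "res ?b tp"] r_trans[of _ _ "res ?b tp"] by auto
  qed
  have "r (val (\<lambda>i. H (V i)) \<alpha>) bt" using \<alpha>(1) by (simp add: Th_degrees)
  with equiv[of \<alpha>] have "r (H (truth_set N V \<alpha>)) bt" by (auto intro: r_trans)
  then show False using H_bt \<alpha>_false by blast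
qed

end


section \<open>Partial functions up to enumeration reducibility\<close>

lemma mem_gr: "x \<in> gr f \<longleftrightarrow> f (pfst x) = Some (psnd x)"
proof -
  have "x \<in> gr f \<longleftrightarrow> (\<exists>a b. x = pair a b \<and> f a = Some b)"
    unfolding gr_def Map.graph_def by auto
  then show ?thesis by (metis fst_conv pair_pfst_psnd prod_encode_inverse snd_conv)
qed

lemma gr_inj: "gr f = gr g \<Longrightarrow> f = g"
proof
  fix n assume eq: "gr f = gr g"
  have "f n = Some y \<longleftrightarrow> g n = Some y" for y
    using eq mem_gr[of "pair n y" f] mem_gr[of "pair n y" g] by simp
  then show "f n = g n" by (metis option.exhaust)
qed

text \<open>The join at the level of graphs: a point coding argument and value is relabelled by
  putting 0 or 1 in front of its argument. It is defined for arbitrary sets because operators act on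
  all sets.\<close>

definition jset :: "nat set \<Rightarrow> nat set \<Rightarrow> nat set" where
  "jset X Y = {x. pfst (pfst x) = 0 \<and> pair (psnd (pfst x)) (psnd x) \<in> X \<or>
    pfst (pfst x) = 1 \<and> pair (psnd (pfst x)) (psnd x) \<in> Y}"

definition part :: "nat \<Rightarrow> nat set \<Rightarrow> nat set" where
  "part i A = {x. pair (pair i (pfst x)) (psnd x) \<in> A}"

definition zset :: "nat set \<Rightarrow> nat set" where
  "zset S = {x. pfst x \<in> S \<and> psnd x = 0}"

definition pjoin :: "pfun \<Rightarrow> pfun \<Rightarrow> pfun" where
  "pjoin f g n = (if pfst n = 0 then f (psnd n) else if pfst n = 1 then g (psnd n) else None)"

definition zfun :: "nat set \<Rightarrow> pfun" where
  "zfun S n = (if n \<in> S then Some 0 else None)"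

definition tag :: "nat \<Rightarrow> pfun \<Rightarrow> pfun" where
  "tag k f = pjoin [0 \<mapsto> k] f"

lemma gr_pjoin: "gr (pjoin f g) = jset (gr f) (gr g)"
  by (auto simp: mem_gr pjoin_def jset_def split: if_splits)

lemma gr_zfun: "gr (zfun S) = zset S"
  by (auto simp: mem_gr zfun_def zset_def split: if_splits)

lemma gr_singleton: "gr [0 \<mapsto> k] = {pair 0 k}"
proof (rule Set.set_eqI)
  fix x show "x \<in> gr [0 \<mapsto> k] \<longleftrightarrow> x \<in> {pair 0 k}"
    using pair_pfst_psnd[of x] by (auto simp: mem_gr simp del: prod.collapse pair_pfst_psnd split: if_splits)
qed

lemma gr_tag: "gr (tag k f) = jset {pair 0 k} (gr f)"
  by (simp add: tag_def gr_pjoin gr_singleton)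

lemma part_jset [simp]: "part 0 (jset X Y) = X" "part (Suc 0) (jset X Y) = Y"
  by (auto simp: part_def jset_def)

lemma part_gr [simp]:
  "part 0 (gr (pjoin f g)) = gr f" "part (Suc 0) (gr (pjoin f g)) = gr g"
  "part (Suc 0) (gr (tag k f)) = gr f"
  by (simp_all add: gr_pjoin gr_tag)

text \<open>The graph point that reveals the tag. Its appearance is a positive event, so an operator
  can wait for it.\<close>

definition tag_elem :: "nat \<Rightarrow> nat" where
  "tag_elem k = pair (pair 0 0) k"

lemma tag_elem_mem: "tag_elem k \<in> gr (tag l f) \<longleftrightarrow> k = l"
  by (simp add: tag_elem_def gr_tag jset_def)

section \<open>Basic enumeration operators and enumeration reducibility\<close>

lemma dec_finite:
  assumes "finite Y" "computable1 f" shows "dec (\<lambda>x. f x \<in> Y)"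
  using assms(1)
proof induction
  case (insert y Y)
  have "dec (\<lambda>x. f x = y \<or> f x \<in> Y)" by (intro dec_disj dec_eq computable1_const assms(2) insert.IH)
  then show ?case by simp
qed (simp add: dec_const)

lemma enumerable_finite_bex:
  assumes "finite I" "\<And>i. i \<in> I \<Longrightarrow> enumerable (P i)"
  shows "enumerable (\<lambda>x A. \<exists>i\<in>I. P i x A)"
  using assms
proof (induction I)
  case (insert i I)
  have "enumerable (\<lambda>x A. P i x A \<or> (\<exists>i\<in>I. P i x A))" by (intro enumerable_disj insert) auto
  then show ?case by simp
qed (simp add: enumerable_dec dec_const)

lemma enumerable_finite_ball:
  assumes "finite I" "\<And>i. i \<in> I \<Longrightarrow> enumerable (P i)"
  shows "enumerable (\<lambda>x A. \<forall>i\<in>I. P i x A)"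
  using assms
proof (induction I)
  case (insert i I)
  have "enumerable (\<lambda>x A. P i x A \<and> (\<forall>i\<in>I. P i x A))" by (intro enumerable_conj insert) auto
  then show ?case by simp
qed (simp add: enumerable_dec dec_const)

lemma e_operator_const: "semidec (\<lambda>x. x \<in> W) \<Longrightarrow> e_operator (\<lambda>A. W)"
  unfolding e_operator_iff by (rule enumerable_const)

lemma e_operator_part: "e_operator (part i)"
  unfolding e_operator_iff part_def mem_Collect_eq
  by (intro enumerable_mem computable1_pair computable1_pfst computable1_psnd computable1_id computable1_const)

lemma e_operator_jset:
  assumes "e_operator \<Phi>" "e_operator \<Psi>" shows "e_operator (\<lambda>A. jset (\<Phi> A) (\<Psi> A))"
  unfolding e_operator_iff jset_def mem_Collect_eq
  by (intro enumerable_disj enumerable_conj enumerable_dec dec_eq enumerable_op[OF assms(1)]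
      enumerable_op[OF assms(2)] computable1_pair computable1_pfst computable1_psnd computable1_id computable1_const)

lemma e_operator_zset: "e_operator zset"
  unfolding e_operator_iff zset_def mem_Collect_eq
  by (intro enumerable_conj enumerable_dec dec_eq enumerable_mem computable1_pfst computable1_psnd computable1_id computable1_const)

lemma semidec_zset:
  assumes "semidec (\<lambda>x. x \<in> W)" shows "semidec (\<lambda>x. x \<in> zset W)"
  unfolding zset_def mem_Collect_eq
  by (intro semidec_conj semidec_subst[OF assms] semidec_dec dec_eq computable1_pfst computable1_psnd computable1_id computable1_const)

lemma semidec_finite: "finite F \<Longrightarrow> semidec (\<lambda>x. x \<in> F)"
  by (intro semidec_dec dec_finite computable1_id)

lemma e_operator_tag: "e_operator (\<lambda>A. jset {pair 0 k} (zset A))"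
  by (intro e_operator_jset e_operator_const semidec_finite e_operator_zset) simp

lemma e_le_refl: "e_le A A"
  unfolding e_le_def using e_operator_id by blast

lemma e_le_trans:
  assumes "e_le A B" "e_le B C" shows "e_le A C"
proof -
  obtain \<Phi> \<Psi> where "e_operator \<Phi>" "A = \<Phi> B" "e_operator \<Psi>" "B = \<Psi> C"
    using assms unfolding e_le_def by blast
  then show ?thesis unfolding e_le_def using e_operator_comp[of \<Phi> \<Psi>] by blast
qed

lemma e_le_op: "e_operator \<Phi> \<Longrightarrow> e_le (\<Phi> A) A"
  unfolding e_le_def by blast

lemma e_le_jset:
  assumes "e_le X C" "e_le Y C" shows "e_le (jset X Y) C"
proof -
  obtain \<Phi> \<Psi> where "e_operator \<Phi>" "X = \<Phi> C" "e_operator \<Psi>" "Y = \<Psi> C"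
    using assms unfolding e_le_def by blast
  then show ?thesis unfolding e_le_def using e_operator_jset[of \<Phi> \<Psi>] by blast
qed

lemma e_le_jset_left: "e_le X (jset X Y)"
  using e_le_op[OF e_operator_part, of 0 "jset X Y"] by simp

lemma e_le_jset_right: "e_le Y (jset X Y)"
  using e_le_op[OF e_operator_part, of 1 "jset X Y"] by simp

lemma e_le_zset: "e_le S (zset S)"
proof -
  have "e_operator (\<lambda>A. {x. pair x 0 \<in> A})"
    unfolding e_operator_iff mem_Collect_eq by (intro enumerable_mem computable1_pair computable1_id computable1_const)
  from e_le_op[OF this, of "zset S"] show ?thesis by (simp add: zset_def)
qed

text \<open>Deleting the fixed finite set \<open>F - X\<close> is an enumeration operation. Hence
  finite additions cannot make a set reducible where it was not.\<close>

lemma e_le_finite_diff: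
  assumes "finite F" shows "e_le X (X \<union> F)"
proof -
  have "e_operator (\<lambda>A. {x. x \<in> A \<and> \<not> x \<in> F - X})"
    unfolding e_operator_iff mem_Collect_eq
    by (intro enumerable_conj enumerable_mem enumerable_dec dec_not dec_finite computable1_id) (use assms in simp)
  from e_le_op[OF this, of "X \<union> F"] show ?thesis by (auto simp: Un_Diff intro: back_subst[of "\<lambda>A. e_le A _"])
qed

lemma e_le_tag_zfun: "e_le (gr (tag k (zfun S))) S"
  unfolding gr_tag gr_zfun using e_le_op[OF e_operator_tag] .

lemma tag_zfun_e_le: "e_le S (gr (tag k (zfun S)))"
  unfolding gr_tag gr_zfun using e_le_trans[OF e_le_zset e_le_jset_right] .

lemma e_le_empty: "e_le {} A"
  using e_le_op[OF e_operator_const[of "{}"]] semidec_finite[of "{}"] by simp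


section \<open>An independent sequence of sets\<close>

text \<open>Forcing with finite conditions: \<open>P\<close> goes into \<open>G\<close> and
  \<open>Q\<close> stays out. Take an undecided point of column \<open>i\<close>. If a permitted
  finite set off that column makes \<open>\<Phi>\<close> enumerate its coordinate \<open>x\<close>,
  add that set and exclude the point; otherwise include the point, and by compactness
  \<open>\<Phi>\<close> never enumerates \<open>x\<close>.\<close>

lemma independence_step:
  assumes \<Phi>: "e_operator \<Phi>" and fin: "finite P" "finite Q" and disj: "P \<inter> Q = {}"
  shows "\<exists>P' Q'. finite P' \<and> finite Q' \<and> P' \<inter> Q' = {} \<and> P \<subseteq> P' \<and> Q \<subseteq> Q' \<and>
    (\<forall>G. P' \<subseteq> G \<longrightarrow> G \<inter> Q' = {} \<longrightarrow> {x. pair i x \<in> G} \<noteq> \<Phi> {z\<in>G. pfst z \<noteq> i})"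
proof -
  have "infinite (range (pair i))" using finite_imageD[of "pair i" UNIV] by (auto simp: inj_on_def)
  then obtain x where x: "pair i x \<notin> P \<union> Q"
    using fin finite_subset[of "range (pair i)" "P \<union> Q"] by auto
  show ?thesis
  proof (cases "\<exists>F. finite F \<and> F \<subseteq> {z. pfst z \<noteq> i} \<and> F \<inter> Q = {} \<and> x \<in> \<Phi> F")
    case True
    then obtain F where F: "finite F" "F \<subseteq> {z. pfst z \<noteq> i}" "F \<inter> Q = {}" "x \<in> \<Phi> F" by blast
    have neq: "{x. pair i x \<in> G} \<noteq> \<Phi> {z\<in>G. pfst z \<noteq> i}"
      if G: "P \<union> F \<subseteq> G" "G \<inter> insert (pair i x) Q = {}" for G
    proof -
      have "F \<subseteq> {z\<in>G. pfst z \<noteq> i}" using F G by blast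
      then have "x \<in> \<Phi> {z\<in>G. pfst z \<noteq> i}" using e_operator_mono[OF \<Phi>] F(4) by blast
      then show ?thesis using G(2) by blast
    qed
    show ?thesis
    proof (rule exI[of _ "P \<union> F"], rule exI[of _ "insert (pair i x) Q"], intro HOL.conjI allI impI)
      show "(P \<union> F) \<inter> insert (pair i x) Q = {}" using disj x F by auto
    qed (use fin F(1) neq in \<open>simp_all add: subset_insertI2\<close>)
  next
    case False
    have neq: "{x. pair i x \<in> G} \<noteq> \<Phi> {z\<in>G. pfst z \<noteq> i}"
      if G: "insert (pair i x) P \<subseteq> G" "G \<inter> Q = {}" for G
    proof
      assume "{x. pair i x \<in> G} = \<Phi> {z\<in>G. pfst z \<noteq> i}"
      then have "x \<in> \<Phi> {z\<in>G. pfst z \<noteq> i}" using G(1) by blast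
      then obtain F where "F \<subseteq> {z\<in>G. pfst z \<noteq> i}" "finite F" "x \<in> \<Phi> F"
        using e_operator_finite[OF \<Phi>] by blast
      then show False using False G(2) by blast
    qed
    show ?thesis
    proof (rule exI[of _ "insert (pair i x) P"], rule exI[of _ Q], intro HOL.conjI allI impI)
      show "insert (pair i x) P \<inter> Q = {}" using disj x by auto
    qed (use fin neq in \<open>simp_all add: subset_insertI2\<close>)
  qed
qed

text \<open>Stage \<open>pair i n\<close> ensures that column \<open>i\<close> is not obtained from
  the other columns by the operator \<open>E n\<close>. The conditions only grow, and
  \<open>G\<close> is the union of their positive parts.\<close>

lemma independent_set_exists: "\<exists>G. \<forall>i. \<not> e_le {x. pair i x \<in> G} {z\<in>G. pfst z \<noteq> i}"
proof -
  obtain E :: "nat \<Rightarrow> nat set \<Rightarrow> nat set" where E: "\<And>\<Phi>. e_operator \<Phi> \<Longrightarrow> \<Phi> \<in> range E"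
    using e_operators_enumerated by blast
  define good where "good c \<longleftrightarrow> finite (fst c) \<and> finite (snd c) \<and> fst c \<inter> snd c = {}"
    for c :: "nat set \<times> nat set"
  define meets where "meets s c \<longleftrightarrow> (e_operator (E (psnd s)) \<longrightarrow> (\<forall>G. fst c \<subseteq> G \<longrightarrow> G \<inter> snd c = {} \<longrightarrow>
      {x. pair (pfst s) x \<in> G} \<noteq> E (psnd s) {z\<in>G. pfst z \<noteq> pfst s}))" for s and c :: "nat set \<times> nat set"
  have "\<exists>c. \<forall>s. good (c s) \<and> (fst (c s) \<subseteq> fst (c (Suc s)) \<and> snd (c s) \<subseteq> snd (c (Suc s)) \<and> meets s (c (Suc s)))"
  proof (rule dependent_nat_choice)
    show "\<exists>c. good c" by (rule exI[of _ "({}, {})"]) (simp add: good_def)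
    fix c s assume c: "good c"
    show "\<exists>d. good d \<and> (fst c \<subseteq> fst d \<and> snd c \<subseteq> snd d \<and> meets s d)"
    proof (cases "e_operator (E (psnd s))")
      case True
      then obtain P Q where "finite P" "finite Q" "P \<inter> Q = {}" "fst c \<subseteq> P" "snd c \<subseteq> Q"
        "\<forall>G. P \<subseteq> G \<longrightarrow> G \<inter> Q = {} \<longrightarrow> {x. pair (pfst s) x \<in> G} \<noteq> E (psnd s) {z\<in>G. pfst z \<noteq> pfst s}"
        using independence_step[of "E (psnd s)" "fst c" "snd c" "pfst s"] c unfolding good_def by blast
      then show ?thesis by (intro exI[of _ "(P, Q)"]) (simp add: good_def meets_def)
    next
      case False
      then show ?thesis using c by (intro exI[of _ c]) (simp add: meets_def)
    qed
  qed
  then obtain c where c: "\<And>s. good (c s)" "\<And>s. fst (c s) \<subseteq> fst (c (Suc s))"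
    "\<And>s. snd (c s) \<subseteq> snd (c (Suc s))" "\<And>s. meets s (c (Suc s))" by blast
  define G where "G = (\<Union>s. fst (c s))"
  \<comment> \<open>A clash between two stages would already be present at the later one.\<close>
  have disj: "G \<inter> snd (c s) = {}" for s
  proof -
    have "fst (c m) \<inter> snd (c s) = {}" for m
    proof -
      have "fst (c m) \<subseteq> fst (c (max m s))" by (rule lift_Suc_mono_le[of "\<lambda>s. fst (c s)"]) (simp_all add: c(2))
      moreover have "snd (c s) \<subseteq> snd (c (max m s))" by (rule lift_Suc_mono_le[of "\<lambda>s. snd (c s)"]) (simp_all add: c(3))
      moreover have "fst (c (max m s)) \<inter> snd (c (max m s)) = {}" using c(1) unfolding good_def by blast
      ultimately show ?thesis by auto
    qed
    then show ?thesis unfolding G_def by blast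
  qed
  have "\<not> e_le {x. pair i x \<in> G} {z\<in>G. pfst z \<noteq> i}" for i
  proof
    assume "e_le {x. pair i x \<in> G} {z\<in>G. pfst z \<noteq> i}"
    then obtain \<Phi> where \<Phi>: "e_operator \<Phi>" "{x. pair i x \<in> G} = \<Phi> {z\<in>G. pfst z \<noteq> i}"
      unfolding e_le_def by blast
    then obtain n where n: "\<Phi> = E n" using E by blast
    have "fst (c (Suc (pair i n))) \<subseteq> G" unfolding G_def by blast
    then show False using c(4)[of "pair i n"] \<Phi> n disj[of "Suc (pair i n)"] unfolding meets_def by simp
  qed
  then show ?thesis by blast
qed

definition indep :: "nat set" where
  "indep = (SOME G. \<forall>i. \<not> e_le {x. pair i x \<in> G} {z\<in>G. pfst z \<noteq> i})"

text \<open>The set b_i of the overview. It contains all other columns of one infinite family and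
  therefore does not depend on the cube.\<close>

definition cobound :: "nat \<Rightarrow> nat set" where
  "cobound i = {z\<in>indep. pfst z \<noteq> i}"

text \<open>The canonical solution for world \<open>Z\<close>: not reducible to b_i for i in
  \<open>Z\<close>, but, for finite \<open>Z\<close>, reducible to every other b_i.\<close>

definition columns :: "nat set \<Rightarrow> nat set" where
  "columns Z = {z\<in>indep. pfst z \<in> Z}"

lemma columns_not_le: "i \<in> Z \<Longrightarrow> \<not> e_le (columns Z) (cobound i)"
proof
  assume i: "i \<in> Z" "e_le (columns Z) (cobound i)"
  have "e_operator (\<lambda>A. {x. pair i x \<in> A})"
    unfolding e_operator_iff mem_Collect_eq by (intro enumerable_mem computable1_pair computable1_id computable1_const)
  from e_le_op[OF this, of "columns Z"] have "e_le {x. pair i x \<in> indep} (columns Z)"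
    using i by (simp add: columns_def)
  from e_le_trans[OF this i(2)] show False
    unfolding cobound_def indep_def using someI_ex[OF independent_set_exists] by blast
qed

lemma columns_le:
  assumes "finite Z" "i \<notin> Z" shows "e_le (columns Z) (cobound i)"
proof -
  have "e_operator (\<lambda>A. {x. x \<in> A \<and> pfst x \<in> Z})"
    unfolding e_operator_iff mem_Collect_eq
    by (intro enumerable_conj enumerable_mem enumerable_dec dec_finite assms computable1_pfst computable1_id)
  moreover have "{x. x \<in> cobound i \<and> pfst x \<in> Z} = columns Z"
    using assms(2) unfolding cobound_def columns_def by blast
  ultimately show ?thesis using e_le_op[of "\<lambda>A. {x. x \<in> A \<and> pfst x \<in> Z}" "cobound i"] by simp
qed

text \<open>For \<open>j\<close> outside \<open>Z\<close> the columns of \<open>Z\<close> are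
  reducible to b_j. If \<open>X\<close> were as well, so would be everything computed from the two
  together, including \<open>S\<close>.\<close>

lemma not_le_cobound:
  assumes "e_le S (jset (gr (tag k (zfun (columns Z)))) X)" "finite Z" "j \<notin> Z" "\<not> e_le S (cobound j)"
  shows "\<not> e_le X (cobound j)"
  using assms(1,4) e_le_trans e_le_jset e_le_trans[OF e_le_tag_zfun columns_le[OF assms(2,3)]] by blast

text \<open>Finiteness of \<open>Z\<close> makes the tag \<open>set_encode Z\<close> determine
  \<open>Z\<close>. The empty world imposes no condition on \<open>S\<close>, so an up-set
  containing it has a computable solution.\<close>

definition cube_problem :: "nat set set \<Rightarrow> mass_problem" where
  "cube_problem U = {tag (set_encode Z) (zfun S) | Z S. Z \<in> U \<and> finite Z \<and> (\<forall>i\<in>Z. \<not> e_le S (cobound i))}"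


section \<open>The Dyment lattice\<close>

lemma pmap_eq_Some: "pmap \<Phi> \<psi> = Some \<phi> \<longleftrightarrow> \<Phi> (gr \<psi>) = gr \<phi>"
proof -
  have Some: "pmap \<Phi> \<psi> = Some \<chi>" if "\<Phi> (gr \<psi>) = gr \<chi>" for \<chi>
  proof -
    have "(THE \<phi>. gr \<chi> = gr \<phi>) = \<chi>" by (rule the_equality) (simp, rule gr_inj, simp)
    then show ?thesis unfolding pmap_def that by auto
  qed
  have "\<exists>\<chi>. \<Phi> (gr \<psi>) = gr \<chi>" if "pmap \<Phi> \<psi> \<noteq> None"
    using that unfolding pmap_def by presburger
  then show ?thesis using Some by fastforce
qed

lemma D_le_iff: "D_le A B \<longleftrightarrow> (\<exists>\<Phi>. e_operator \<Phi> \<and> (\<forall>\<psi>\<in>B. \<exists>\<phi>\<in>A. \<Phi> (gr \<psi>) = gr \<phi>))"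
proof -
  have "B \<subseteq> dom (pmap \<Phi>) \<and> (\<forall>\<psi>\<in>B. the (pmap \<Phi> \<psi>) \<in> A) \<longleftrightarrow> (\<forall>\<psi>\<in>B. \<exists>\<phi>\<in>A. pmap \<Phi> \<psi> = Some \<phi>)" for \<Phi>
    by (fastforce simp: dom_def)
  then show ?thesis unfolding D_le_def pmap_eq_Some by simp
qed

lemma D_leI:
  assumes "e_operator \<Phi>" "\<And>\<psi>. \<psi> \<in> B \<Longrightarrow> \<exists>\<phi>\<in>A. \<Phi> (gr \<psi>) = gr \<phi>"
  shows "D_le A B"
  unfolding D_le_iff using assms by blast

lemma D_leE:
  assumes "D_le A B"
  obtains \<Phi> where "e_operator \<Phi>" "\<And>\<psi>. \<psi> \<in> B \<Longrightarrow> \<exists>\<phi>\<in>A. \<Phi> (gr \<psi>) = gr \<phi>"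
  using assms unfolding D_le_iff by blast

lemma D_le_subset: "B \<subseteq> A \<Longrightarrow> D_le A B"
  by (rule D_leI[OF e_operator_id]) auto

lemma D_le_trans:
  assumes "D_le A B" "D_le B C" shows "D_le A C"
proof -
  obtain \<Phi> where \<Phi>: "e_operator \<Phi>" "\<And>\<psi>. \<psi> \<in> B \<Longrightarrow> \<exists>\<phi>\<in>A. \<Phi> (gr \<psi>) = gr \<phi>" using assms(1) by (rule D_leE) blast
  obtain \<Psi> where \<Psi>: "e_operator \<Psi>" "\<And>\<psi>. \<psi> \<in> C \<Longrightarrow> \<exists>\<phi>\<in>B. \<Psi> (gr \<psi>) = gr \<phi>" using assms(2) by (rule D_leE) blast
  show ?thesis
  proof (rule D_leI[OF e_operator_comp[OF \<Phi>(1) \<Psi>(1)]])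
    fix \<psi> assume "\<psi> \<in> C"
    then obtain \<chi> where "\<chi> \<in> B" "\<Psi> (gr \<psi>) = gr \<chi>" using \<Psi>(2) by blast
    then show "\<exists>\<phi>\<in>A. \<Phi> (\<Psi> (gr \<psi>)) = gr \<phi>" using \<Phi>(2) by simp
  qed
qed

text \<open>A case distinction using positive information only: all branches run together, and each
  outputs only once its condition has been observed. As exactly one condition holds, the output is
  the graph of one branch and not a mixture.\<close>

lemma D_le_cases:
  assumes I: "finite I" and \<Phi>: "\<And>i. i \<in> I \<Longrightarrow> e_operator (\<Phi> i)"
    and K: "\<And>i. i \<in> I \<Longrightarrow> enumerable (\<lambda>x. K i)"
    and ex: "\<And>\<psi>. \<psi> \<in> B \<Longrightarrow> \<exists>i\<in>I. K i (gr \<psi>) \<and> (\<forall>j\<in>I. K j (gr \<psi>) \<longrightarrow> j = i) \<and> (\<exists>\<phi>\<in>A. \<Phi> i (gr \<psi>) = gr \<phi>)"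
  shows "D_le A B"
proof (rule D_leI)
  show "e_operator (\<lambda>X. {x. \<exists>i\<in>I. K i X \<and> x \<in> \<Phi> i X})"
    unfolding e_operator_iff mem_Collect_eq
    by (intro enumerable_finite_bex[OF I] enumerable_conj K enumerable_op[OF \<Phi>] computable1_id)
  fix \<psi> assume "\<psi> \<in> B"
  from ex[OF this] obtain i \<phi> where i: "i \<in> I" "K i (gr \<psi>)" "\<And>j. j \<in> I \<Longrightarrow> K j (gr \<psi>) \<Longrightarrow> j = i"
    and \<phi>: "\<phi> \<in> A" "\<Phi> i (gr \<psi>) = gr \<phi>" by blast
  have "{x. \<exists>i\<in>I. K i (gr \<psi>) \<and> x \<in> \<Phi> i (gr \<psi>)} = gr \<phi>" using i \<phi>(2) by blast
  then show "\<exists>\<phi>\<in>A. {x. \<exists>i\<in>I. K i (gr \<psi>) \<and> x \<in> \<Phi> i (gr \<psi>)} = gr \<phi>" using \<phi>(1) by blast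
qed

section \<open>Join, meet and residual of mass problems\<close>

definition mjoin :: "mass_problem \<Rightarrow> mass_problem \<Rightarrow> mass_problem" where
  "mjoin A B = {pjoin f g | f g. f \<in> A \<and> g \<in> B}"

definition D_meet :: "mass_problem \<Rightarrow> mass_problem \<Rightarrow> mass_problem" where
  "D_meet A B = tag 0 ` A \<union> tag 1 ` B"

text \<open>
  The set coding an enumeration operator is part of the argument, so that no universal
  enumeration operator is needed.
\<close>

definition apply_op :: "nat set \<Rightarrow> nat set \<Rightarrow> nat set" where
  "apply_op W A = {x. \<exists>u. pair x u \<in> W \<and> (\<forall>y\<in>set_decode u. y \<in> A)}"

text \<open>\<open>W\<close> ranges over all sets: being stored in the solution, it can be consulted
  by \<open>D_le_mjoin_res\<close>, while \<open>D_res_le\<close> supplies the c.e. set of a given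
  operator.\<close>

definition D_res :: "mass_problem \<Rightarrow> mass_problem \<Rightarrow> mass_problem" where
  "D_res A B = {pjoin (zfun W) g | W g. \<forall>f\<in>A. \<exists>\<phi>\<in>B. apply_op W (gr (pjoin f g)) = gr \<phi>}"

lemma mjoinI: "f \<in> A \<Longrightarrow> g \<in> B \<Longrightarrow> pjoin f g \<in> mjoin A B"
  unfolding mjoin_def by blast

lemma mjoinE: "h \<in> mjoin A B \<Longrightarrow> (\<And>f g. h = pjoin f g \<Longrightarrow> f \<in> A \<Longrightarrow> g \<in> B \<Longrightarrow> thesis) \<Longrightarrow> thesis"
  unfolding mjoin_def by blast

lemma mjoin_empty: "mjoin A B = {} \<longleftrightarrow> A = {} \<or> B = {}"
  unfolding mjoin_def by auto

lemma D_le_mjoin: "D_le A (mjoin A B)" "D_le B (mjoin A B)"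
  by (rule D_leI[OF e_operator_part[of 0]], auto elim!: mjoinE,
      rule D_leI[OF e_operator_part[of 1]], auto elim!: mjoinE)

lemma D_mjoin_le:
  assumes "D_le A C" "D_le B C" shows "D_le (mjoin A B) C"
proof -
  obtain \<Phi> where \<Phi>: "e_operator \<Phi>" "\<And>\<psi>. \<psi> \<in> C \<Longrightarrow> \<exists>\<phi>\<in>A. \<Phi> (gr \<psi>) = gr \<phi>" using assms(1) by (rule D_leE) blast
  obtain \<Psi> where \<Psi>: "e_operator \<Psi>" "\<And>\<psi>. \<psi> \<in> C \<Longrightarrow> \<exists>\<phi>\<in>B. \<Psi> (gr \<psi>) = gr \<phi>" using assms(2) by (rule D_leE) blast
  show ?thesis
  proof (rule D_leI[OF e_operator_jset[OF \<Phi>(1) \<Psi>(1)]])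
    fix \<psi> assume "\<psi> \<in> C"
    then obtain f g where "f \<in> A" "\<Phi> (gr \<psi>) = gr f" "g \<in> B" "\<Psi> (gr \<psi>) = gr g" using \<Phi>(2) \<Psi>(2) by blast
    then show "\<exists>\<phi>\<in>mjoin A B. jset (\<Phi> (gr \<psi>)) (\<Psi> (gr \<psi>)) = gr \<phi>"
      by (intro bexI[of _ "pjoin f g"] mjoinI) (simp_all add: gr_pjoin)
  qed
qed

lemma e_operator_add_tag: "e_operator (\<lambda>X. jset {pair 0 k} X)"
  by (intro e_operator_jset e_operator_const semidec_finite e_operator_id) simp

lemma D_meet_le: "D_le (D_meet A B) A" "D_le (D_meet A B) B"
proof -
  show "D_le (D_meet A B) A"
    by (rule D_leI[OF e_operator_add_tag[of 0]]) (auto simp: D_meet_def gr_tag[symmetric])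
  show "D_le (D_meet A B) B"
    by (rule D_leI[OF e_operator_add_tag[of 1]]) (auto simp: D_meet_def gr_tag[symmetric])
qed

lemma D_le_meet:
  assumes "D_le C A" "D_le C B" shows "D_le C (D_meet A B)"
proof -
  obtain \<Phi> where \<Phi>: "e_operator \<Phi>" "\<And>\<psi>. \<psi> \<in> A \<Longrightarrow> \<exists>\<phi>\<in>C. \<Phi> (gr \<psi>) = gr \<phi>" using assms(1) by (rule D_leE) blast
  obtain \<Psi> where \<Psi>: "e_operator \<Psi>" "\<And>\<psi>. \<psi> \<in> B \<Longrightarrow> \<exists>\<phi>\<in>C. \<Psi> (gr \<psi>) = gr \<phi>" using assms(2) by (rule D_leE) blast
  show ?thesis
  proof (rule D_le_cases[of "{0, 1}" "\<lambda>i X. (if i = 0 then \<Phi> else \<Psi>) (part 1 X)" "\<lambda>i X. tag_elem i \<in> X"])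
    show "e_operator (\<lambda>X. (if i = 0 then \<Phi> else \<Psi>) (part 1 X))" for i :: nat
      using e_operator_comp[OF \<Phi>(1) e_operator_part] e_operator_comp[OF \<Psi>(1) e_operator_part] by auto
    show "enumerable (\<lambda>x X. tag_elem i \<in> X)" for i by (intro enumerable_mem computable1_const)
    fix \<psi> assume "\<psi> \<in> D_meet A B"
    then consider f where "f \<in> A" "\<psi> = tag 0 f" | g where "g \<in> B" "\<psi> = tag 1 g" unfolding D_meet_def by blast
    then show "\<exists>i\<in>{0, 1}. tag_elem i \<in> gr \<psi> \<and> (\<forall>j\<in>{0, 1}. tag_elem j \<in> gr \<psi> \<longrightarrow> j = i) \<and>
        (\<exists>\<phi>\<in>C. (if i = 0 then \<Phi> else \<Psi>) (part 1 (gr \<psi>)) = gr \<phi>)"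
      by cases (simp_all add: tag_elem_mem \<Phi>(2) \<Psi>(2))
  qed simp
qed

lemma D_le_mjoin_res: "D_le B (mjoin A (D_res A B))"
proof (rule D_leI)
  \<comment> \<open>The second component of the input is itself a join. Its left part presents
    \<open>W\<close> by points with value 0, and its right part \<open>g\<close> is joined with
    \<open>f\<close> again before the axioms in \<open>W\<close> are applied.\<close>
  let ?\<Phi> = "\<lambda>X. {x. \<exists>u. pair (pair x u) 0 \<in> part 0 (part 1 X) \<and>
    (\<forall>y\<in>set_decode u. y \<in> jset (part 0 X) (part 1 (part 1 X)))}"
  show "e_operator ?\<Phi>"
    unfolding e_operator_iff mem_Collect_eq
    by (intro enumerable_ex enumerable_conj enumerable_ball
        enumerable_op[OF e_operator_comp[OF e_operator_part e_operator_part]]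
        enumerable_op[OF e_operator_jset[OF e_operator_part e_operator_comp[OF e_operator_part e_operator_part]]]
        computable1_pair computable1_pfst computable1_psnd computable1_id computable1_const)
  fix \<psi> assume "\<psi> \<in> mjoin A (D_res A B)"
  then obtain f W g where \<psi>: "\<psi> = pjoin f (pjoin (zfun W) g)" "f \<in> A"
    and W: "\<forall>f\<in>A. \<exists>\<phi>\<in>B. apply_op W (gr (pjoin f g)) = gr \<phi>"
    unfolding mjoin_def D_res_def by blast
  have "?\<Phi> (gr \<psi>) = apply_op W (gr (pjoin f g))"
    by (simp add: \<psi>(1) apply_op_def gr_zfun zset_def gr_pjoin)
  then show "\<exists>\<phi>\<in>B. ?\<Phi> (gr \<psi>) = gr \<phi>" using W \<psi>(2) by simp
qed

lemma D_res_le: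
  assumes "D_le B (mjoin A C)" shows "D_le (D_res A B) C"
proof -
  obtain \<Phi> where \<Phi>: "e_operator \<Phi>" "\<And>\<psi>. \<psi> \<in> mjoin A C \<Longrightarrow> \<exists>\<phi>\<in>B. \<Phi> (gr \<psi>) = gr \<phi>" using assms by (rule D_leE) blast
  obtain W where W: "ce W" "\<And>X. \<Phi> X = apply_op W X"
    using \<Phi>(1) unfolding e_operator_def apply_op_def subset_eq by blast
  show ?thesis
  proof (rule D_leI)
    show "e_operator (\<lambda>X. jset (zset W) X)"
      using W(1) unfolding ce_iff_semidec
      by (intro e_operator_jset e_operator_const semidec_zset e_operator_id)
    fix g assume g: "g \<in> C"
    have "pjoin (zfun W) g \<in> D_res A B"
      unfolding D_res_def mem_Collect_eq
    proof (intro exI HOL.conjI ballI)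
      show "\<exists>\<phi>\<in>B. apply_op W (gr (pjoin f g)) = gr \<phi>" if "f \<in> A" for f
        using \<Phi>(2)[OF mjoinI[OF that g]] W(2) by simp
    qed simp
    then show "\<exists>\<phi>\<in>D_res A B. jset (zset W) (gr g) = gr \<phi>"
      by (intro bexI) (simp_all add: gr_pjoin gr_zfun)
  qed
qed

interpretation D: brouwer_preorder D_le mjoin D_meet D_res UNIV "{}"
proof
  fix A B C
  show "D_le A A" by (rule D_le_subset) simp
  show "D_le A B \<Longrightarrow> D_le B C \<Longrightarrow> D_le A C" by (rule D_le_trans)
  show "D_le (mjoin A B) C \<longleftrightarrow> D_le A C \<and> D_le B C"
    using D_le_mjoin D_mjoin_le D_le_trans by blast
  show "D_le C (D_meet A B) \<longleftrightarrow> D_le C A \<and> D_le C B"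
    using D_meet_le D_le_meet D_le_trans by blast
  show "D_le (D_res A B) C \<longleftrightarrow> D_le B (mjoin A C)"
  proof
    assume "D_le (D_res A B) C"
    then have "D_le (D_res A B) (mjoin A C)" by (rule D_le_trans[OF _ D_le_mjoin(2)])
    then have "D_le (mjoin A (D_res A B)) (mjoin A C)" by (rule D_mjoin_le[OF D_le_mjoin(1)])
    then show "D_le B (mjoin A C)" by (rule D_le_trans[OF D_le_mjoin_res])
  qed (rule D_res_le)
  show "D_le UNIV A" by (rule D_le_subset) simp
  show "D_le A {}" by (rule D_le_subset) simp
  show "\<not> D_le {} UNIV" unfolding D_le_iff by blast
qed

lemma D_top_join: "D_le {} (mjoin A B) \<Longrightarrow> D_le {} A \<or> D_le {} B"
  using mjoin_empty[of A B] unfolding D_le_iff by (metis all_not_in_conv)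


section \<open>The Dyment-Muchnik lattice\<close>

text \<open>The reduction may depend on the solution, so no operator has to be stored; for the same
  reason plain union serves as the meet.\<close>

definition Dw_res :: "mass_problem \<Rightarrow> mass_problem \<Rightarrow> mass_problem" where
  "Dw_res A B = {g. \<forall>f\<in>A. \<exists>\<phi>\<in>B. pfun_e_le \<phi> (pjoin f g)}"

lemma pfun_e_le_refl: "pfun_e_le f f"
  unfolding pfun_e_le_def by (rule e_le_refl)

lemma pfun_e_le_trans: "pfun_e_le f g \<Longrightarrow> pfun_e_le g h \<Longrightarrow> pfun_e_le f h"
  unfolding pfun_e_le_def by (rule e_le_trans)

lemma pfun_e_le_pjoin: "pfun_e_le f (pjoin f g)" "pfun_e_le g (pjoin f g)"
  unfolding pfun_e_le_def gr_pjoin by (rule e_le_jset_left, rule e_le_jset_right)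

lemma pjoin_e_le: "pfun_e_le f h \<Longrightarrow> pfun_e_le g h \<Longrightarrow> pfun_e_le (pjoin f g) h"
  unfolding pfun_e_le_def gr_pjoin by (rule e_le_jset)

lemma Dw_le_trans: "Dw_le A B \<Longrightarrow> Dw_le B C \<Longrightarrow> Dw_le A C"
  unfolding Dw_le_def using pfun_e_le_trans by meson

lemma Dw_le_subset: "B \<subseteq> A \<Longrightarrow> Dw_le A B"
  unfolding Dw_le_def using pfun_e_le_refl by blast

lemma Dw_le_mjoin: "Dw_le A (mjoin A B)" "Dw_le B (mjoin A B)"
  unfolding Dw_le_def by (auto elim!: mjoinE intro: pfun_e_le_pjoin)

lemma Dw_mjoin_le: "Dw_le A C \<Longrightarrow> Dw_le B C \<Longrightarrow> Dw_le (mjoin A B) C"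
  unfolding Dw_le_def using mjoinI pjoin_e_le by meson

interpretation Dw: brouwer_preorder Dw_le mjoin "(\<union>)" Dw_res UNIV "{}"
proof
  fix A B C
  show "Dw_le A A" by (rule Dw_le_subset) simp
  show "Dw_le A B \<Longrightarrow> Dw_le B C \<Longrightarrow> Dw_le A C" by (rule Dw_le_trans)
  show "Dw_le (mjoin A B) C \<longleftrightarrow> Dw_le A C \<and> Dw_le B C"
    using Dw_le_mjoin Dw_mjoin_le Dw_le_trans by blast
  show "Dw_le C (A \<union> B) \<longleftrightarrow> Dw_le C A \<and> Dw_le C B" unfolding Dw_le_def by blast
  show "Dw_le (Dw_res A B) C \<longleftrightarrow> Dw_le B (mjoin A C)"
  proof
    assume *: "Dw_le (Dw_res A B) C"
    have "Dw_le B (mjoin A (Dw_res A B))" unfolding Dw_le_def Dw_res_def by (auto elim!: mjoinE)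
    moreover have "Dw_le (mjoin A (Dw_res A B)) (mjoin A C)"
      by (rule Dw_mjoin_le[OF Dw_le_mjoin(1) Dw_le_trans[OF * Dw_le_mjoin(2)]])
    ultimately show "Dw_le B (mjoin A C)" by (rule Dw_le_trans)
  next
    assume "Dw_le B (mjoin A C)"
    then have "C \<subseteq> Dw_res A B" unfolding Dw_le_def Dw_res_def by (auto intro: mjoinI)
    then show "Dw_le (Dw_res A B) C" by (rule Dw_le_subset)
  qed
  show "Dw_le UNIV A" by (rule Dw_le_subset) simp
  show "Dw_le A {}" by (rule Dw_le_subset) simp
  show "\<not> Dw_le {} UNIV" unfolding Dw_le_def by blast
qed

lemma Dw_top_join: "Dw_le {} (mjoin A B) \<Longrightarrow> Dw_le {} A \<or> Dw_le {} B"
  using mjoin_empty[of A B] unfolding Dw_le_def by (metis all_not_in_conv)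


section \<open>Embedding the up-sets of finite cubes\<close>

lemma cube_problemI:
  "Z \<in> U \<Longrightarrow> finite Z \<Longrightarrow> (\<And>i. i \<in> Z \<Longrightarrow> \<not> e_le S (cobound i)) \<Longrightarrow>
    tag (set_encode Z) (zfun S) \<in> cube_problem U"
  unfolding cube_problem_def by blast

lemma cube_problemE:
  assumes "h \<in> cube_problem U"
  obtains Z S where "h = tag (set_encode Z) (zfun S)" "Z \<in> U" "finite Z"
    "\<And>i. i \<in> Z \<Longrightarrow> \<not> e_le S (cobound i)"
  using assms unfolding cube_problem_def by blast

lemma cube_problem_mono: "U \<subseteq> V \<Longrightarrow> cube_problem U \<subseteq> cube_problem V"
  unfolding cube_problem_def by blast

lemma cube_problem_empty: "cube_problem {} = {}"
  unfolding cube_problem_def by simp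

lemma set_encode_inj: "finite Z \<Longrightarrow> finite T \<Longrightarrow> set_encode Z = set_encode T \<Longrightarrow> Z = T"
  using set_encode_inverse by metis

lemma e_le_of_tag: "e_le (gr (tag k (zfun S))) X \<Longrightarrow> e_le S X"
  by (rule e_le_trans[OF tag_zfun_e_le])

lemma upset_finite: "finite N \<Longrightarrow> upset N U \<Longrightarrow> finite U"
  unfolding upset_def using finite_subset[of U "Pow N"] by simp

lemma upset_finite_mem: "finite N \<Longrightarrow> upset N U \<Longrightarrow> Z \<in> U \<Longrightarrow> finite Z"
  by (rule finite_subset[OF upset_subset])

text \<open>\<open>U\<close> and \<open>V\<close> are finite, so the branch to run is hardwired for
  each possible tag.\<close>

lemma D_cube_problem_union:
  assumes N: "finite N" and U: "upset N U" and V: "upset N V"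
    and "D_le C (cube_problem U)" "D_le C (cube_problem V)"
  shows "D_le C (cube_problem (U \<union> V))"
proof -
  obtain \<Phi> where \<Phi>: "e_operator \<Phi>" "\<And>\<psi>. \<psi> \<in> cube_problem U \<Longrightarrow> \<exists>\<phi>\<in>C. \<Phi> (gr \<psi>) = gr \<phi>"
    using assms(4) by (rule D_leE) blast
  obtain \<Psi> where \<Psi>: "e_operator \<Psi>" "\<And>\<psi>. \<psi> \<in> cube_problem V \<Longrightarrow> \<exists>\<phi>\<in>C. \<Psi> (gr \<psi>) = gr \<phi>"
    using assms(5) by (rule D_leE) blast
  have fin: "finite Z" if "Z \<in> U \<union> V" for Z
    using that upset_finite_mem[OF N U, of Z] upset_finite_mem[OF N V, of Z] by blast
  show ?thesis
  proof (rule D_le_cases[of "U \<union> V" "\<lambda>Z. if Z \<in> U then \<Phi> else \<Psi>" "\<lambda>Z X. tag_elem (set_encode Z) \<in> X"])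
    show "finite (U \<union> V)" using upset_finite[OF N] U V by simp
    show "enumerable (\<lambda>x X. tag_elem (set_encode Z) \<in> X)" for Z by (intro enumerable_mem computable1_const)
    fix \<psi> assume "\<psi> \<in> cube_problem (U \<union> V)"
    then obtain Z S where Z: "\<psi> = tag (set_encode Z) (zfun S)" "Z \<in> U \<union> V" "finite Z"
      "\<And>i. i \<in> Z \<Longrightarrow> \<not> e_le S (cobound i)" by (rule cube_problemE) blast
    have "tag_elem (set_encode T) \<in> gr \<psi> \<longleftrightarrow> T = Z" if "T \<in> U \<union> V" for T
      unfolding Z(1) tag_elem_mem using set_encode_inj[OF fin[OF that] Z(3)] by blast
    moreover have "\<exists>\<phi>\<in>C. (if Z \<in> U then \<Phi> else \<Psi>) (gr \<psi>) = gr \<phi>"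
    proof (cases "Z \<in> U")
      case True
      then have "\<psi> \<in> cube_problem U" unfolding Z(1) using Z(3,4) by (intro cube_problemI)
      then show ?thesis using True \<Phi>(2) by simp
    next
      case False
      then have "\<psi> \<in> cube_problem V" unfolding Z(1) using Z(2,3,4) by (intro cube_problemI) auto
      then show ?thesis using False \<Psi>(2) by simp
    qed
    ultimately show "\<exists>Z\<in>U \<union> V. tag_elem (set_encode Z) \<in> gr \<psi> \<and>
        (\<forall>T\<in>U \<union> V. tag_elem (set_encode T) \<in> gr \<psi> \<longrightarrow> T = Z) \<and>
        (\<exists>\<phi>\<in>C. (if Z \<in> U then \<Phi> else \<Psi>) (gr \<psi>) = gr \<phi>)"
      using Z(2) by (intro bexI[of _ Z]) simp_all
  qed (use \<Phi>(1) \<Psi>(1) in simp)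
qed

text \<open>Non-reducibility to b_i is inherited upwards, so any \<open>X\<close> above both sets
  solves the joint world, which belongs to both up-sets.\<close>

lemma tag_union_mem_cube_problem:
  assumes "finite N" "upset N U" "upset N V" "Z \<in> U" "T \<in> V"
    and "\<And>i. i \<in> Z \<Longrightarrow> \<not> e_le S (cobound i)" "e_le S X"
    and "\<And>i. i \<in> T \<Longrightarrow> \<not> e_le S' (cobound i)" "e_le S' X"
  shows "tag (set_encode (Z \<union> T)) (zfun X) \<in> cube_problem (U \<inter> V)"
proof (rule cube_problemI)
  have sub: "Z \<subseteq> N" "T \<subseteq> N" by (rule upset_subset[OF assms(2,4)], rule upset_subset[OF assms(3,5)])
  then show "finite (Z \<union> T)" using assms(1) by (auto intro: finite_subset)
  have "Z \<union> T \<in> U" using sub by (intro upset_mono[OF assms(2,4)]) auto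
  moreover have "Z \<union> T \<in> V" using sub by (intro upset_mono[OF assms(3,5)]) auto
  ultimately show "Z \<union> T \<in> U \<inter> V" by blast
  fix i assume "i \<in> Z \<union> T"
  then show "\<not> e_le X (cobound i)"
    using assms(6,8) e_le_trans[OF assms(7)] e_le_trans[OF assms(9)] by blast
qed

text \<open>The whole input graph serves as the new set, since both given solutions are reducible to
  it; only the pair of tags has to be waited for.\<close>

lemma D_cube_problem_inter:
  assumes N: "finite N" and U: "upset N U" and V: "upset N V"
    and "D_le (cube_problem U) C" "D_le (cube_problem V) C"
  shows "D_le (cube_problem (U \<inter> V)) C"
proof -
  obtain \<Phi> where \<Phi>: "e_operator \<Phi>" "\<And>\<psi>. \<psi> \<in> C \<Longrightarrow> \<exists>\<phi>\<in>cube_problem U. \<Phi> (gr \<psi>) = gr \<phi>"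
    using assms(4) by (rule D_leE) blast
  obtain \<Psi> where \<Psi>: "e_operator \<Psi>" "\<And>\<psi>. \<psi> \<in> C \<Longrightarrow> \<exists>\<phi>\<in>cube_problem V. \<Psi> (gr \<psi>) = gr \<phi>"
    using assms(5) by (rule D_leE) blast
  let ?K = "\<lambda>p X. tag_elem (set_encode (fst p)) \<in> \<Phi> X \<and> tag_elem (set_encode (snd p)) \<in> \<Psi> X"
  let ?T = "\<lambda>p X. jset {pair 0 (set_encode (fst p \<union> snd p))} (zset X)"
  show ?thesis
  proof (rule D_le_cases[of "U \<times> V" ?T ?K])
    show "finite (U \<times> V)" using upset_finite[OF N] U V by simp
    show "e_operator (?T p)" for p by (rule e_operator_tag)
    show "enumerable (\<lambda>x. ?K p)" for p
      by (intro enumerable_conj enumerable_op[OF \<Phi>(1)] enumerable_op[OF \<Psi>(1)] computable1_const)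
    fix \<psi> assume "\<psi> \<in> C"
    then obtain \<phi> \<chi> where "\<phi> \<in> cube_problem U" "\<Phi> (gr \<psi>) = gr \<phi>" "\<chi> \<in> cube_problem V" "\<Psi> (gr \<psi>) = gr \<chi>"
      using \<Phi>(2) \<Psi>(2) by blast
    then obtain Z S T S' where Z: "\<Phi> (gr \<psi>) = gr (tag (set_encode Z) (zfun S))" "Z \<in> U" "finite Z"
        "\<And>i. i \<in> Z \<Longrightarrow> \<not> e_le S (cobound i)"
      and T: "\<Psi> (gr \<psi>) = gr (tag (set_encode T) (zfun S'))" "T \<in> V" "finite T"
        "\<And>i. i \<in> T \<Longrightarrow> \<not> e_le S' (cobound i)"
      by (elim cube_problemE) blast
    have "e_le S (gr \<psi>)" by (rule e_le_of_tag) (use e_le_op[OF \<Phi>(1), of "gr \<psi>"] Z(1) in simp)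
    moreover have "e_le S' (gr \<psi>)" by (rule e_le_of_tag) (use e_le_op[OF \<Psi>(1), of "gr \<psi>"] T(1) in simp)
    ultimately have mem: "tag (set_encode (Z \<union> T)) (zfun (gr \<psi>)) \<in> cube_problem (U \<inter> V)"
      by (intro tag_union_mem_cube_problem[OF N U V Z(2) T(2) Z(4) _ T(4)])
    have K: "?K p (gr \<psi>) \<longleftrightarrow> p = (Z, T)" if "p \<in> U \<times> V" for p
    proof -
      have "finite (fst p)" "finite (snd p)" using that upset_finite_mem[OF N U] upset_finite_mem[OF N V] by auto
      then show ?thesis unfolding Z(1) T(1) tag_elem_mem
        using set_encode_inj[OF _ Z(3), of "fst p"] set_encode_inj[OF _ T(3), of "snd p"] by (auto simp: prod_eq_iff)
    qed
    show "\<exists>p\<in>U \<times> V. ?K p (gr \<psi>) \<and> (\<forall>q\<in>U \<times> V. ?K q (gr \<psi>) \<longrightarrow> q = p) \<and>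
        (\<exists>\<phi>\<in>cube_problem (U \<inter> V). ?T p (gr \<psi>) = gr \<phi>)"
    proof (intro bexI[of _ "(Z, T)"] HOL.conjI ballI impI)
      show "\<exists>\<phi>\<in>cube_problem (U \<inter> V). ?T (Z, T) (gr \<psi>) = gr \<phi>"
        by (rule bexI[OF _ mem]) (simp add: gr_tag gr_zfun)
    qed (use K K[of "(Z, T)"] Z(2) T(2) in simp_all)
  qed
qed

text \<open>
  Finite parts of functions with value \<open>0\<close> are compatible, so the tag of the result does not depend on \<open>S\<close>.
  It can be read off from the total function \<open>zfun UNIV\<close>, although \<open>UNIV\<close> itself is computable.
\<close>

lemma tag_independent:
  assumes \<Phi>: "e_operator \<Phi>" and Z: "Z \<in> U" "finite Z"
    and out: "\<And>h. h \<in> cube_problem U \<Longrightarrow> \<exists>T S. \<Phi> (jset (gr h) X) = gr (tag (set_encode T) (zfun S)) \<and> T \<in> V"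
    and T: "\<Phi> (jset (gr (tag (set_encode Z) (zfun (columns Z)))) X) = gr (tag (set_encode T) (zfun S))"
  shows "tag_elem k \<in> \<Phi> (jset (gr (tag (set_encode Z) (zfun UNIV))) X) \<longleftrightarrow> k = set_encode T"
proof
  let ?j = "\<lambda>S. jset (gr (tag (set_encode Z) (zfun S))) X"
  have mono: "\<Phi> (?j A) \<subseteq> \<Phi> (?j B)" if "A \<subseteq> B" for A B
    using that by (intro e_operator_mono[OF \<Phi>]) (auto simp: gr_tag gr_zfun jset_def zset_def)
  have "tag_elem (set_encode T) \<in> \<Phi> (?j (columns Z))" unfolding T tag_elem_mem ..
  then show "k = set_encode T \<Longrightarrow> tag_elem k \<in> \<Phi> (?j UNIV)" using mono[OF subset_UNIV] by blast
  assume "tag_elem k \<in> \<Phi> (?j UNIV)"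
  then obtain F where F: "F \<subseteq> ?j UNIV" "finite F" "tag_elem k \<in> \<Phi> F"
    using e_operator_finite[OF \<Phi>] by blast
  \<comment> \<open>If \<open>y\<close> is a point of the \<open>zfun\<close> component, this is the
    argument at which it asserts the value 0. Other points merely add harmless numbers, and
    \<open>?F\<close> stays finite.\<close>
  let ?F = "(\<lambda>y. psnd (psnd (pfst y))) ` F"
  have "F \<subseteq> ?j ?F"
  proof
    fix y assume "y \<in> F"
    then have "y \<in> ?j UNIV" "psnd (psnd (pfst y)) \<in> ?F" using F(1) by blast+
    then show "y \<in> ?j ?F" unfolding gr_tag gr_zfun jset_def zset_def by auto
  qed
  also have "\<dots> \<subseteq> ?j (columns Z \<union> ?F)"
    by (auto simp: gr_tag gr_zfun jset_def zset_def)
  finally have k: "tag_elem k \<in> \<Phi> (?j (columns Z \<union> ?F))" using F(3) e_operator_mono[OF \<Phi>] by blast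
  \<comment> \<open>Thus the enlarged set is still a solution. On it both tags appear in the graph
    of a single tagged function, which forces them to agree.\<close>
  have "\<not> e_le (columns Z \<union> ?F) (cobound i)" if "i \<in> Z" for i
    using columns_not_le[OF that] e_le_trans[OF e_le_finite_diff] F(2) by blast
  then have "tag (set_encode Z) (zfun (columns Z \<union> ?F)) \<in> cube_problem U"
    using Z by (intro cube_problemI)
  from out[OF this] obtain T' S' where T': "\<Phi> (?j (columns Z \<union> ?F)) = gr (tag (set_encode T') (zfun S'))" by blast
  have "tag_elem (set_encode T) \<in> \<Phi> (?j (columns Z \<union> ?F))"
    using \<open>tag_elem (set_encode T) \<in> \<Phi> (?j (columns Z))\<close> mono[of "columns Z" "columns Z \<union> ?F"] by blast
  then show "k = set_encode T" using k unfolding T' tag_elem_mem by simp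
qed

text \<open>The common end of both residual arguments: \<open>t\<close> records the worlds answered
  on the canonical solutions. In one lattice it is read off uniformly, in the other it is merely
  chosen.\<close>

lemma residual_mem_cube_problem:
  assumes N: "finite N" and U: "upset N U" and V: "upset N V"
    and t: "\<And>Z. Z \<in> U \<Longrightarrow> t Z \<in> V"
    and S: "\<And>Z i. Z \<in> U \<Longrightarrow> i \<in> t Z \<Longrightarrow> \<not> e_le (S Z) (cobound i)"
      "\<And>Z. Z \<in> U \<Longrightarrow> e_le (S Z) (jset (gr (tag (set_encode Z) (zfun (columns Z)))) X)"
  shows "tag (set_encode (\<Union>Z\<in>U. t Z - Z)) (zfun X) \<in> cube_problem {Y. Y \<subseteq> N \<and> (\<forall>Z\<in>U. Y \<union> Z \<in> V)}"
proof (rule cube_problemI)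
  have sub: "(\<Union>Z\<in>U. t Z - Z) \<subseteq> N" using t upset_subset[OF V] by blast
  then show "finite (\<Union>Z\<in>U. t Z - Z)" by (rule finite_subset[OF _ N])
  have "(\<Union>Z\<in>U. t Z - Z) \<union> T \<in> V" if "T \<in> U" for T
    using sub upset_subset[OF U that] that by (intro upset_mono[OF V t[OF that]]) auto
  then show "(\<Union>Z\<in>U. t Z - Z) \<in> {Y. Y \<subseteq> N \<and> (\<forall>Z\<in>U. Y \<union> Z \<in> V)}" using sub by blast
  fix i assume "i \<in> (\<Union>Z\<in>U. t Z - Z)"
  then obtain Z where Z: "Z \<in> U" "i \<in> t Z" "i \<notin> Z" by blast
  show "\<not> e_le X (cobound i)"
    by (rule not_le_cobound[OF S(2)[OF Z(1)] upset_finite_mem[OF N U Z(1)] Z(3) S(1)[OF Z(1,2)]])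
qed

lemma columns_mem_cube_problem:
  "Z \<in> U \<Longrightarrow> finite Z \<Longrightarrow> tag (set_encode Z) (zfun (columns Z)) \<in> cube_problem U"
  by (rule cube_problemI) (simp_all add: columns_not_le)

text \<open>The answers on all canonical solutions form one of finitely many functions from
  \<open>U\<close> to \<open>V\<close>, so this function can be the case to wait for.\<close>

lemma D_cube_problem_residual:
  assumes N: "finite N" and U: "upset N U" and V: "upset N V"
    and "D_le (cube_problem V) (mjoin (cube_problem U) C)"
  shows "D_le (cube_problem {Y. Y \<subseteq> N \<and> (\<forall>Z\<in>U. Y \<union> Z \<in> V)}) C"
proof -
  obtain \<Phi> where \<Phi>: "e_operator \<Phi>"
    and out: "\<And>\<psi>. \<psi> \<in> mjoin (cube_problem U) C \<Longrightarrow> \<exists>\<phi>\<in>cube_problem V. \<Phi> (gr \<psi>) = gr \<phi>"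
    using assms(4) by (rule D_leE) blast
  let ?j = "\<lambda>Z S X. jset (gr (tag (set_encode Z) (zfun S))) X"
  \<comment> \<open>\<open>UNIV\<close> replaces \<open>columns Z\<close>, which need not be
    enumerable from \<open>X\<close>. By \<open>tag_independent\<close> the same tags appear,
    although the output on \<open>UNIV\<close> need not otherwise be a graph.\<close>
  let ?K = "\<lambda>t X. \<forall>Z\<in>U. tag_elem (set_encode (t Z)) \<in> \<Phi> (?j Z UNIV X)"
  let ?T = "\<lambda>t X. jset {pair 0 (set_encode (\<Union>Z\<in>U. t Z - Z))} (zset X)"
  let ?I = "U \<rightarrow>\<^sub>E V"
  show ?thesis
  proof (rule D_le_cases[of ?I ?T ?K])
    show "finite ?I" using upset_finite[OF N] U V by (intro finite_PiE) auto
    show "e_operator (?T t)" for t by (rule e_operator_tag)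
    have "e_operator (\<lambda>X. \<Phi> (?j Z UNIV X))" for Z
    proof (rule e_operator_comp[OF \<Phi>], intro e_operator_jset e_operator_const e_operator_id)
      have "semidec (\<lambda>x. x \<in> UNIV)" by (simp add: semidec_dec dec_const)
      then have "e_operator (\<lambda>X. jset {pair 0 (set_encode Z)} (zset UNIV))"
        by (intro e_operator_jset e_operator_const[OF semidec_zset] e_operator_const[OF semidec_finite]) simp_all
      then have "enumerable (\<lambda>x X. x \<in> gr (tag (set_encode Z) (zfun UNIV)))"
        unfolding e_operator_iff gr_tag gr_zfun .
      then show "semidec (\<lambda>x. x \<in> gr (tag (set_encode Z) (zfun UNIV)))"
        using enumerable_semidec[OF _ computable1_id computable1_id] by blast
    qed
    then show "enumerable (\<lambda>x. ?K t)" for t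
      using upset_finite[OF N U] by (intro enumerable_finite_ball enumerable_op computable1_const)
    fix g assume g: "g \<in> C"
    have out': "\<exists>T S. \<Phi> (jset (gr h) (gr g)) = gr (tag (set_encode T) (zfun S)) \<and> T \<in> V \<and>
        (\<forall>i\<in>T. \<not> e_le S (cobound i))" if h: "h \<in> cube_problem U" for h
    proof -
      obtain \<phi> where "\<phi> \<in> cube_problem V" "\<Phi> (jset (gr h) (gr g)) = gr \<phi>"
        using out[OF mjoinI[OF h g]] unfolding gr_pjoin by blast
      then show ?thesis by (elim cube_problemE) auto
    qed
    have fin: "finite Z" if "Z \<in> U" for Z using upset_finite_mem[OF N U that] .
    have "\<forall>Z\<in>U. \<exists>T S. \<Phi> (?j Z (columns Z) (gr g)) = gr (tag (set_encode T) (zfun S)) \<and> T \<in> V \<and>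
        (\<forall>i\<in>T. \<not> e_le S (cobound i))"
      using out'[OF columns_mem_cube_problem] fin by blast
    then obtain T S where TS: "\<forall>Z\<in>U. \<Phi> (?j Z (columns Z) (gr g)) = gr (tag (set_encode (T Z)) (zfun (S Z))) \<and>
        T Z \<in> V \<and> (\<forall>i\<in>T Z. \<not> e_le (S Z) (cobound i))" by metis
    define t where "t = restrict T U"
    have tI: "t \<in> ?I" using TS unfolding t_def by auto
    have tZ: "t Z = T Z" if "Z \<in> U" for Z using that unfolding t_def by simp
    have elem: "tag_elem k \<in> \<Phi> (?j Z UNIV (gr g)) \<longleftrightarrow> k = set_encode (t Z)" if Z: "Z \<in> U" for Z k
      unfolding tZ[OF Z]
    proof (rule tag_independent[OF \<Phi> Z fin[OF Z]])
      show "\<exists>T S. \<Phi> (jset (gr h) (gr g)) = gr (tag (set_encode T) (zfun S)) \<and> T \<in> V"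
        if "h \<in> cube_problem U" for h using out'[OF that] by blast
      show "\<Phi> (?j Z (columns Z) (gr g)) = gr (tag (set_encode (T Z)) (zfun (S Z)))" using TS Z by blast
    qed
    have unique: "t' = t" if t': "t' \<in> ?I" "?K t' (gr g)" for t'
    proof (rule PiE_ext[OF t'(1) tI])
      fix Z assume Z: "Z \<in> U"
      then have "set_encode (t' Z) = set_encode (t Z)" using elem t'(2) by blast
      moreover have "t' Z \<in> V" "t Z \<in> V" using t'(1) tI Z by auto
      ultimately show "t' Z = t Z" using set_encode_inj upset_finite_mem[OF N V] by blast
    qed
    have "tag (set_encode (\<Union>Z\<in>U. t Z - Z)) (zfun (gr g)) \<in> cube_problem {Y. Y \<subseteq> N \<and> (\<forall>Z\<in>U. Y \<union> Z \<in> V)}"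
    proof (rule residual_mem_cube_problem[OF N U V])
      fix Z assume Z: "Z \<in> U"
      show "t Z \<in> V" using TS Z tZ by simp
      show "i \<in> t Z \<Longrightarrow> \<not> e_le (S Z) (cobound i)" for i using TS Z tZ by simp
      show "e_le (S Z) (?j Z (columns Z) (gr g))"
        by (rule e_le_of_tag[of "set_encode (T Z)"]) (use e_le_op[OF \<Phi>, of "?j Z (columns Z) (gr g)"] TS Z in simp)
    qed
    then have res: "\<exists>\<phi>\<in>cube_problem {Y. Y \<subseteq> N \<and> (\<forall>Z\<in>U. Y \<union> Z \<in> V)}. ?T t (gr g) = gr \<phi>"
      by (rule bexI[rotated]) (simp add: gr_tag gr_zfun)
    have Kt: "?K t (gr g)" using elem by simp
    show "\<exists>t\<in>?I. ?K t (gr g) \<and> (\<forall>t'\<in>?I. ?K t' (gr g) \<longrightarrow> t' = t) \<and>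
        (\<exists>\<phi>\<in>cube_problem {Y. Y \<subseteq> N \<and> (\<forall>Z\<in>U. Y \<union> Z \<in> V)}. ?T t (gr g) = gr \<phi>)"
      by (rule bexI[OF _ tI], rule HOL.conjI[OF Kt], rule HOL.conjI[OF _ res], intro ballI impI) (rule unique)
  qed
qed

text \<open>A c.e. graph yields a set reducible to every b_i, so its world can contain no i.\<close>

lemma empty_mem_of_computable:
  assumes "\<phi> \<in> cube_problem U" "e_le (gr \<phi>) {}" shows "{} \<in> U"
proof -
  obtain Z S where Z: "\<phi> = tag (set_encode Z) (zfun S)" "Z \<in> U" "\<And>i. i \<in> Z \<Longrightarrow> \<not> e_le S (cobound i)"
    using assms(1) by (rule cube_problemE) blast
  have "e_le S (cobound i)" for i
    using e_le_trans[OF e_le_of_tag e_le_empty] assms(2) Z(1) by blast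
  then have "Z = {}" using Z(3) by blast
  then show ?thesis using Z(2) by simp
qed

lemma gr_empty: "gr Map.empty = {}"
  by (auto simp: mem_gr)

lemma Th_Dyment_subset: "Th (degrees D_le) \<subseteq> JAN"
proof (rule D.Th_subset_JAN[of cube_problem])
  show "{} \<in> U" if le: "D_le (cube_problem U) UNIV" for U
  proof -
    obtain \<Phi> where "e_operator \<Phi>" and out: "\<forall>\<psi>\<in>UNIV. \<exists>\<phi>\<in>cube_problem U. \<Phi> (gr \<psi>) = gr \<phi>"
      using le unfolding D_le_iff by blast
    moreover obtain \<phi> where "\<phi> \<in> cube_problem U" "\<Phi> (gr Map.empty) = gr \<phi>"
      using bspec[OF out UNIV_I] by blast
    \<comment> \<open>\<open>UNIV\<close> contains the empty function, whose graph carries no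
      information, so the answer to it has a c.e. graph.\<close>
    ultimately show ?thesis using empty_mem_of_computable[of \<phi>] e_le_op[of \<Phi> "{}"] by (simp add: gr_empty)
  qed
qed (simp_all add: D_le_subset cube_problem_mono cube_problem_empty D_cube_problem_union
    D_cube_problem_inter D_cube_problem_residual)

section \<open>The embedding for nonuniform reducibility\<close>

lemma Dw_cube_problem_inter:
  assumes N: "finite N" and U: "upset N U" and V: "upset N V"
    and "Dw_le (cube_problem U) C" "Dw_le (cube_problem V) C"
  shows "Dw_le (cube_problem (U \<inter> V)) C"
  unfolding Dw_le_def
proof
  fix \<psi> assume "\<psi> \<in> C"
  then obtain \<phi> \<chi> where "\<phi> \<in> cube_problem U" "e_le (gr \<phi>) (gr \<psi>)" "\<chi> \<in> cube_problem V" "e_le (gr \<chi>) (gr \<psi>)"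
    using assms(4,5) unfolding Dw_le_def pfun_e_le_def by blast
  then obtain Z S T S' where Z: "e_le (gr (tag (set_encode Z) (zfun S))) (gr \<psi>)" "Z \<in> U"
      "\<And>i. i \<in> Z \<Longrightarrow> \<not> e_le S (cobound i)"
    and T: "e_le (gr (tag (set_encode T) (zfun S'))) (gr \<psi>)" "T \<in> V"
      "\<And>i. i \<in> T \<Longrightarrow> \<not> e_le S' (cobound i)"
    by (elim cube_problemE) blast
  have "tag (set_encode (Z \<union> T)) (zfun (gr \<psi>)) \<in> cube_problem (U \<inter> V)"
    by (rule tag_union_mem_cube_problem[OF N U V Z(2) T(2) Z(3) e_le_of_tag[OF Z(1)] T(3) e_le_of_tag[OF T(1)]])
  then show "\<exists>\<phi>\<in>cube_problem (U \<inter> V). pfun_e_le \<phi> \<psi>"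
    unfolding pfun_e_le_def using e_le_tag_zfun by blast
qed

lemma Dw_cube_problem_residual:
  assumes N: "finite N" and U: "upset N U" and V: "upset N V"
    and le: "Dw_le (cube_problem V) (mjoin (cube_problem U) C)"
  shows "Dw_le (cube_problem {Y. Y \<subseteq> N \<and> (\<forall>Z\<in>U. Y \<union> Z \<in> V)}) C"
  unfolding Dw_le_def
proof
  fix g assume g: "g \<in> C"
  let ?j = "\<lambda>Z. jset (gr (tag (set_encode Z) (zfun (columns Z)))) (gr g)"
  have "\<exists>T S. T \<in> V \<and> (\<forall>i\<in>T. \<not> e_le S (cobound i)) \<and> e_le S (?j Z)" if Z: "Z \<in> U" for Z
  proof -
    have "pjoin (tag (set_encode Z) (zfun (columns Z))) g \<in> mjoin (cube_problem U) C"
      by (rule mjoinI[OF columns_mem_cube_problem[OF Z upset_finite_mem[OF N U Z]] g])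
    then obtain \<phi> where \<phi>: "\<phi> \<in> cube_problem V" "e_le (gr \<phi>) (?j Z)"
      using le unfolding Dw_le_def pfun_e_le_def gr_pjoin[symmetric] by blast
    from \<phi>(1) obtain T S where T: "\<phi> = tag (set_encode T) (zfun S)" "T \<in> V" "\<And>i. i \<in> T \<Longrightarrow> \<not> e_le S (cobound i)"
      by (rule cube_problemE) blast
    have "e_le S (?j Z)" by (rule e_le_of_tag) (use \<phi>(2) T(1) in blast)
    then show ?thesis using T(2,3) by blast
  qed
  then obtain T S where TS: "\<And>Z. Z \<in> U \<Longrightarrow> T Z \<in> V \<and> (\<forall>i\<in>T Z. \<not> e_le (S Z) (cobound i)) \<and> e_le (S Z) (?j Z)"
    by metis
  have "tag (set_encode (\<Union>Z\<in>U. T Z - Z)) (zfun (gr g)) \<in> cube_problem {Y. Y \<subseteq> N \<and> (\<forall>Z\<in>U. Y \<union> Z \<in> V)}"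
    by (rule residual_mem_cube_problem[OF N U V, of T S]) (use TS in blast)+
  then show "\<exists>\<phi>\<in>cube_problem {Y. Y \<subseteq> N \<and> (\<forall>Z\<in>U. Y \<union> Z \<in> V)}. pfun_e_le \<phi> g"
    unfolding pfun_e_le_def using e_le_tag_zfun by blast
qed

lemma Dw_cube_problem_union:
  assumes "Dw_le C (cube_problem U)" "Dw_le C (cube_problem V)"
  shows "Dw_le C (cube_problem (U \<union> V))"
proof -
  have "cube_problem (U \<union> V) = cube_problem U \<union> cube_problem V" unfolding cube_problem_def by blast
  then show ?thesis using assms unfolding Dw_le_def by auto
qed

lemma Th_Dyment_Muchnik_subset: "Th (degrees Dw_le) \<subseteq> JAN"
proof (rule Dw.Th_subset_JAN[of cube_problem])
  show "{} \<in> U" if le: "Dw_le (cube_problem U) UNIV" for U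
  proof -
    have "\<exists>\<phi>\<in>cube_problem U. pfun_e_le \<phi> Map.empty" using le unfolding Dw_le_def by (rule bspec) simp
    then obtain \<phi> where "\<phi> \<in> cube_problem U" "e_le (gr \<phi>) {}"
      unfolding pfun_e_le_def gr_empty by blast
    then show ?thesis by (rule empty_mem_of_computable)
  qed
qed (simp_all add: Dw_le_subset cube_problem_mono cube_problem_empty Dw_cube_problem_union
    Dw_cube_problem_inter Dw_cube_problem_residual)

theorem theorem6p1:
  shows "Th \<M>\<^sub>D = Th \<M>\<^sub>D\<^sub>w \<and> Th \<M>\<^sub>D\<^sub>w = JAN"
  using D.JAN_sound[OF D_top_join] Th_Dyment_subset Dw.JAN_sound[OF Dw_top_join] Th_Dyment_Muchnik_subset
  unfolding Dyment_lattice_def Dyment_Muchnik_lattice_def by blast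

end
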